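(* Let $n\ge3$, and let $\Lambda_0,\dots,\Lambda_n$ be the fundamental weights and $\alpha_0,\dots,\alpha_n$ the simple roots of $B_n^{(1)}$. Let $\delta=\alpha_0+\alpha_1+2\alpha_2+\cdots+2\alpha_n$ be the null root. Set $$q=e^{-\delta/2},\quad c_0=1,\quad\text{and}\quad c_i=e^{\alpha_i+\cdots+\alpha_{n-1}+\alpha_n}\ \text{ for all } i\in\{1,\dots,n\}.$$ Then $$\begin{aligned}e^{-\Lambda_0}\mathrm{ch}(L(\Lambda_0))&=\mathcal E_{c_0,c_1,\dots,c_n}\Big((-c_0q;q^2)_\infty\prod_{k=1}^n(-c_kq;q^2)_\infty(-c_k^{-1}q;q^2)_\infty\Big)\\&=\frac12\Big((-q;q^2)_\infty\prod_{k=1}^n(-c_kq;q^2)_\infty(-c_k^{-1}q;q^2)_\infty+(q;q^2)_\infty\prod_{k=1}^n(c_kq;q^2)_\infty(c_k^{-1}q;q^2)_\infty\Big),\end{aligned}$$ $$\begin{aligned}e^{-\Lambda_1}\mathrm{ch}(L(\Lambda_1))&=\mathcal E_{c_0,c_1,\dots,c_n}\Big((-c_0q;q^2)_\infty(-c_1q^3;q^2)_\infty(-c_1^{-1}q^{-1};q^2)_\infty\prod_{k=2}^n(-c_kq;q^2)_\infty(-c_k^{-1}q;q^2)_\infty\Big)\\&=\frac12\Big((-q;q^2)_\infty(-c_1q^3;q^2)_\infty(-c_1^{-1}q^{-1};q^2)_\infty\prod_{k=2}^n(-c_kq;q^2)_\infty(-c_k^{-1}q;q^2)_\infty\\&\q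quad+(q;q^2)_\infty(c_1q^3;q^2)_\infty(c_1^{-1}q^{-1};q^2)_\infty\prod_{k=2}^n(c_kq;q^2)_\infty(c_k^{-1}q;q^2)_\infty\Big).\end{aligned}$$
   Context: $L(\lambda)$ denotes the irreducible highest weight module of highest weight $\lambda$ over the affine Kac--Moody algebra, and $\mathrm{ch}(L(\lambda))=\sum_\mu\dim L(\lambda)_\mu\,e^\mu$, where $e^\mu$ are formal exponentials with $e^\mu e^\nu=e^{\mu+\nu}$ (rational combinations of roots allowed in exponents). $(a;q)_\infty=\prod_{k\ge0}(1-aq^k)$. Labelling of $B_n^{(1)}$ ($n\ge 3$): nodes $0$ and $1$ are both joined to node $2$ by simple edges when $n>3$ or $n=3$, nodes $2,3,\dots,n-1$ form a simply-laced chain, and nodes $n-1,n$ are joined by a double edge with $\alpha_n$ the short root, i.e. $\alpha_{n-1}(h_n)=-2$, $\alpha_n(h_{n-1})=-1$, where $h_i$ are the simple coroots. For a (Laurent-type) power series $G=G(x_1,\dots,x_m)$ and $k\le m$, $\mathcal E_{x_1,\dots,x_k}(G)$ is the sub-series of $G$ consisting of the terms in which the sum of the powers of $x_1,\dots,x_k$ is even; equivalently $\mathcal E_{x_1,\dots,x_k}(G)=\frac12\big(G(x_1,\dots,x_k,x_{k+1},\dots,x_m)+G(-x_1,\dots,-x_k,x_{k+1},\dots,x_m)\big)$. Here $c_0,c_1,\dots,c_n,q$ are treated as independent variables when applying $\mathcal E_{c_0,c_1,\dots,c_n}$, and the value $c_0=1$ is substituted afterwards. *)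

theory Defs
  imports
    Complex_Main
    "HOL-Library.Function_Algebras"
    "HOL-Library.Poly_Mapping"
    "HOL-Computational_Algebra.Formal_Laurent_Series"
begin

section \<open>Lie algebras and their modules\<close>

locale lie_algebra = vector_space scale
  for scale :: "complex \<Rightarrow> 'g::ab_group_add \<Rightarrow> 'g" +
  fixes bracket :: "'g \<Rightarrow> 'g \<Rightarrow> 'g"
  assumes linear_left: "Vector_Spaces.linear scale scale (\<lambda>x. bracket x y)"
    and linear_right: "Vector_Spaces.linear scale scale (\<lambda>y. bracket x y)"
    and bracket_self: "bracket x x = 0"
    and jacobi: "bracket x (bracket y z) + bracket y (bracket z x) + bracket z (bracket x y) = 0"
begin

definition lie_subalgebra :: "'g set \<Rightarrow> bool" where
  "lie_subalgebra S \<longleftrightarrow> subspace S \<and> (\<forall>x\<in>S. \<forall>y\<in>S. bracket x y \<in> S)"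

definition lie_ideal :: "'g set \<Rightarrow> bool" where
  "lie_ideal J \<longleftrightarrow> subspace J \<and> (\<forall>x. \<forall>y\<in>J. bracket x y \<in> J)"

end

locale lie_module = g: lie_algebra scale bracket + V: vector_space scaleV
  for scale :: "complex \<Rightarrow> 'g::ab_group_add \<Rightarrow> 'g"
    and bracket :: "'g \<Rightarrow> 'g \<Rightarrow> 'g"
    and scaleV :: "complex \<Rightarrow> 'v::ab_group_add \<Rightarrow> 'v" +
  fixes act :: "'g \<Rightarrow> 'v \<Rightarrow> 'v"
  assumes act_linear_left: "Vector_Spaces.linear scale scaleV (\<lambda>x. act x v)"
    and act_linear_right: "Vector_Spaces.linear scaleV scaleV (act x)"
    and act_bracket: "act (bracket x y) v = act x (act y v) - act y (act x v)"
begin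

definition submodule :: "'v set \<Rightarrow> bool" where
  "submodule W \<longleftrightarrow> V.subspace W \<and> (\<forall>x. \<forall>w\<in>W. act x w \<in> W)"

end


section \<open>Cartan datum of type \<open>B\<^sub>n\<^sup>(\<^sup>1\<^sup>)\<close>\<close>

text \<open>The entry at \<open>(i, j)\<close> is \<open>\<alpha>\<^sub>j(h\<^sub>i)\<close>.  For \<open>n \<ge> 3\<close> the edges of the Dynkin diagram are
  \<open>{0, 2}\<close> and \<open>{k, k + 1}\<close> for \<open>1 \<le> k < n\<close>; the last one is the double edge.\<close>

definition cartan_B1 :: "nat \<Rightarrow> nat \<Rightarrow> nat \<Rightarrow> int" where
  "cartan_B1 n i j =
     (if n < i \<or> n < j then 0
      else if i = j then 2
      else if i = n \<and> j = n - 1 then -2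
      else if {i, j} = {0, 2} \<or> (\<exists>k. 1 \<le> k \<and> k < n \<and> {i, j} = {k, k + 1}) then -1
      else 0)"

text \<open>The Cartan subalgebra has the basis \<open>h\<^sub>0, \<dots>, h\<^sub>n, d\<close> with \<open>d\<close> the scaling element,
  \<open>\<alpha>\<^sub>j(d) = \<delta>\<^sub>j\<^sub>0\<close>.  An element of its dual is given by its values on this basis; a weight for
  \<open>B\<^sub>n\<^sup>(\<^sup>1\<^sup>)\<close> vanishes at the unused indices \<open>Coroot i\<close> with \<open>i > n\<close>.\<close>

datatype cartan_index = Coroot nat | Scaling

type_synonym weight = "cartan_index \<Rightarrow> complex"

definition cartan_indices :: "nat \<Rightarrow> cartan_index set" where
  "cartan_indices n = insert Scaling (Coroot ` {..n})"

definition weights :: "nat \<Rightarrow> weight set" where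
  "weights n = {\<mu>. \<forall>b. b \<notin> cartan_indices n \<longrightarrow> \<mu> b = 0}"

definition wscale :: "complex \<Rightarrow> weight \<Rightarrow> weight" where
  "wscale c \<mu> = (\<lambda>b. c * \<mu> b)"

definition simple_root :: "nat \<Rightarrow> nat \<Rightarrow> weight" where
  "simple_root n j b =
     (case b of Coroot i \<Rightarrow> of_int (cartan_B1 n i j) | Scaling \<Rightarrow> (if j = 0 then 1 else 0))"

definition fundamental_weight :: "nat \<Rightarrow> weight" where
  "fundamental_weight j b =
     (case b of Coroot i \<Rightarrow> (if i = j then 1 else 0) | Scaling \<Rightarrow> 0)"

definition null_root :: "nat \<Rightarrow> weight" where
  "null_root n = simple_root n 0 + simple_root n 1 + wscale 2 (\<Sum>i=2..n. simple_root n i)"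

primrec cartan_element :: "(nat \<Rightarrow> 'g) \<Rightarrow> 'g \<Rightarrow> cartan_index \<Rightarrow> 'g" where
  "cartan_element h d (Coroot i) = h i"
| "cartan_element h d Scaling = d"


section \<open>The affine Kac--Moody algebra and its irreducible highest weight modules\<close>

text \<open>The algebra is pinned down up to isomorphism as in Kac's definition: it is generated by
  \<open>e\<^sub>i, f\<^sub>i\<close> and the Cartan subalgebra subject to the Chevalley relations, the Cartan subalgebra
  embeds, and every ideal meeting it trivially has been divided out.  (By the Gabber--Kac theorem
  this is the same as imposing the Serre relations.)\<close>

locale affine_B_algebra = lie_algebra scale bracket
  for scale :: "complex \<Rightarrow> 'g::ab_group_add \<Rightarrow> 'g"
    and bracket :: "'g \<Rightarrow> 'g \<Rightarrow> 'g" +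
  fixes n :: nat and h :: "nat \<Rightarrow> 'g" and d :: 'g and e f :: "nat \<Rightarrow> 'g"
  assumes cartan_inj: "inj_on (cartan_element h d) (cartan_indices n)"
    and cartan_independent: "independent (cartan_element h d ` cartan_indices n)"
    and cartan_abelian:
      "\<lbrakk>b \<in> cartan_indices n; b' \<in> cartan_indices n\<rbrakk>
        \<Longrightarrow> bracket (cartan_element h d b) (cartan_element h d b') = 0"
    and bracket_e_f:
      "\<lbrakk>i \<le> n; j \<le> n\<rbrakk> \<Longrightarrow> bracket (e i) (f j) = (if i = j then h i else 0)"
    and bracket_cartan_e:
      "\<lbrakk>b \<in> cartan_indices n; j \<le> n\<rbrakk>
        \<Longrightarrow> bracket (cartan_element h d b) (e j) = scale (simple_root n j b) (e j)"
    and bracket_cartan_f: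
      "\<lbrakk>b \<in> cartan_indices n; j \<le> n\<rbrakk>
        \<Longrightarrow> bracket (cartan_element h d b) (f j) = scale (- simple_root n j b) (f j)"
    and generated:
      "\<lbrakk>lie_subalgebra S; e ` {..n} \<subseteq> S; f ` {..n} \<subseteq> S;
        cartan_element h d ` cartan_indices n \<subseteq> S\<rbrakk> \<Longrightarrow> S = UNIV"
    and no_ideal_avoiding_cartan:
      "\<lbrakk>lie_ideal J; J \<inter> span (cartan_element h d ` cartan_indices n) = {0}\<rbrakk> \<Longrightarrow> J = {0}"

text \<open>A module satisfying the following locale is, up to isomorphism, \<open>L(\<Lambda>)\<close>.\<close>

locale affine_B_irreducible_hw_module =
  affine_B_algebra scale bracket n h d e f + lie_module scale bracket scaleV act
  for scale :: "complex \<Rightarrow> 'g::ab_group_add \<Rightarrow> 'g"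
    and bracket :: "'g \<Rightarrow> 'g \<Rightarrow> 'g"
    and n :: nat and h :: "nat \<Rightarrow> 'g" and d :: 'g and e f :: "nat \<Rightarrow> 'g"
    and scaleV :: "complex \<Rightarrow> 'v::ab_group_add \<Rightarrow> 'v"
    and act :: "'g \<Rightarrow> 'v \<Rightarrow> 'v" +
  fixes \<Lambda> :: weight
  assumes irreducible: "submodule W \<Longrightarrow> W = {0} \<or> W = UNIV"
    and highest_weight_vector:
      "\<exists>v. v \<noteq> 0 \<and> (\<forall>i\<le>n. act (e i) v = 0) \<and>
        (\<forall>b\<in>cartan_indices n. act (cartan_element h d b) v = scaleV (\<Lambda> b) v) \<and>
        (\<forall>W. submodule W \<and> v \<in> W \<longrightarrow> W = UNIV)"

definition weight_space ::
  "nat \<Rightarrow> (nat \<Rightarrow> 'g) \<Rightarrow> 'g \<Rightarrow> (complex \<Rightarrow> 'v \<Rightarrow> 'v) \<Rightarrow> ('g \<Rightarrow> 'v \<Rightarrow> 'v) \<Rightarrow> weight \<Rightarrow> 'v set" where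
  "weight_space n h d scaleV act \<mu> =
     {v. \<forall>b\<in>cartan_indices n. act (cartan_element h d b) v = scaleV (\<mu> b) v}"


section \<open>Formal exponential series\<close>

text \<open>The series \<open>\<Sum>\<^sub>\<mu> F(\<mu>) e\<^sup>\<mu>\<close> is represented by its coefficient function \<open>F\<close>.\<close>

type_synonym exp_series = "weight \<Rightarrow> rat"

text \<open>Weight spaces of a highest weight module are finite-dimensional, so the convention that
  \<open>dim\<close> is \<open>0\<close> in infinite dimension plays no role for \<open>L(\<Lambda>)\<close>.\<close>

definition character ::
  "nat \<Rightarrow> (nat \<Rightarrow> 'g) \<Rightarrow> 'g \<Rightarrow> (complex \<Rightarrow> 'v::ab_group_add \<Rightarrow> 'v) \<Rightarrow> ('g \<Rightarrow> 'v \<Rightarrow> 'v) \<Rightarrow> exp_series"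
  where
  "character n h d scaleV act \<mu> =
     (if \<mu> \<in> weights n then of_nat (vector_space.dim scaleV (weight_space n h d scaleV act \<mu>))
      else 0)"

text \<open>Multiplication by \<open>e\<^sup>\<nu>\<close>.\<close>

definition exp_times :: "weight \<Rightarrow> exp_series \<Rightarrow> exp_series" where
  "exp_times \<nu> F = (\<lambda>\<mu>. F (\<mu> - \<nu>))"


section \<open>Series in the independent variables \<open>c\<^sub>0, c\<^sub>1, \<dots>\<close> and \<open>q\<close>\<close>

text \<open>Laurent polynomials in the \<open>c\<^sub>k\<close>, indexed by exponent vectors, and formal Laurent series
  in \<open>q\<close> over them.\<close>

type_synonym laurent_poly = "(nat \<Rightarrow>\<^sub>0 int) \<Rightarrow>\<^sub>0 rat"

type_synonym cq_series = "laurent_poly fls"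

definition c_pow :: "nat \<Rightarrow> int \<Rightarrow> cq_series" where
  "c_pow k m = fls_const (Poly_Mapping.single (Poly_Mapping.single k m) 1)"

definition q_pow :: "int \<Rightarrow> cq_series" where
  "q_pow m = fls_X_intpow m"

definition rat_const :: "rat \<Rightarrow> cq_series" where
  "rat_const r = fls_const (Poly_Mapping.single 0 r)"

text \<open>The limit is taken in the \<open>q\<close>-adic topology.\<close>

definition qpochhammer_inf :: "cq_series \<Rightarrow> cq_series \<Rightarrow> cq_series" where
  "qpochhammer_inf a p = lim (\<lambda>N. \<Prod>k<N. 1 - a * p ^ k)"

abbreviation qp2 :: "cq_series \<Rightarrow> cq_series" where
  "qp2 a \<equiv> qpochhammer_inf a (q_pow 2)"

text \<open>The operator \<open>\<E>\<close> for the variables \<open>c\<^sub>k\<close> with \<open>k \<in> X\<close>.\<close>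

definition even_part_poly :: "nat set \<Rightarrow> laurent_poly \<Rightarrow> laurent_poly" where
  "even_part_poly X p =
     (\<Sum>a | a \<in> Poly_Mapping.keys p \<and> even (\<Sum>k\<in>X. Poly_Mapping.lookup a k).
        Poly_Mapping.single a (Poly_Mapping.lookup p a))"

definition even_part :: "nat set \<Rightarrow> cq_series \<Rightarrow> cq_series" where
  "even_part X G = Abs_fls (\<lambda>m. even_part_poly X (fls_nth G m))"

lemma lookup_even_part_poly:
  "Poly_Mapping.lookup (even_part_poly X p) a =
     (if even (\<Sum>k\<in>X. Poly_Mapping.lookup a k) then Poly_Mapping.lookup p a else 0)"
proof -
  have fin: "finite {a. a \<in> Poly_Mapping.keys p \<and> even (\<Sum>k\<in>X. Poly_Mapping.lookup a k)}"
    by simp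
  have "Poly_Mapping.lookup (even_part_poly X p) a =
      (\<Sum>b | b \<in> Poly_Mapping.keys p \<and> even (\<Sum>k\<in>X. Poly_Mapping.lookup b k).
         if b = a then Poly_Mapping.lookup p b else 0)"
    unfolding even_part_poly_def lookup_sum
    by (intro sum.cong refl) (simp add: lookup_single when_def)
  also have "\<dots> = (if even (\<Sum>k\<in>X. Poly_Mapping.lookup a k) then Poly_Mapping.lookup p a else 0)"
    using fin by (simp add: sum.delta in_keys_iff)
  finally show ?thesis .
qed

lemma fls_nth_even_part: "fls_nth (even_part X G) m = even_part_poly X (fls_nth G m)"
proof -
  have "\<forall>\<^sub>\<infinity>k::nat. fls_nth G (- int k) = 0"
    using fls_nth[of G] by simp
  then have "\<forall>\<^sub>\<infinity>k::nat. even_part_poly X (fls_nth G (- int k)) = 0"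
    by (rule eventually_mono) (simp add: even_part_poly_def)
  then show ?thesis
    by (simp add: even_part_def Abs_fls_inverse)
qed

text \<open>The substitution \<open>q = e\<^bsup>-\<delta>/2\<^esup>\<close>, \<open>c\<^sub>0 = 1 = e\<^sup>0\<close>,
  \<open>c\<^sub>i = e\<^bsup>\<alpha>\<^sub>i + \<dots> + \<alpha>\<^sub>n\<^esup>\<close>: the monomial \<open>q\<^sup>m c\<^sup>a\<close> becomes the formal exponential with exponent
  \<open>monomial_weight n m a\<close>.  For a given \<open>\<mu>\<close> only finitely many monomials
  of a series (in \<open>c\<^sub>0, \<dots>, c\<^sub>n, q\<close>) contribute, since \<open>\<delta>, \<alpha>\<^sub>1, \<dots>, \<alpha>\<^sub>n\<close> are linearly independent and
  each coefficient of \<open>q\<^sup>m\<close> is a Laurent polynomial.\<close>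

definition c_weight :: "nat \<Rightarrow> nat \<Rightarrow> weight" where
  "c_weight n i = (if i = 0 then 0 else \<Sum>j=i..n. simple_root n j)"

definition q_weight :: "nat \<Rightarrow> weight" where
  "q_weight n = wscale (- 1 / 2) (null_root n)"

definition monomial_weight :: "nat \<Rightarrow> int \<Rightarrow> (nat \<Rightarrow>\<^sub>0 int) \<Rightarrow> weight" where
  "monomial_weight n m a =
     wscale (of_int m) (q_weight n) +
     (\<Sum>i=0..n. wscale (of_int (Poly_Mapping.lookup a i)) (c_weight n i))"

definition specialize :: "nat \<Rightarrow> cq_series \<Rightarrow> exp_series" where
  "specialize n G \<mu> =
     (\<Sum>(m, a) | Poly_Mapping.lookup (fls_nth G m) a \<noteq> 0 \<and> monomial_weight n m a = \<mu>.
        Poly_Mapping.lookup (fls_nth G m) a)"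

end

theory Submission
  imports Defs "HOL-Library.Countable" "HOL-Library.Groups_Big_Fun"
begin

text \<open>The weight multiplicities are read off from a fermionic Fock space with neutral fermion modes
  \<open>\<psi>\<^sub>a(k)\<close>, \<open>-n \<le> a \<le> n\<close>, whose basis states are the finite sets of creation modes; the product
  \<open>(-c\<^sub>0q;q\<^sup>2) \<Prod> (-c\<^sub>kq;q\<^sup>2)(-c\<^sub>k\<^sup>-\<^sup>1q;q\<^sup>2)\<close> enumerates these sets by weight. Quadratic expressions in the
  modes satisfy the Chevalley relations of \<open>B\<^sub>n\<^sup>(\<^sup>1\<^sup>)\<close>, and \<open>f\<^sub>i\<close> is a positive multiple of the adjoint of
  \<open>e\<^sub>i\<close>. The crux is that a singular vector is the vacuum or the state \<open>\<psi>\<^sub>1(-1)|0\<rangle>\<close>: it is killed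
  by the positive halves of \<open>n\<close> commuting Heisenberg algebras, hence is a shifted vacuum for each
  charged pair of fermions, and dominance of its weight leaves only two possible shifts. So the even
  and odd parts are irreducible with highest weights \<open>\<Lambda>\<^sub>0\<close> and \<open>\<Lambda>\<^sub>1\<close> (up to \<open>\<delta>\<close>). Only the Chevalley
  relations enter the comparison with \<open>L(\<Lambda>)\<close>, because an irreducible highest weight module is determined
  by its highest weight already over the algebra defined by these relations.\<close>

section \<open>Weights\<close>

text \<open>The colours from -n to n stand for the weights of the vector representation of so(2n+1):
  \<open>\<epsilon>\<^sub>i\<close>, its negative and 0, where \<open>c\<^sub>i\<close> is the
  exponential of \<open>\<epsilon>\<^sub>i\<close>. Modes are half-integral, so a fermion
  contributes an odd power of q. The quadratic operators are the currents of so(2n+1); as infinite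
  sums they need normal ordering only in the Cartan direction and degree 0. There the diagonal
  operators \<open>charge\<close> replace them, and the only central term to be computed is the one
  between \<open>e_op\<close> and \<open>f_op\<close> at the same node. The module is given
  abstractly, with no map to or from the Fock space. Hence the isomorphism is built as a relation
  generated by the pair of highest weight vectors. That zero on one side forces zero on the other is
  proved separately in each direction: irreducibility serves the abstract module, the list of
  singular vectors serves the Fock space. Exhaustion of the Fock sector comes from the Hermitian
  form. The vacuum weight \<open>\<kappa>\<close> stays a parameter, because the top of the odd
  sector lies half a null root away from the normalised weight of node 1.\<close>

lemma wscale_apply [simp]: "wscale c \<mu> b = c * \<mu> b"
  by (simp add: wscale_def)

lemma fun_sum_apply: "(\<Sum>i\<in>A. f i) x = (\<Sum>i\<in>A. f i x)" for f :: "'i \<Rightarrow> 'a \<Rightarrow> 'b::comm_monoid_add"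
  by (induction A rule: infinite_finite_induct) auto

lemma c_weight_0 [simp]: "c_weight n 0 = 0"
  by (simp add: c_weight_def)

lemma c_weight_last: "1 \<le> n \<Longrightarrow> c_weight n n = simple_root n n"
  by (simp add: c_weight_def)

lemma c_weight_step: "\<lbrakk>1 \<le> i; i < n\<rbrakk> \<Longrightarrow> c_weight n i = simple_root n i + c_weight n (Suc i)"
  by (simp add: c_weight_def sum.atLeast_Suc_atMost)

lemma null_root_eq:
  assumes "2 \<le> n"
  shows "null_root n = simple_root n 0 + c_weight n 1 + c_weight n 2"
proof -
  have "c_weight n 1 = simple_root n 1 + c_weight n 2"
    using c_weight_step[of 1 n] assms by (simp add: numeral_2_eq_2)
  moreover have "c_weight n 2 = (\<Sum>i=2..n. simple_root n i)"
    by (simp add: c_weight_def)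
  ultimately show ?thesis
    by (simp add: null_root_def fun_eq_iff)
qed

lemma cartan_B1_eq:
  assumes "i \<le> n" "j \<le> n"
  shows "cartan_B1 n i j =
    (if i = j then 2 else if i = n \<and> j = n - 1 then -2
     else if (i = 0 \<and> j = 2) \<or> (i = 2 \<and> j = 0) \<or> (1 \<le> i \<and> j = Suc i) \<or> (1 \<le> j \<and> i = Suc j)
     then -1 else 0)"
proof -
  have "(\<exists>k. 1 \<le> k \<and> k < n \<and> {i, j} = {k, k + 1}) \<longleftrightarrow>
      (1 \<le> i \<and> j = Suc i) \<or> (1 \<le> j \<and> i = Suc j)"
    using assms by (auto simp: doubleton_eq_iff)
  moreover have "{i, j} = {0, 2} \<longleftrightarrow> (i = 0 \<and> j = 2) \<or> (i = 2 \<and> j = 0)"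
    by (auto simp: doubleton_eq_iff)
  ultimately show ?thesis
    using assms by (simp only: cartan_B1_def not_less[symmetric] if_False disj_assoc simp_thms)
qed

text \<open>In orthogonal coordinates \<open>c_weight n i\<close> is
  \<open>\<epsilon>\<^sub>i\<close>. The coroot of node j with 0 < j < n evaluates to coordinate j
  minus coordinate j + 1, node n to twice the last coordinate, and node 0 to minus the sum of the
  first two. Downward induction adds one simple root at a time.\<close>

lemma c_weight_Coroot:
  assumes n: "3 \<le> n" and i: "1 \<le> i" "i \<le> n" and j: "j \<le> n"
  shows "c_weight n i (Coroot j) =
    (if j = 0 then (if i \<le> 2 then -1 else 0)
     else if j = n then (if i = n then 2 else 0)
     else (if i = j then 1 else 0) - (if i = Suc j then 1 else 0))"
  using i(2) i(1)
proof (induction rule: inc_induct)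
  case base
  then show ?case
    using n j by (simp add: c_weight_last simple_root_def cartan_B1_eq)
next
  case (step i)
  have "c_weight n i (Coroot j) = of_int (cartan_B1 n j i) + c_weight n (Suc i) (Coroot j)"
    using step by (simp add: c_weight_step simple_root_def)
  then have rec: "c_weight n i (Coroot j) = of_int (cartan_B1 n j i) +
      (if j = 0 then (if i = 1 then -1 else 0)
       else if j = n then (if Suc i = n then 2 else 0)
       else (if Suc i = j then 1 else 0) - (if i = j then 1 else 0))"
    using step by auto
  consider "j = 0" | "0 < j" "j < n" | "j = n" using j by linarith
  then show ?case
  proof cases
    case 1
    then show ?thesis using n step.hyps step.prems unfolding rec
      by (simp add: cartan_B1_eq)
  next
    case 2
    then have "n - 1 \<noteq> j \<or> i \<noteq> n" "j \<noteq> n" using step.hyps by auto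
    then show ?thesis using n 2 step.hyps step.prems unfolding rec
      by (simp add: cartan_B1_eq)
  next
    case 3
    have "i = n - 1 \<longleftrightarrow> Suc i = n" using n by linarith
    then show ?thesis using n 3 step.hyps step.prems unfolding rec
      by (simp add: cartan_B1_eq)
  qed
qed

lemma c_weight_Scaling: "c_weight n i Scaling = 0"
  by (simp add: c_weight_def fun_sum_apply simple_root_def)

lemma null_root_Coroot:
  assumes n: "3 \<le> n" and j: "j \<le> n"
  shows "null_root n (Coroot j) = 0"
proof -
  have "simple_root n 0 (Coroot j) = (if j = 0 then 2 else if j = 2 then -1 else 0)"
    using n j by (simp add: simple_root_def cartan_B1_eq)
  then show ?thesis
    using n j by (auto simp: null_root_eq c_weight_Coroot)
qed

lemma null_root_Scaling: "2 \<le> n \<Longrightarrow> null_root n Scaling = 1"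
  by (simp add: null_root_eq c_weight_Scaling simple_root_def)

lemma q_weight_Coroot: "\<lbrakk>3 \<le> n; j \<le> n\<rbrakk> \<Longrightarrow> q_weight n (Coroot j) = 0"
  by (simp add: q_weight_def null_root_Coroot)

lemma q_weight_Scaling: "2 \<le> n \<Longrightarrow> q_weight n Scaling = -1/2"
  by (simp add: q_weight_def null_root_Scaling)

lemma simple_root_0_eq:
  "2 \<le> n \<Longrightarrow> simple_root n 0 = wscale (-2) (q_weight n) - c_weight n 1 - c_weight n 2"
  by (rule ext) (simp add: q_weight_def null_root_eq diff_divide_distrib)

lemma simple_root_eq:
  "\<lbrakk>1 \<le> i; i < n\<rbrakk> \<Longrightarrow> simple_root n i = c_weight n i - c_weight n (Suc i)"
  by (simp add: c_weight_step)

text \<open>The telescoping sum of coroots dual to \<open>\<epsilon>\<^sub>i\<close>. The half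
  compensates the coroot of the short root, which is twice the last coordinate.\<close>

definition eps_coord :: "nat \<Rightarrow> nat \<Rightarrow> weight \<Rightarrow> complex" where
  "eps_coord n i \<mu> = (\<Sum>j=i..<n. \<mu> (Coroot j)) + \<mu> (Coroot n) / 2"

lemma eps_coord_linear [simp]:
  "eps_coord n i 0 = 0"
  "eps_coord n i (\<mu> + \<nu>) = eps_coord n i \<mu> + eps_coord n i \<nu>"
  "eps_coord n i (\<mu> - \<nu>) = eps_coord n i \<mu> - eps_coord n i \<nu>"
  "eps_coord n i (wscale c \<mu>) = c * eps_coord n i \<mu>"
  by (simp_all add: eps_coord_def sum.distrib sum_subtractf sum_distrib_left field_simps)

lemma eps_coord_sum: "eps_coord n i (\<Sum>a\<in>A. f a) = (\<Sum>a\<in>A. eps_coord n i (f a))"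
  using sum_comp_morphism[of "eps_coord n i" f A] by (simp add: o_def)

lemma eps_coord_c_weight:
  assumes n: "3 \<le> n" and i: "1 \<le> i" "i \<le> n" and k: "1 \<le> k" "k \<le> n"
  shows "eps_coord n i (c_weight n k) = (if i = k then 1 else 0)"
  using i(2) i(1)
proof (induction rule: inc_induct)
  case base
  then show ?case using n k by (simp add: eps_coord_def c_weight_Coroot)
next
  case (step i)
  have "eps_coord n i (c_weight n k) = c_weight n k (Coroot i) + eps_coord n (Suc i) (c_weight n k)"
    using step by (simp add: eps_coord_def sum.atLeast_Suc_lessThan)
  then show ?case using n k step by (auto simp: c_weight_Coroot)
qed

lemma eps_coord_q_weight: "\<lbrakk>3 \<le> n; 1 \<le> i\<rbrakk> \<Longrightarrow> eps_coord n i (q_weight n) = 0"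
  by (simp add: eps_coord_def q_weight_Coroot)

text \<open>A linear functional taking the value 1 on every simple root.\<close>

definition height :: "nat \<Rightarrow> weight \<Rightarrow> complex" where
  "height n \<mu> = (\<Sum>i=1..n. of_nat (Suc n - i) * eps_coord n i \<mu>) + 2 * of_nat n * \<mu> Scaling"

lemma height_linear [simp]:
  "height n 0 = 0"
  "height n (\<mu> + \<nu>) = height n \<mu> + height n \<nu>"
  "height n (\<mu> - \<nu>) = height n \<mu> - height n \<nu>"
  "height n (wscale c \<mu>) = c * height n \<mu>"
  by (simp_all add: height_def sum.distrib sum_subtractf sum_distrib_left algebra_simps)

lemma height_sum: "height n (\<Sum>a\<in>A. f a) = (\<Sum>a\<in>A. height n (f a))"
  using sum_comp_morphism[of "height n" f A] by (simp add: o_def)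

lemma height_c_weight:
  assumes "3 \<le> n" "k \<le> n"
  shows "height n (c_weight n k) = (if k = 0 then 0 else of_nat (Suc n - k))"
proof (cases "k = 0")
  case False
  have "(\<Sum>i=1..n. of_nat (Suc n - i) * eps_coord n i (c_weight n k)) =
      (\<Sum>i=1..n. if i = k then of_nat (Suc n - i) else (0::complex))"
    using assms False by (intro sum.cong refl) (auto simp: eps_coord_c_weight)
  also have "\<dots> = of_nat (Suc n - k)"
    using assms False by (simp add: sum.delta del: of_nat_diff)
  finally show ?thesis
    using False by (simp add: height_def c_weight_Scaling)
qed simp

lemma height_q_weight: "3 \<le> n \<Longrightarrow> height n (q_weight n) = - of_nat n"
  by (simp add: height_def q_weight_Scaling eps_coord_q_weight)

text \<open>The null root has height 1 + 1 + 2(n - 1) = 2n, which fixes the coefficient of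
  \<open>\<mu> Scaling\<close> in \<open>height\<close>; the weights n + 1 - i of the coordinates
  make each difference of neighbouring \<open>\<epsilon>\<close> equal to 1.\<close>

lemma height_simple_root:
  assumes "3 \<le> n" "i \<le> n"
  shows "height n (simple_root n i) = 1"
proof -
  consider "i = 0" | "1 \<le> i" "i < n" | "i = n" using assms by linarith
  then show ?thesis
  proof cases
    case 1
    then show ?thesis using assms
      by (simp add: simple_root_0_eq height_c_weight height_q_weight of_nat_diff)
  next
    case 2
    then show ?thesis using assms by (simp add: simple_root_eq height_c_weight of_nat_diff)
  next
    case 3
    then show ?thesis using assms by (simp flip: c_weight_last add: height_c_weight)
  qed
qed

lemma weights_closed:
  "0 \<in> weights n"
  "\<mu> \<in> weights n \<Longrightarrow> \<nu> \<in> weights n \<Longrightarrow> \<mu> + \<nu> \<in> weights n"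
  "\<mu> \<in> weights n \<Longrightarrow> \<nu> \<in> weights n \<Longrightarrow> \<mu> - \<nu> \<in> weights n"
  "\<mu> \<in> weights n \<Longrightarrow> wscale c \<mu> \<in> weights n"
  by (simp_all add: weights_def)

lemma weights_sum: "(\<And>a. a \<in> A \<Longrightarrow> f a \<in> weights n) \<Longrightarrow> (\<Sum>a\<in>A. f a) \<in> weights n"
  by (induction A rule: infinite_finite_induct) (auto intro: weights_closed)

lemma simple_root_weights: "simple_root n j \<in> weights n"
  by (auto simp: weights_def simple_root_def cartan_indices_def cartan_B1_def split: cartan_index.split)

lemma c_weight_weights: "c_weight n i \<in> weights n"
  by (auto simp: c_weight_def intro!: weights_sum simple_root_weights weights_closed)

lemma q_weight_weights: "q_weight n \<in> weights n"
  unfolding q_weight_def null_root_def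
  by (intro weights_closed weights_sum simple_root_weights)

lemma fundamental_weight_weights: "j \<le> n \<Longrightarrow> fundamental_weight j \<in> weights n"
  by (auto simp: weights_def fundamental_weight_def cartan_indices_def split: cartan_index.split)

text \<open>This is why exciting one fermion of colour 1 above the vacuum of node 0 produces the
  highest weight of node 1, apart from a multiple of the null root.\<close>

lemma fundamental_weight_1_eq:
  assumes "3 \<le> n"
  shows "fundamental_weight 1 = fundamental_weight 0 + c_weight n 1"
proof
  fix b
  have "c_weight n 1 \<in> weights n" by (rule c_weight_weights)
  then show "fundamental_weight 1 b = (fundamental_weight 0 + c_weight n 1) b"
    using assms
    by (cases b; cases "b \<in> cartan_indices n")
       (auto simp: fundamental_weight_def c_weight_Coroot c_weight_Scaling weights_def
         cartan_indices_def split: if_splits)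
qed

section \<open>Fermion modes\<close>

type_synonym mode = "int \<times> int"

type_synonym fvec = "mode set \<Rightarrow> complex"

text \<open>Ordering the modes by \<open>to_nat\<close> makes the set counted below finite for every \<open>S\<close>, so that the
  anticommutation relations need no finiteness assumptions.\<close>

definition mode_sign :: "mode \<Rightarrow> mode set \<Rightarrow> complex" where
  "mode_sign u S = (-1) ^ card {v \<in> S. to_nat v < to_nat u}"

lemma finite_below: "finite {v \<in> S. to_nat v < to_nat u}" for u :: mode and S :: "mode set"
proof -
  have "finite (to_nat -` {..<to_nat u} :: mode set)"
    by (intro finite_vimageI finite_lessThan inj_to_nat)
  then show ?thesis by (rule finite_subset[rotated]) auto
qed

lemma mode_sign_insert:
  assumes "v \<notin> S"
  shows "mode_sign u (insert v S) = (if to_nat v < to_nat u then - mode_sign u S else mode_sign u S)"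
proof -
  have "{w \<in> insert v S. to_nat w < to_nat u} =
      (if to_nat v < to_nat u then insert v {w \<in> S. to_nat w < to_nat u}
       else {w \<in> S. to_nat w < to_nat u})"
    by auto
  then show ?thesis
    using assms finite_below[of S u] by (simp add: mode_sign_def)
qed

lemma mode_sign_remove:
  assumes "v \<in> S"
  shows "mode_sign u (S - {v}) = (if to_nat v < to_nat u then - mode_sign u S else mode_sign u S)"
  using mode_sign_insert[of v "S - {v}" u] assms by (simp add: insert_absorb split: if_splits)

lemma mode_sign_square [simp]: "mode_sign u S * mode_sign u S = 1"
  by (simp add: mode_sign_def flip: power_add)

lemma mode_sign_square_left [simp]: "mode_sign u S * (mode_sign u S * z) = z"
  by (simp flip: mult.assoc)

lemma cnj_mode_sign [simp]: "cnj (mode_sign u S) = mode_sign u S"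
  by (simp add: mode_sign_def)

lemma mode_sign_nonzero [simp]: "mode_sign u S \<noteq> 0"
  by (simp add: mode_sign_def)

definition create :: "mode \<Rightarrow> fvec \<Rightarrow> fvec" where
  "create u x = (\<lambda>S. if u \<in> S then mode_sign u S * x (S - {u}) else 0)"

definition annihilate :: "mode \<Rightarrow> fvec \<Rightarrow> fvec" where
  "annihilate u x = (\<lambda>S. if u \<in> S then 0 else mode_sign u S * x (insert u S))"

lemma create_create: "create u (create v x) + create v (create u x) = 0"
proof
  fix S
  show "(create u (create v x) + create v (create u x)) S = 0 S"
  proof (cases "u \<in> S \<and> v \<in> S \<and> u \<noteq> v")
    case True
    then have "S - {v} - {u} = S - {u} - {v}" "to_nat u \<noteq> to_nat v" by auto
    with True show ?thesis by (auto simp: create_def mode_sign_remove)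
  qed (auto simp: create_def)
qed

lemma annihilate_annihilate: "annihilate u (annihilate v x) + annihilate v (annihilate u x) = 0"
proof
  fix S
  show "(annihilate u (annihilate v x) + annihilate v (annihilate u x)) S = 0 S"
  proof (cases "u \<notin> S \<and> v \<notin> S \<and> u \<noteq> v")
    case True
    then have "insert v (insert u S) = insert u (insert v S)" "to_nat u \<noteq> to_nat v" by auto
    with True show ?thesis by (auto simp: annihilate_def mode_sign_insert)
  qed (auto simp: annihilate_def)
qed

lemma create_annihilate: "create u (annihilate v x) + annihilate v (create u x) = (if u = v then x else 0)"
proof
  fix S
  show "(create u (annihilate v x) + annihilate v (create u x)) S = (if u = v then x else 0) S"
  proof (cases "u = v")
    case True
    then show ?thesis
      by (auto simp: create_def annihilate_def mode_sign_remove mode_sign_insert insert_absorb)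
  next
    case False
    then have "insert v (S - {u}) = insert v S - {u}" "to_nat u \<noteq> to_nat v" by auto
    with False show ?thesis
      by (auto simp: create_def annihilate_def mode_sign_remove mode_sign_insert)
  qed
qed

text \<open>The mode \<open>\<psi>\<^sub>a(k)\<close> lowers the energy by \<open>k + 1/2\<close>; its adjoint is \<open>\<psi>\<^sub>-\<^sub>a(-1-k)\<close>, and the modes with
  \<open>k < 0\<close> are the creation operators.\<close>

definition psi :: "int \<Rightarrow> int \<Rightarrow> fvec \<Rightarrow> fvec" where
  "psi a k = (if k < 0 then create (a, k) else annihilate (- a, - 1 - k))"

text \<open>Stated as a rule for exchanging two factors by \<open>subst\<close>. Two creations or
  two annihilations never produce the scalar, since k and -1-k have opposite signs in the sense k <
  0 versus k \<ge> 0.\<close>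

lemma psi_anticomm:
  "psi a k (psi b l x) = (if b = - a \<and> l = - 1 - k then x else 0) - psi b l (psi a k x)"
proof -
  have "psi a k (psi b l x) + psi b l (psi a k x) = (if b = - a \<and> l = - 1 - k then x else 0)"
    using create_create[of "(a,k)" "(b,l)" x] annihilate_annihilate[of "(-a,-1-k)" "(-b,-1-l)" x]
      create_annihilate[of "(a,k)" "(-b,-1-l)" x] create_annihilate[of "(b,l)" "(-a,-1-k)" x]
    by (auto simp: psi_def add.commute split: if_splits)
  then show ?thesis by (simp add: algebra_simps)
qed

definition fscale :: "complex \<Rightarrow> fvec \<Rightarrow> fvec" where
  "fscale c x = (\<lambda>S. c * x S)"

lemma fscale_apply [simp]: "fscale c x S = c * x S"
  by (simp add: fscale_def)

lemma fscale_simps [simp]: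
  "fscale c 0 = 0" "fscale 0 x = 0" "fscale 1 x = x" "fscale c (- x) = - fscale c x"
  "fscale (- c) x = - fscale c x"
  by (simp_all add: fun_eq_iff)

interpretation fv: vector_space fscale
  by standard (simp_all add: fun_eq_iff algebra_simps)

lemma psi_linear:
  "psi a k 0 = 0"
  "psi a k (x + y) = psi a k x + psi a k y"
  "psi a k (x - y) = psi a k x - psi a k y"
  "psi a k (- x) = - psi a k x"
  "psi a k (fscale c x) = fscale c (psi a k x)"
  by (auto simp: psi_def create_def annihilate_def fun_eq_iff algebra_simps)

lemma psi_sum: "psi a k (\<Sum>i\<in>I. f i) = (\<Sum>i\<in>I. psi a k (f i))"
  using sum_comp_morphism[of "psi a k" f I] by (simp add: o_def psi_linear)

lemma psi_psi_same:
  assumes "a \<noteq> 0"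
  shows "psi a k (psi a k x) = 0"
proof -
  have "psi a k (psi a k x) = - psi a k (psi a k x)"
    using psi_anticomm[of a k a k x] assms by simp
  then show ?thesis by (simp add: fun_eq_iff)
qed

section \<open>The Fock space of finite combinations of finite states\<close>

definition modes :: "nat \<Rightarrow> mode set" where
  "modes n = {(a, k). \<bar>a\<bar> \<le> int n \<and> k < 0}"

definition states :: "nat \<Rightarrow> mode set set" where
  "states n = {S. finite S \<and> S \<subseteq> modes n}"

definition fock :: "nat \<Rightarrow> fvec set" where
  "fock n = {x. finite {S. x S \<noteq> 0} \<and> (\<forall>S. x S \<noteq> 0 \<longrightarrow> S \<in> states n)}"

lemma fockI: "\<lbrakk>finite {S. x S \<noteq> 0}; \<And>S. x S \<noteq> 0 \<Longrightarrow> S \<in> states n\<rbrakk> \<Longrightarrow> x \<in> fock n"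
  by (simp add: fock_def)

lemma fock_finite: "x \<in> fock n \<Longrightarrow> finite {S. x S \<noteq> 0}"
  by (simp add: fock_def)

lemma fock_states: "x \<in> fock n \<Longrightarrow> x S \<noteq> 0 \<Longrightarrow> S \<in> states n"
  by (simp add: fock_def)

lemma fock_0 [simp]: "0 \<in> fock n"
  by (simp add: fock_def)

lemma fock_add:
  assumes "x \<in> fock n" "y \<in> fock n"
  shows "x + y \<in> fock n"
proof (rule fockI)
  show "finite {S. (x + y) S \<noteq> 0}"
    by (rule finite_subset[OF _ finite_UnI[OF fock_finite[OF assms(1)] fock_finite[OF assms(2)]]]) auto
  show "S \<in> states n" if "(x + y) S \<noteq> 0" for S
    using that assms by (cases "x S = 0") (auto dest: fock_states)
qed

lemma fock_fscale: "x \<in> fock n \<Longrightarrow> fscale c x \<in> fock n"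
  by (auto simp: fock_def intro: rev_finite_subset)

lemma fock_minus: "x \<in> fock n \<Longrightarrow> y \<in> fock n \<Longrightarrow> x - y \<in> fock n"
  using fock_add[of x n "fscale (-1) y"] fock_fscale[of y n "-1"] by simp

lemma fock_sum: "(\<And>i. i \<in> I \<Longrightarrow> f i \<in> fock n) \<Longrightarrow> (\<Sum>i\<in>I. f i) \<in> fock n"
  by (induction I rule: infinite_finite_induct) (auto intro: fock_add)

lemma states_insert: "insert u S \<in> states n \<longleftrightarrow> u \<in> modes n \<and> S \<in> states n"
  by (auto simp: states_def)

lemma create_fock:
  assumes "x \<in> fock n" "u \<in> modes n"
  shows "create u x \<in> fock n"
proof (rule fockI)
  have "{S. create u x S \<noteq> 0} \<subseteq> insert u ` {S. x S \<noteq> 0}"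
    by (auto simp: create_def image_iff split: if_splits intro!: exI[of _ "S - {u}" for S])
  then show "finite {S. create u x S \<noteq> 0}"
    by (rule finite_subset) (intro finite_imageI fock_finite[OF assms(1)])
  show "S \<in> states n" if "create u x S \<noteq> 0" for S
  proof -
    from that have "u \<in> S" "x (S - {u}) \<noteq> 0" by (auto simp: create_def split: if_splits)
    then show ?thesis using fock_states[OF assms(1)] assms(2) states_insert[of u "S - {u}" n]
      by (simp add: insert_absorb)
  qed
qed

lemma annihilate_fock:
  assumes "x \<in> fock n"
  shows "annihilate u x \<in> fock n"
proof (rule fockI)
  have "{S. annihilate u x S \<noteq> 0} \<subseteq> (\<lambda>S. S - {u}) ` {S. x S \<noteq> 0}"
    by (auto simp: annihilate_def image_iff split: if_splits intro!: exI[of _ "insert u S" for S])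
  then show "finite {S. annihilate u x S \<noteq> 0}"
    by (rule finite_subset) (intro finite_imageI fock_finite[OF assms(1)])
  show "S \<in> states n" if "annihilate u x S \<noteq> 0" for S
    using that fock_states[OF assms, of "insert u S"]
    by (auto simp: annihilate_def states_insert split: if_splits)
qed

lemma psi_fock: "\<lbrakk>x \<in> fock n; \<bar>a\<bar> \<le> int n\<rbrakk> \<Longrightarrow> psi a k x \<in> fock n"
  by (auto simp: psi_def modes_def intro: create_fock annihilate_fock)

text \<open>Finitely many finite states occur in \<open>x\<close>, so one bound serves all their
  modes. It is what cuts every operator sum below down to a finite window.\<close>

lemma fock_bound:
  assumes "x \<in> fock n"
  obtains K where "K \<ge> 0" "\<And>S a l. x S \<noteq> 0 \<Longrightarrow> (a, l) \<in> S \<Longrightarrow> - K \<le> l"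
proof -
  let ?U = "\<Union>{S. x S \<noteq> 0}"
  have "finite ?U"
    using assms by (auto simp: fock_def states_def)
  then have fin: "finite (insert 0 (snd ` ?U))" by simp
  define K where "K = - Min (insert 0 (snd ` ?U))"
  show ?thesis
  proof (rule that[of K])
    show "K \<ge> 0" unfolding K_def using Min_le[OF fin, of 0] by simp
    show "- K \<le> l" if "x S \<noteq> 0" "(a, l) \<in> S" for S a l
    proof -
      have "l \<in> snd ` ?U" using that by force
      then show ?thesis unfolding K_def using Min_le[OF fin, of l] by simp
    qed
  qed
qed

text \<open>Since k \<ge> K \<ge> 0, the operator removes the mode (-a, -1-k), which lies below -K
  and hence occurs in no state of \<open>x\<close>.\<close>

lemma psi_vanish:
  assumes "\<And>S a l. x S \<noteq> 0 \<Longrightarrow> (a, l) \<in> S \<Longrightarrow> - K \<le> l" "K \<ge> 0" "k \<ge> K"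
  shows "psi a k x = 0"
proof
  fix S
  have "x (insert (- a, - 1 - k) S) = 0"
    using assms(1)[of "insert (- a, - 1 - k) S" "- a" "- 1 - k"] assms(3) by force
  then show "psi a k x S = 0 S" using assms by (simp add: psi_def annihilate_def)
qed

lemma fock_psi_bound:
  assumes "x \<in> fock n"
  obtains K where "K \<ge> 0" "\<And>a k. k \<ge> K \<Longrightarrow> psi a k x = 0"
  using fock_bound[OF assms] psi_vanish by metis

section \<open>Quadratic operators and their commutators\<close>

definition qterm :: "int \<Rightarrow> int \<Rightarrow> int \<Rightarrow> fvec \<Rightarrow> int \<Rightarrow> fvec" where
  "qterm a b m x k = psi a k (psi b (m - 1 - k) x)"

text \<open>The degree m Fourier coefficient of the product of the fermion fields of colours a and
  b: the half-integral labels k + 1/2 and (m - 1 - k) + 1/2 add up to m.\<close>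

definition quad :: "int \<Rightarrow> int \<Rightarrow> int \<Rightarrow> fvec \<Rightarrow> fvec" where
  "quad a b m x = Sum_any (qterm a b m x)"

text \<open>For a regular triple the two factors of every term anticommute, so that no normal
  ordering is needed.\<close>

definition regular :: "int \<Rightarrow> int \<Rightarrow> int \<Rightarrow> bool" where
  "regular a b m \<longleftrightarrow> a \<noteq> - b \<or> m \<noteq> 0"

lemma qterm_swap: "regular a b m \<Longrightarrow> qterm a b m x k = - qterm b a m x (m - 1 - k)"
  unfolding qterm_def regular_def by (subst psi_anticomm) auto

text \<open>At least one factor annihilates \<open>x\<close>. For k < m - K it is the right one,
  because m - 1 - k \<ge> K; for k \<ge> K it is the left one, once regularity has allowed the
  exchange.\<close>

lemma qterm_vanish:
  assumes "regular a b m" "\<And>c l. l \<ge> K \<Longrightarrow> psi c l x = 0" "k \<ge> K \<or> k < m - K"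
  shows "qterm a b m x k = 0"
proof (cases "k \<ge> K")
  case True
  then show ?thesis using assms
    by (subst qterm_swap) (auto simp: qterm_def psi_linear)
next
  case False
  then show ?thesis using assms by (auto simp: qterm_def psi_linear)
qed

lemma qterm_finite:
  assumes "x \<in> fock n" "regular a b m"
  shows "finite {k. qterm a b m x k \<noteq> 0}"
proof -
  obtain K where K: "\<And>c l. l \<ge> K \<Longrightarrow> psi c l x = 0" using fock_psi_bound[OF assms(1)] by metis
  have "{k. qterm a b m x k \<noteq> 0} \<subseteq> {m - K..<K}"
    using qterm_vanish[OF assms(2) K] by force
  then show ?thesis by (rule finite_subset) simp
qed

lemma quad_eq_sum:
  assumes "regular a b m" "\<And>c l. l \<ge> K \<Longrightarrow> psi c l x = 0" "L \<le> m - K" "K \<le> U"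
  shows "quad a b m x = (\<Sum>k\<in>{L..<U}. qterm a b m x k)"
  unfolding quad_def
proof (rule Sum_any.expand_superset)
  show "{k. qterm a b m x k \<noteq> 0} \<subseteq> {L..<U}"
    using qterm_vanish[OF assms(1,2)] assms(3,4) by force
qed simp

lemma Sum_any_minus: "Sum_any (\<lambda>k. - f k) = - Sum_any f"
  for f :: "'k \<Rightarrow> 'b::ab_group_add"
  by (simp add: Sum_any.expand_set sum_negf)

lemma Sum_any_diff:
  fixes f g :: "'k \<Rightarrow> 'b::ab_group_add"
  assumes "finite {k. f k \<noteq> 0}" "finite {k. g k \<noteq> 0}"
  shows "Sum_any (\<lambda>k. f k - g k) = Sum_any f - Sum_any g"
  using Sum_any.distrib[of f "\<lambda>k. - g k"] assms by (simp add: Sum_any_minus)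

lemma Sum_any_morphism:
  fixes T :: "'b::ab_group_add \<Rightarrow> 'c::ab_group_add"
  assumes "T 0 = 0" "\<And>I. T (\<Sum>k\<in>I. f k) = (\<Sum>k\<in>I. T (f k))" "finite {k. f k \<noteq> 0}"
  shows "T (Sum_any f) = Sum_any (\<lambda>k. T (f k))"
proof -
  have "Sum_any (\<lambda>k. T (f k)) = (\<Sum>k | f k \<noteq> 0. T (f k))"
    using assms by (intro Sum_any.expand_superset) auto
  then show ?thesis by (simp add: Sum_any.expand_set assms(2))
qed

lemma Sum_any_single:
  fixes f :: "'k \<Rightarrow> 'b::ab_group_add"
  assumes "\<And>k. k \<noteq> k0 \<Longrightarrow> f k = 0"
  shows "Sum_any f = f k0" "finite {k. f k \<noteq> 0}"
proof -
  have sub: "{k. f k \<noteq> 0} \<subseteq> {k0}" using assms by auto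
  show "Sum_any f = f k0" using Sum_any.expand_superset[OF _ sub] by simp
  show "finite {k. f k \<noteq> 0}" by (rule finite_subset[OF sub]) simp
qed

lemma qterm_linear:
  "qterm a b m 0 k = 0"
  "qterm a b m (x + y) k = qterm a b m x k + qterm a b m y k"
  "qterm a b m (fscale c x) k = fscale c (qterm a b m x k)"
  by (simp_all add: qterm_def psi_linear)

lemma quad_0 [simp]: "quad a b m 0 = 0"
  by (simp add: quad_def qterm_linear[abs_def])

lemma quad_add:
  assumes "x \<in> fock n" "y \<in> fock n" "regular a b m"
  shows "quad a b m (x + y) = quad a b m x + quad a b m y"
  unfolding quad_def qterm_linear using assms by (intro Sum_any.distrib qterm_finite)

lemma quad_fscale:
  assumes "x \<in> fock n" "regular a b m"
  shows "quad a b m (fscale c x) = fscale c (quad a b m x)"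
  unfolding quad_def qterm_linear
  using Sum_any_morphism[of "fscale c" "qterm a b m x"] qterm_finite[OF assms]
  by (simp add: fv.scale_sum_right)

lemma quad_sum:
  assumes "\<And>i. i \<in> I \<Longrightarrow> f i \<in> fock n" "regular a b m"
  shows "quad a b m (\<Sum>i\<in>I. f i) = (\<Sum>i\<in>I. quad a b m (f i))"
  using assms(1)
proof (induction I rule: infinite_finite_induct)
  case (insert i I)
  then have "quad a b m (f i + (\<Sum>i\<in>I. f i)) = quad a b m (f i) + quad a b m (\<Sum>i\<in>I. f i)"
    by (intro quad_add[OF _ _ assms(2)] fock_sum) auto
  moreover have "sum f (insert i I) = f i + sum f I"
    "(\<Sum>i\<in>insert i I. quad a b m (f i)) = quad a b m (f i) + (\<Sum>i\<in>I. quad a b m (f i))"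
    using insert by simp_all
  moreover have "quad a b m (\<Sum>i\<in>I. f i) = (\<Sum>i\<in>I. quad a b m (f i))"
    using insert by blast
  ultimately show ?case by (simp only:)
qed (simp_all only: sum.infinite sum.empty quad_0 simp_thms)

lemma qterm_fock:
  "\<lbrakk>x \<in> fock n; \<bar>a\<bar> \<le> int n; \<bar>b\<bar> \<le> int n\<rbrakk> \<Longrightarrow> qterm a b m x k \<in> fock n"
  by (simp add: qterm_def psi_fock)

lemma quad_fock:
  "\<lbrakk>x \<in> fock n; \<bar>a\<bar> \<le> int n; \<bar>b\<bar> \<le> int n\<rbrakk> \<Longrightarrow> quad a b m x \<in> fock n"
  by (simp add: quad_def Sum_any.expand_set fock_sum qterm_fock)

lemma quad_swap:
  assumes "regular a b m"
  shows "quad a b m x = - quad b a m x"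
proof -
  have "bij (\<lambda>k. m - 1 - k)"
    by (rule bijI') (auto intro: exI[of _ "m - 1 - y" for y])
  moreover have "qterm a b m x \<circ> (\<lambda>k. m - 1 - k) = (\<lambda>k. - qterm b a m x k)"
    by (rule ext) (simp add: qterm_swap[OF assms])
  ultimately have "Sum_any (qterm a b m x) = Sum_any (\<lambda>k. - qterm b a m x k)"
    by (rule Sum_any.reindex_cong)
  then show ?thesis by (simp add: quad_def Sum_any_minus)
qed

lemma quad_same:
  assumes "a \<noteq> 0 \<or> m \<noteq> 0"
  shows "quad a a m x = 0"
proof -
  have "quad a a m x = - quad a a m x"
    using assms by (intro quad_swap) (auto simp: regular_def)
  then show ?thesis by (simp add: fun_eq_iff)
qed

text \<open>A quadratic operator acts on fermions as a derivation. Moving \<open>psi c s\<close> to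
  the left meets the factor b at the single index k = m + s and the factor a at the single index k =
  -1 - s, so each contraction sum has one term.\<close>

lemma quad_psi:
  assumes "x \<in> fock n" "regular a b m"
  shows "quad a b m (psi c s x) = psi c s (quad a b m x) +
     (if c = - b then psi a (m + s) x else 0) - (if c = - a then psi b (m + s) x else 0)"
proof -
  let ?f = "\<lambda>k. psi c s (qterm a b m x k)"
  let ?g = "\<lambda>k. if c = - b \<and> k = m + s then psi a k x else 0"
  let ?h = "\<lambda>k. if c = - a \<and> k = - 1 - s then psi b (m - 1 - k) x else 0"
  have f: "finite {k. ?f k \<noteq> 0}"
    by (rule finite_subset[OF _ qterm_finite[OF assms]]) (auto simp: psi_linear)
  have g: "Sum_any ?g = (if c = - b then psi a (m + s) x else 0)" "finite {k. ?g k \<noteq> 0}"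
    using Sum_any_single[of "m + s" ?g] by auto
  have h: "Sum_any ?h = (if c = - a then psi b (m + s) x else 0)" "finite {k. ?h k \<noteq> 0}"
    using Sum_any_single[of "- 1 - s" ?h] by auto
  have "qterm a b m (psi c s x) k = ?f k + ?g k - ?h k" for k
  proof -
    have "qterm a b m (psi c s x) k = psi a k (psi b (m - 1 - k) (psi c s x))"
      by (simp only: qterm_def)
    also have "\<dots> =
        psi a k ((if c = - b \<and> k = m + s then x else 0) - psi c s (psi b (m - 1 - k) x))"
      by (subst psi_anticomm[of b]) (auto simp: algebra_simps)
    also have "\<dots> = ?g k - psi a k (psi c s (psi b (m - 1 - k) x))"
      by (simp add: psi_linear)
    also have "psi a k (psi c s (psi b (m - 1 - k) x)) = ?h k - ?f k"
      by (subst psi_anticomm[of a]) (auto simp: qterm_def)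
    finally show ?thesis by (simp only: diff_diff_eq2 add.commute)
  qed
  then have "quad a b m (psi c s x) = Sum_any (\<lambda>k. (?f k + ?g k) - ?h k)"
    by (simp add: quad_def)
  also have "\<dots> = Sum_any (\<lambda>k. ?f k + ?g k) - Sum_any ?h"
  proof (rule Sum_any_diff[OF _ h(2)])
    show "finite {k. ?f k + ?g k \<noteq> 0}"
      by (rule finite_subset[OF _ finite_UnI[OF f g(2)]]) auto
  qed
  also have "Sum_any (\<lambda>k. ?f k + ?g k) = Sum_any ?f + Sum_any ?g"
    by (rule Sum_any.distrib[OF f g(2)])
  also have "Sum_any ?f = psi c s (quad a b m x)"
    using Sum_any_morphism[of "psi c s" "qterm a b m x"] qterm_finite[OF assms]
    by (simp add: psi_linear psi_sum quad_def)
  finally show ?thesis by (simp only: g(1) h(1))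
qed

lemma Sum_any_combine:
  fixes f g1 g2 g3 g4 :: "'k \<Rightarrow> 'b::ab_group_add"
  assumes "finite {k. f k \<noteq> 0}" "finite {k. g1 k \<noteq> 0}" "finite {k. g2 k \<noteq> 0}"
    "finite {k. g3 k \<noteq> 0}" "finite {k. g4 k \<noteq> 0}"
  shows "Sum_any (\<lambda>k. f k + g1 k - g2 k + g3 k - g4 k) =
    Sum_any f + Sum_any g1 - Sum_any g2 + Sum_any g3 - Sum_any g4"
proof -
  define J where "J = {k. f k \<noteq> 0} \<union> {k. g1 k \<noteq> 0} \<union> {k. g2 k \<noteq> 0} \<union> {k. g3 k \<noteq> 0} \<union> {k. g4 k \<noteq> 0}"
  have J: "finite J" using assms by (simp add: J_def)
  have *: "Sum_any h = sum h J" if "\<And>k. h k \<noteq> 0 \<Longrightarrow> k \<in> J" for h :: "'k \<Rightarrow> 'b"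
    using that by (intro Sum_any.expand_superset J) auto
  have "Sum_any (\<lambda>k. f k + g1 k - g2 k + g3 k - g4 k) = (\<Sum>k\<in>J. f k + g1 k - g2 k + g3 k - g4 k)"
    by (rule *) (auto simp: J_def)
  also have "\<dots> = sum f J + sum g1 J - sum g2 J + sum g3 J - sum g4 J"
    by (simp only: sum.distrib sum_subtractf)
  also have "sum f J = Sum_any f" by (rule *[symmetric]) (auto simp: J_def)
  also have "sum g1 J = Sum_any g1" by (rule *[symmetric]) (auto simp: J_def)
  also have "sum g2 J = Sum_any g2" by (rule *[symmetric]) (auto simp: J_def)
  also have "sum g3 J = Sum_any g3" by (rule *[symmetric]) (auto simp: J_def)
  also have "sum g4 J = Sum_any g4" by (rule *[symmetric]) (auto simp: J_def)
  finally show ?thesis .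
qed

lemma quad_Sum_any:
  assumes "\<And>k. f k \<in> fock n" "regular a b m" "finite {k. f k \<noteq> 0}"
  shows "quad a b m (Sum_any f) = Sum_any (\<lambda>k. quad a b m (f k))"
proof -
  have "Sum_any (\<lambda>k. quad a b m (f k)) = (\<Sum>k | f k \<noteq> 0. quad a b m (f k))"
    using assms(3) by (intro Sum_any.expand_superset) auto
  then show ?thesis by (simp add: Sum_any.expand_set quad_sum[OF assms(1,2)])
qed

lemma Sum_any_if_qterm:
  assumes "x \<in> fock n" "P \<Longrightarrow> regular a b m"
  shows "Sum_any (\<lambda>k. if P then qterm a b m x (p + k) else 0) = (if P then quad a b m x else 0)"
    and "finite {k. (if P then qterm a b m x (p + k) else 0) \<noteq> 0}"
proof -
  have bij: "bij ((+) p)"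
    by (rule bijI') (auto intro: exI[of _ "y - p" for y])
  show "Sum_any (\<lambda>k. if P then qterm a b m x (p + k) else 0) = (if P then quad a b m x else 0)"
    using Sum_any.reindex_cong[OF bij, of "qterm a b m x"] by (auto simp: quad_def o_def)
  have "finite ((+) p -` {k. qterm a b m x k \<noteq> 0})" if P
    by (rule finite_vimageI[OF qterm_finite[OF assms(1) assms(2)[OF that]] bij_is_inj[OF bij]])
  then show "finite {k. (if P then qterm a b m x (p + k) else 0) \<noteq> 0}"
    by (cases P) (simp_all add: vimage_def)
qed

text \<open>Applying the derivation \<open>quad a b m\<close> to each product in
  \<open>quad c d p\<close> gives the bracket of the loop algebra of so(2n+1). The conditions
  \<open>r'\<close> exclude brackets landing in the Cartan direction in degree 0, where the separate
  sums diverge and a central term would arise.\<close>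

lemma quad_quad:
  assumes x: "x \<in> fock n" and r: "regular a b m" "regular c d p"
    and cd: "\<bar>c\<bar> \<le> int n" "\<bar>d\<bar> \<le> int n" and ab: "\<bar>a\<bar> \<le> int n" "\<bar>b\<bar> \<le> int n"
    and r': "c = - b \<Longrightarrow> regular a d (m + p)" "c = - a \<Longrightarrow> regular b d (m + p)"
      "d = - b \<Longrightarrow> regular c a (m + p)" "d = - a \<Longrightarrow> regular c b (m + p)"
  shows "quad a b m (quad c d p x) = quad c d p (quad a b m x) +
    (if c = - b then quad a d (m + p) x else 0) - (if c = - a then quad b d (m + p) x else 0) +
    (if d = - b then quad c a (m + p) x else 0) - (if d = - a then quad c b (m + p) x else 0)"
proof -
  let ?f = "qterm c d p (quad a b m x)"
  let ?g1 = "\<lambda>k. if c = - b then qterm a d (m + p) x (m + k) else 0"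
  let ?g2 = "\<lambda>k. if c = - a then qterm b d (m + p) x (m + k) else 0"
  let ?g3 = "\<lambda>k. if d = - b then qterm c a (m + p) x (0 + k) else 0"
  let ?g4 = "\<lambda>k. if d = - a then qterm c b (m + p) x (0 + k) else 0"
  have "quad a b m (qterm c d p x k) = ?f k + ?g1 k - ?g2 k + ?g3 k - ?g4 k" for k
  proof -
    have y: "psi d (p - 1 - k) x \<in> fock n" using x cd by (simp add: psi_fock)
    have "quad a b m (qterm c d p x k) = psi c k (quad a b m (psi d (p - 1 - k) x)) +
        (if c = - b then psi a (m + k) (psi d (p - 1 - k) x) else 0) -
        (if c = - a then psi b (m + k) (psi d (p - 1 - k) x) else 0)"
      unfolding qterm_def by (rule quad_psi[OF y r(1)])
    also have "\<dots> = psi c k (quad a b m (psi d (p - 1 - k) x)) + ?g1 k - ?g2 k"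
      by (simp only: qterm_def) (simp add: algebra_simps)
    also have "psi c k (quad a b m (psi d (p - 1 - k) x)) = ?f k + ?g3 k - ?g4 k"
      unfolding quad_psi[OF x r(1)] by (simp add: psi_linear qterm_def algebra_simps)
    finally show ?thesis by (simp only: diff_conv_add_uminus minus_add ac_simps)
  qed
  then have "Sum_any (\<lambda>k. quad a b m (qterm c d p x k)) =
      Sum_any (\<lambda>k. ?f k + ?g1 k - ?g2 k + ?g3 k - ?g4 k)"
    by (simp only:)
  also have "\<dots> = Sum_any ?f + Sum_any ?g1 - Sum_any ?g2 + Sum_any ?g3 - Sum_any ?g4"
    by (intro Sum_any_combine Sum_any_if_qterm[OF x] qterm_finite[OF quad_fock[OF x ab]] r r')
  also have "Sum_any (\<lambda>k. quad a b m (qterm c d p x k)) = quad a b m (quad c d p x)"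
    unfolding quad_def[of c d p x]
    by (rule quad_Sum_any[symmetric, OF qterm_fock[OF x cd] r(1) qterm_finite[OF x r(2)]])
  finally show ?thesis
    by (simp only: Sum_any_if_qterm(1)[OF x] r' quad_def[of c d p "quad a b m x"] cong: if_cong)
qed

section \<open>Basis states and induction over creation operators\<close>

definition delta :: "mode set \<Rightarrow> fvec" where
  "delta S = (\<lambda>T. if T = S then 1 else 0)"

lemma delta_fock: "S \<in> states n \<Longrightarrow> delta S \<in> fock n"
  by (auto simp: delta_def fock_def)

lemma delta_insert: "u \<notin> S \<Longrightarrow> delta (insert u S) = fscale (mode_sign u S) (create u (delta S))"
proof
  fix T
  assume u: "u \<notin> S"
  show "delta (insert u S) T = fscale (mode_sign u S) (create u (delta S)) T"
    using u mode_sign_remove[of u T u] by (auto simp: delta_def create_def)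
qed

lemma fock_expand:
  assumes "x \<in> fock n"
  shows "x = (\<Sum>S | x S \<noteq> 0. fscale (x S) (delta S))"
proof
  fix T
  show "x T = (\<Sum>S | x S \<noteq> 0. fscale (x S) (delta S)) T"
    using fock_finite[OF assms]
    by (simp add: fun_sum_apply delta_def if_distrib[of "(*) _"] sum.delta' cong: if_cong)
qed

lemma fock_induct [consumes 1, case_names zero vac create add scale]:
  assumes "x \<in> fock n"
    and zero: "P 0"
    and vac: "P (delta {})"
    and create: "\<And>c k y. \<lbrakk>\<bar>c\<bar> \<le> int n; k < 0; y \<in> fock n; P y\<rbrakk> \<Longrightarrow> P (psi c k y)"
    and add: "\<And>y z. \<lbrakk>y \<in> fock n; z \<in> fock n; P y; P z\<rbrakk> \<Longrightarrow> P (y + z)"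
    and scale: "\<And>r y. \<lbrakk>y \<in> fock n; P y\<rbrakk> \<Longrightarrow> P (fscale r y)"
  shows "P x"
proof -
  have delta: "P (delta S)" if "S \<in> states n" for S
  proof -
    from that have "finite S" "S \<subseteq> modes n" by (auto simp: states_def)
    then show ?thesis
    proof (induction S rule: finite_induct)
      case (insert u S)
      obtain c k where u: "u = (c, k)" by (cases u)
      have "\<bar>c\<bar> \<le> int n" "k < 0" "S \<in> states n" "P (delta S)"
        using insert u by (auto simp: modes_def states_def)
      then have "P (fscale (mode_sign u S) (psi c k (delta S)))"
        by (intro scale create psi_fock delta_fock)
      moreover have "psi c k (delta S) = create u (delta S)"
        using \<open>k < 0\<close> by (simp add: u psi_def)
      ultimately show ?case by (simp only: delta_insert[OF insert(2)])
    qed (rule vac)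
  qed
  have "(\<Sum>S\<in>I. fscale (x S) (delta S)) \<in> fock n \<and> P (\<Sum>S\<in>I. fscale (x S) (delta S))"
    if "finite I" "I \<subseteq> {S. x S \<noteq> 0}" for I
    using that
  proof (induction I rule: finite_induct)
    case empty
    then show ?case by (simp only: sum.empty fock_0 zero simp_thms)
  next
    case (insert S I)
    then have S: "S \<in> states n" using fock_states[OF assms(1)] by auto
    have "(\<Sum>S\<in>insert S I. fscale (x S) (delta S)) =
        fscale (x S) (delta S) + (\<Sum>S\<in>I. fscale (x S) (delta S))"
      using insert by simp
    moreover have "fscale (x S) (delta S) \<in> fock n" "P (fscale (x S) (delta S))"
      using S by (auto intro: fock_fscale delta_fock scale delta)
    ultimately show ?case using insert by (simp only: insert_subset) (blast intro: fock_add add)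
  qed
  from this[OF fock_finite[OF assms(1)] order_refl] show ?thesis
    by (simp flip: fock_expand[OF assms(1)])
qed

section \<open>Charges and the central term\<close>

definition chg :: "int \<Rightarrow> mode set \<Rightarrow> int" where
  "chg a S = int (card {k. (a, k) \<in> S}) - int (card {k. (- a, k) \<in> S})"

text \<open>The normally ordered version of \<open>quad a (- a) 0\<close>, which is not regular;
  defining it diagonally avoids the ordering.\<close>

definition charge :: "int \<Rightarrow> fvec \<Rightarrow> fvec" where
  "charge a x = (\<lambda>S. of_int (chg a S) * x S)"

lemma charge_linear:
  "charge a 0 = 0"
  "charge a (x + y) = charge a x + charge a y"
  "charge a (fscale c x) = fscale c (charge a x)"
  by (auto simp: charge_def fun_eq_iff algebra_simps)

lemma chg_insert:
  assumes "finite S" "(c, s) \<notin> S"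
  shows "chg a (insert (c, s) S) = chg a S + (if c = a then 1 else 0) - (if c = - a then 1 else 0)"
proof -
  have fin: "finite {k. (b, k) \<in> S}" for b
    by (rule finite_subset[of _ "snd ` S"]) (use assms in force)+
  have "card {k. (b, k) \<in> insert (c, s) S} = card {k. (b, k) \<in> S} + (if c = b then 1 else 0)" for b
  proof (cases "c = b")
    case True
    then have "{k. (b, k) \<in> insert (c, s) S} = insert s {k. (b, k) \<in> S}" by auto
    with True show ?thesis using fin assms by simp
  qed simp
  then show ?thesis by (simp add: chg_def)
qed

lemma charge_psi:
  assumes "x \<in> fock n" "s < 0"
  shows "charge a (psi c s x) = psi c s (charge a x) +
    fscale ((if c = a then 1 else 0) - (if c = - a then 1 else 0)) (psi c s x)"
proof
  fix S
  show "charge a (psi c s x) S = (psi c s (charge a x) +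
    fscale ((if c = a then 1 else 0) - (if c = - a then 1 else 0)) (psi c s x)) S"
  proof (cases "(c, s) \<in> S \<and> x (S - {(c, s)}) \<noteq> 0")
    case True
    then have "S - {(c, s)} \<in> states n" using fock_states[OF assms(1)] by blast
    then have "finite (S - {(c, s)})" by (simp add: states_def)
    from chg_insert[OF this, of c s a] True
    have "chg a S = chg a (S - {(c, s)}) + (if c = a then 1 else 0) - (if c = - a then 1 else 0)"
      by (simp add: insert_absorb)
    then have eq: "of_int (chg a S) = of_int (chg a (S - {(c, s)})) +
        ((if c = a then 1 else 0) - (if c = - a then 1 else 0) :: complex)"
      by (simp only: of_int_add of_int_diff) (simp split: if_splits)
    show ?thesis using assms(2) True
      by (simp add: psi_def create_def charge_def eq distrib_right)
  next
    case False
    then show ?thesis using assms(2) by (auto simp: psi_def create_def charge_def)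
  qed
qed

lemma psi_vac: "0 \<le> k \<Longrightarrow> psi a k (delta {}) = 0"
  by (auto simp: psi_def annihilate_def delta_def)

lemma vac_fock: "delta {} \<in> fock n"
  by (rule delta_fock) (simp add: states_def)

lemma quad_vac:
  assumes "regular a b m" "m \<ge> 0"
  shows "quad a b m (delta {}) = 0"
  using quad_eq_sum[OF assms(1), of 0 "delta {}" 0 0] psi_vac assms(2) by simp

lemma quad_minus:
  assumes "x \<in> fock n" "y \<in> fock n" "regular a b m"
  shows "quad a b m (x - y) = quad a b m x - quad a b m y"
  using quad_add[of x n "fscale (-1) y" a b m] quad_fscale[of y n a b m "-1"]
    fock_fscale[of y n "-1"] assms
  by simp

text \<open>Both sides have the same commutators with the creation operators.\<close>

lemma quad_commutator_charge:
  assumes "x \<in> fock n" and ab: "\<bar>a\<bar> \<le> int n" "\<bar>b\<bar> \<le> int n" "a \<noteq> b" "a \<noteq> - b"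
    and m: "m = 0 \<or> m = 1"
  shows "quad a b m (quad (- b) (- a) (- m) x) =
    quad (- b) (- a) (- m) (quad a b m x) + charge a x + charge b x + fscale (of_int m) x"
  using assms(1)
proof (induction x rule: fock_induct)
  case zero
  show ?case by (simp only: quad_0 charge_linear fv.scale_zero_right add_0)
next
  have r: "regular a b m'" "regular (- b) (- a) m'" for m' using ab by (auto simp: regular_def)
  {
    case vac
    have ch: "charge c (delta {}) = 0" for c
      by (auto simp: charge_def chg_def delta_def)
    show ?case
    proof (cases "m = 0")
      case True
      then show ?thesis by (simp only: True minus_zero quad_vac[OF r(1)] quad_vac[OF r(2)] order_refl quad_0 ch add_0
            of_int_0 fscale_simps)
    next
      case False
      then have m1: "m = 1" using m by simp
      \<comment> \<open>The central term appears here. In degree -1 the lowering operator applied to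
        the vacuum creates just one pair, both modes with index -1, and the raising operator removes
        this pair with coefficient 1.\<close>
      let ?z = "psi (- a) (- 1) (delta {})"
      have z: "?z \<in> fock n" using ab by (simp add: psi_fock vac_fock)
      have "quad (- b) (- a) (- 1) (delta {}) = (\<Sum>k\<in>{-1..<0}. qterm (- b) (- a) (- 1) (delta {}) k)"
        using psi_vac by (intro quad_eq_sum[OF r(2), of 0]) auto
      also have "{-1..<0::int} = {-1}" by auto
      finally have "quad (- b) (- a) (- 1) (delta {}) = psi (- b) (- 1) ?z"
        by (simp add: qterm_def)
      then have "quad a b m (quad (- b) (- a) (- m) (delta {})) = quad a b 1 (psi (- b) (- 1) ?z)"
        by (simp add: m1)
      also have "\<dots> = psi (- b) (- 1) (quad a b 1 ?z) + psi a 0 ?z"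
        unfolding quad_psi[OF z r(1)] using ab by simp
      also have "quad a b 1 ?z = 0"
        unfolding quad_psi[OF vac_fock r(1)] using ab psi_vac by (simp add: quad_vac r psi_linear)
      also have "psi a 0 ?z = delta {}"
        by (subst psi_anticomm) (simp add: psi_vac psi_linear)
      also have "psi (- b) (- 1) 0 + delta {} = delta {}" by (simp add: psi_linear)
      finally have "quad a b m (quad (- b) (- a) (- m) (delta {})) = delta {}" .
      then show ?thesis
        by (simp only: m1 quad_vac[OF r(1)] zero_le_one quad_0 ch add_0 of_int_1 fscale_simps)
    qed
  next
    case (create c k y)
    let ?A = "quad a b m" and ?B = "quad (- b) (- a) (- m)"
    have f: "\<bar>e\<bar> \<le> int n \<Longrightarrow> psi e l y \<in> fock n" for e l
      by (rule psi_fock[OF create(3)])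
    have fA: "?A y \<in> fock n" and fB: "?B y \<in> fock n"
      using create(3) ab by (auto intro: quad_fock)
    have g: "\<bar>e\<bar> \<le> int n \<Longrightarrow> psi e l (?A y) \<in> fock n" "\<bar>e\<bar> \<le> int n \<Longrightarrow> psi e l (?B y) \<in> fock n" for e l
      by (auto intro: psi_fock fA fB)
    have A: "?A (psi e s x) = psi e s (?A x) + (if e = - b then psi a (m + s) x else 0)
        - (if e = - a then psi b (m + s) x else 0)" if "x \<in> fock n" for e s x
      by (rule quad_psi[OF that r(1)])
    have B: "?B (psi e s x) = psi e s (?B x) + (if e = a then psi (- b) (s - m) x else 0)
        - (if e = b then psi (- a) (s - m) x else 0)" if "x \<in> fock n" for e s x
      using quad_psi[OF that r(2), of "- m" e s] by simp
    have "?A (?B (psi c k y)) = ?A (psi c k (?B y)) + (if c = a then ?A (psi (- b) (k - m) y) else 0)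
        - (if c = b then ?A (psi (- a) (k - m) y) else 0)"
      unfolding B[OF create(3)] using create(1) ab f g
      by (auto simp: quad_add[where n = n, OF _ _ r(1)] quad_minus[where n = n, OF _ _ r(1)] fock_add fock_minus)
    also have "\<dots> = psi c k (?A (?B y)) + (if c = - b then psi a (m + k) (?B y) else 0)
        - (if c = - a then psi b (m + k) (?B y) else 0)
        + (if c = a then psi (- b) (k - m) (?A y) + psi a k y else 0)
        - (if c = b then psi (- a) (k - m) (?A y) - psi b k y else 0)"
      unfolding A[OF fB] A[OF create(3)] using ab by auto
    finally have 1: "?A (?B (psi c k y)) = \<dots>" .
    have "?B (?A (psi c k y)) = ?B (psi c k (?A y)) + (if c = - b then ?B (psi a (m + k) y) else 0)
        - (if c = - a then ?B (psi b (m + k) y) else 0)"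
      unfolding A[OF create(3)] using create(1) ab f g
      by (auto simp: quad_add[where n = n, OF _ _ r(2)] quad_minus[where n = n, OF _ _ r(2)] fock_add fock_minus)
    also have "\<dots> = psi c k (?B (?A y)) + (if c = a then psi (- b) (k - m) (?A y) else 0)
        - (if c = b then psi (- a) (k - m) (?A y) else 0)
        + (if c = - b then psi a (m + k) (?B y) + psi (- b) k y else 0)
        - (if c = - a then psi b (m + k) (?B y) - psi (- a) k y else 0)"
      unfolding B[OF fA] B[OF create(3)] using ab by auto
    finally have 2: "?B (?A (psi c k y)) = \<dots>" .
    \<comment> \<open>The mixed terms with \<open>?A y\<close> or \<open>?B y\<close> agree in the
      two compositions. What remains, plus or minus \<open>psi c k y\<close> for c among the colours
      a, b and their negatives, is the change of charge recorded by
      \<open>charge_psi\<close>.\<close>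
    show ?case
      unfolding 1 2 create.IH charge_psi[OF create(3,2)] psi_linear
      by (auto simp: fun_eq_iff algebra_simps)
  next
    case (add y z)
    have f: "quad a b m y \<in> fock n" "quad a b m z \<in> fock n"
      "quad (- b) (- a) (- m) y \<in> fock n" "quad (- b) (- a) (- m) z \<in> fock n"
      using add ab by (auto intro: quad_fock)
    show ?case
      by (simp only: quad_add[OF add(1,2) r(1)] quad_add[OF add(1,2) r(2)] quad_add[OF f(1,2) r(2)]
          quad_add[OF f(3,4) r(1)] charge_linear fv.scale_right_distrib add.IH ac_simps)
  next
    case (scale t y)
    have f: "quad a b m y \<in> fock n" "quad (- b) (- a) (- m) y \<in> fock n"
      using scale ab by (auto intro: quad_fock)
    show ?case
      by (simp only: quad_fscale[OF scale(1) r(1)] quad_fscale[OF scale(1) r(2)]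
          quad_fscale[OF f(1) r(2)] quad_fscale[OF f(2) r(1)] charge_linear fv.scale_right_distrib
          scale.IH fv.scale_left_commute)
  }
qed

text \<open>Normal ordering made explicit. For l < 0 the term counts the mode (a, l); for l \<ge> 0
  it is one minus the occupation of (-a, -1-l), and subtracting \<open>x\<close> removes the one. A
  window reaching K on both sides contains all occupied modes.\<close>

lemma charge_eq_sum:
  assumes x: "x \<in> fock n" and K: "K \<ge> 0" "\<And>S a l. x S \<noteq> 0 \<Longrightarrow> (a, l) \<in> S \<Longrightarrow> - K \<le> l"
    and LU: "L \<le> - K" "K \<le> U"
  shows "charge a x = (\<Sum>l\<in>{L..<U}. psi a l (psi (- a) (- 1 - l) x) - (if 0 \<le> l then x else 0))"
    (is "_ = sum ?t _")
proof
  fix S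
  have neg: "?t l S = (if (a, l) \<in> S then x S else 0)" if "l < 0" for l
    using that by (simp add: psi_def create_def annihilate_def insert_absorb)
      (auto simp: insert_absorb mode_sign_remove)
  have pos: "?t l S = - (if (- a, - 1 - l) \<in> S then x S else 0)" if "0 \<le> l" for l
    using that by (simp add: psi_def create_def annihilate_def mode_sign_insert)
  have "{L..<U} = {L..<0} \<union> {0..<U}" using LU K(1) by auto
  then have "sum ?t {L..<U} S = (\<Sum>l\<in>{L..<0}. ?t l S) + (\<Sum>l\<in>{0..<U}. ?t l S)"
    unfolding fun_sum_apply by (simp only:) (rule sum.union_disjoint, auto)
  also have "(\<Sum>l\<in>{L..<0}. ?t l S) = of_nat (card {l \<in> {L..<0}. (a, l) \<in> S}) * x S"
  proof -
    have "(\<Sum>l\<in>{L..<0}. ?t l S) = (\<Sum>l\<in>{L..<0}. if (a, l) \<in> S then x S else 0)"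
      by (rule sum.cong[OF refl neg]) simp
    then show ?thesis by (simp only:) (simp flip: sum.inter_filter)
  qed
  also have "(\<Sum>l\<in>{0..<U}. ?t l S) = - (of_nat (card {l \<in> {0..<U}. (- a, - 1 - l) \<in> S}) * x S)"
  proof -
    have "(\<Sum>l\<in>{0..<U}. ?t l S) = (\<Sum>l\<in>{0..<U}. - (if (- a, - 1 - l) \<in> S then x S else 0))"
      by (rule sum.cong[OF refl pos]) simp
    then show ?thesis by (simp only: sum_negf) (simp flip: sum.inter_filter)
  qed
  finally have eq: "sum ?t {L..<U} S = of_nat (card {l \<in> {L..<0}. (a, l) \<in> S}) * x S
      - of_nat (card {l \<in> {0..<U}. (- a, - 1 - l) \<in> S}) * x S"
    by (simp only: add_uminus_conv_diff)
  show "charge a x S = sum ?t {L..<U} S"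
  proof (cases "x S = 0")
    case True
    then show ?thesis unfolding eq by (simp add: charge_def)
  next
    case False
    then have S: "S \<subseteq> modes n" using fock_states[OF x] by (auto simp: states_def)
    have b: "- K \<le> l \<and> l < 0" if "(c, l) \<in> S" for c l
      using K(2)[OF False that] S that by (auto simp: modes_def)
    have "{l \<in> {L..<0}. (a, l) \<in> S} = {l. (a, l) \<in> S}"
      using b LU by force
    moreover have "card {l \<in> {0..<U}. (- a, - 1 - l) \<in> S} = card {l. (- a, l) \<in> S}"
    proof (rule bij_betw_same_card)
      show "bij_betw (\<lambda>l. - 1 - l) {l \<in> {0..<U}. (- a, - 1 - l) \<in> S} {l. (- a, l) \<in> S}"
      proof (rule bij_betwI)
        show "(\<lambda>l. - 1 - l) \<in> {l. (- a, l) \<in> S} \<rightarrow> {l \<in> {0..<U}. (- a, - 1 - l) \<in> S}"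
          using b LU by force
      qed auto
    qed
    ultimately show ?thesis unfolding eq by (simp add: charge_def chg_def algebra_simps)
  qed
qed

text \<open>Downward induction on \<open>k\<close>: once the modes above \<open>k\<close> annihilate \<open>x\<close>, the vanishing of the
  Heisenberg operators turns \<open>\<psi>\<^sub>a(k)\<close> applied to the charge of \<open>x\<close> into a double sum that is
  antisymmetric, up to \<open>-(k + 1)\<close> times \<open>\<psi>\<^sub>a(k) x\<close> from normal ordering.\<close>

lemma heisenberg_vacuum:
  assumes x: "x \<in> fock n" and a: "a \<noteq> 0"
    and H: "\<And>m. m \<ge> 1 \<Longrightarrow> quad a (- a) m x = 0"
    and Q: "charge a x = fscale (of_int \<kappa>) x"
    and k: "k \<ge> - \<kappa>"
  shows "psi a k x = 0"
proof -
  obtain K where K: "K \<ge> 0" "\<And>S a l. x S \<noteq> 0 \<Longrightarrow> (a, l) \<in> S \<Longrightarrow> - K \<le> l"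
    using fock_bound[OF x] by metis
  have van: "psi c l x = 0" if "l \<ge> K" for c l
    using psi_vanish[OF K(2,1) that] .
  show ?thesis using k
  proof (induction "nat (K - k)" arbitrary: k rule: less_induct)
    case less
    show ?case
    proof (cases "k \<ge> K")
      case True
      then show ?thesis by (rule van)
    next
      case False
      have above: "psi a l x = 0" if "l > k" for l
        using less.hyps[of l] less.prems that False by simp
      \<comment> \<open>Below all occupied modes, as the sums for the charge and for every
        \<open>quad a (- a) (k - l)\<close> require, and not above k, so that the range splits at
        k.\<close>
      define L where "L = min (- K) k"
      define T where "T l j = psi a l (psi a j (psi (- a) (k - l - 1 - j) x))" for l j
      have anti: "psi a l (psi a j y) = - psi a j (psi a l y)" for l j y
        by (subst psi_anticomm) (use a in simp)
      have T_anti: "T l j = - T j l" for l j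
        unfolding T_def by (subst anti) (simp add: algebra_simps)
      \<comment> \<open>Apply \<open>psi a l\<close> to the vanishing Heisenberg operator of degree
        k - l. Terms with j > k drop out after exchanging factors; the term j = k is the one met in
        the charge sum, and the rest is a row of \<open>T\<close>.\<close>
      have row: "psi a l (psi a k (psi (- a) (- 1 - l) x)) = - (\<Sum>j\<in>{L..<k}. T l j)"
        if l: "l \<in> {L..<k}" for l
      proof -
        have reg: "regular a (- a) (k - l)" "regular (- a) a (k - l)" using l by (auto simp: regular_def)
        have "quad a (- a) (k - l) x = (\<Sum>j\<in>{L..<K}. qterm a (- a) (k - l) x j)"
          by (rule quad_eq_sum[OF reg(1) van]) (use l L_def in auto)
        also have "\<dots> = (\<Sum>j\<in>{L..<k + 1}. qterm a (- a) (k - l) x j)"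
        proof (rule sum.mono_neutral_right)
          show "\<forall>j\<in>{L..<K} - {L..<k + 1}. qterm a (- a) (k - l) x j = 0"
            by (subst qterm_swap[OF reg(1)]) (auto simp: qterm_def above psi_linear)
        qed (use False in auto)
        also have "{L..<k + 1} = insert k {L..<k}" using l by auto
        also have "sum (qterm a (- a) (k - l) x) (insert k {L..<k}) =
            qterm a (- a) (k - l) x k + (\<Sum>j\<in>{L..<k}. qterm a (- a) (k - l) x j)"
          by simp
        also have "quad a (- a) (k - l) x = 0" using H[of "k - l"] l by simp
        finally have "psi a l (qterm a (- a) (k - l) x k + (\<Sum>j\<in>{L..<k}. qterm a (- a) (k - l) x j)) = 0"
          by (metis psi_linear(1))
        then have "0 = psi a l (qterm a (- a) (k - l) x k) +
            (\<Sum>j\<in>{L..<k}. psi a l (qterm a (- a) (k - l) x j))"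
          by (simp only: psi_linear psi_sum)
        then show ?thesis
          by (simp add: T_def qterm_def eq_neg_iff_add_eq_0 minus_diff_commute)
      qed
      let ?S = "\<Sum>l\<in>{L..<k}. \<Sum>j\<in>{L..<k}. T l j"
      have "?S = (\<Sum>j\<in>{L..<k}. \<Sum>l\<in>{L..<k}. T l j)" by (rule sum.swap)
      also have "\<dots> = (\<Sum>j\<in>{L..<k}. \<Sum>l\<in>{L..<k}. - T j l)"
        by (intro sum.cong refl) (rule T_anti)
      also have "\<dots> = - ?S" by (simp only: sum_negf)
      finally have S0: "?S = 0" by (simp add: fun_eq_iff)
      let ?y = "psi a k x"
      have low: "(\<Sum>l\<in>{L..<k}. psi a k (psi a l (psi (- a) (- 1 - l) x))) = 0"
      proof -
        have "(\<Sum>l\<in>{L..<k}. psi a k (psi a l (psi (- a) (- 1 - l) x))) = ?S"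
          by (intro sum.cong refl, subst anti) (simp only: row minus_minus)
        then show ?thesis by (simp only: S0)
      qed
      \<comment> \<open>For l > k the operator \<open>psi a l\<close> kills \<open>x\<close>, so the
        product in the charge sum is the identity on \<open>x\<close>.\<close>
      have high: "psi a k (psi a l (psi (- a) (- 1 - l) x)) = ?y" if "l \<in> {k + 1..<K}" for l
      proof -
        have "psi a l (psi (- a) (- 1 - l) x) = x - psi (- a) (- 1 - l) (psi a l x)"
          by (subst psi_anticomm) simp
        also have "\<dots> = x" using that by (simp add: above psi_linear)
        finally show ?thesis by simp
      qed
      have "fscale (of_int \<kappa>) ?y = psi a k (charge a x)"
        by (simp add: Q psi_linear)
      also have "charge a x = (\<Sum>l\<in>{L..<K}. psi a l (psi (- a) (- 1 - l) x) - (if 0 \<le> l then x else 0))"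
        by (rule charge_eq_sum[OF x K(1) K(2)]) (auto simp: L_def)
      also have "psi a k \<dots> = (\<Sum>l\<in>{L..<K}. psi a k (psi a l (psi (- a) (- 1 - l) x)))
          - (\<Sum>l\<in>{L..<K}. if 0 \<le> l then ?y else 0)"
        unfolding psi_sum psi_linear sum_subtractf
        by (simp only: if_distrib[of "psi a k"] psi_linear)
      also have "{L..<K} = {L..<k} \<union> insert k {k + 1..<K}" using False by (auto simp: L_def)
      also have "(\<Sum>l\<in>{L..<k} \<union> insert k {k + 1..<K}. psi a k (psi a l (psi (- a) (- 1 - l) x))) =
          (\<Sum>l\<in>{k + 1..<K}. ?y)"
      proof -
        have "(\<Sum>l\<in>{L..<k} \<union> insert k {k + 1..<K}. psi a k (psi a l (psi (- a) (- 1 - l) x))) =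
          (\<Sum>l\<in>{L..<k}. psi a k (psi a l (psi (- a) (- 1 - l) x))) +
          (\<Sum>l\<in>insert k {k + 1..<K}. psi a k (psi a l (psi (- a) (- 1 - l) x)))"
          by (rule sum.union_disjoint) auto
        also have "(\<Sum>l\<in>insert k {k + 1..<K}. psi a k (psi a l (psi (- a) (- 1 - l) x))) =
          (\<Sum>l\<in>{k + 1..<K}. psi a k (psi a l (psi (- a) (- 1 - l) x)))"
          by (simp add: psi_psi_same[OF a])
        also have "\<dots> = (\<Sum>l\<in>{k + 1..<K}. ?y)"
          by (rule sum.cong[OF refl high])
        finally show ?thesis by (simp only: low add_0_left)
      qed
      also have "{L..<k} \<union> insert k {k + 1..<K} = {L..<0} \<union> {0..<K}"
        using False K(1) by (auto simp: L_def)
      also have "(\<Sum>l\<in>{L..<0} \<union> {0..<K}. if 0 \<le> l then ?y else 0) = (\<Sum>l\<in>{0..<K}. ?y)"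
        by (rule sum.mono_neutral_cong_right) auto
      finally have eq: "fscale (of_int \<kappa>) ?y = (\<Sum>l\<in>{k + 1..<K}. ?y) - (\<Sum>l\<in>{0..<K}. ?y)" .
      show ?thesis
      proof
        fix S
        \<comment> \<open>The indices above k contribute K - (k + 1) copies and the vacuum
          subtraction removes K copies. The resulting factor \<open>\<kappa> + 1 + k\<close> is at
          least 1 because k \<ge> -\<open>\<kappa>\<close>.\<close>
        have "of_int \<kappa> * ?y S = of_nat (nat (K - (k + 1))) * ?y S - of_nat (nat K) * ?y S"
          using fun_cong[OF eq, of S] by (simp add: fun_sum_apply)
        then have "of_int (\<kappa> + 1 + k) * ?y S = 0"
          using False K(1) by (simp add: algebra_simps)
        then show "?y S = 0 S" using less.prems by (simp del: of_int_add)
      qed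
    qed
  qed
qed

section \<open>The Hermitian form making basis states orthonormal\<close>

definition ip :: "fvec \<Rightarrow> fvec \<Rightarrow> complex" where
  "ip x y = (\<Sum>S | x S \<noteq> 0. cnj (x S) * y S)"

lemma ip_superset: "\<lbrakk>finite T; {S. x S \<noteq> 0} \<subseteq> T\<rbrakk> \<Longrightarrow> ip x y = (\<Sum>S\<in>T. cnj (x S) * y S)"
  unfolding ip_def by (rule sum.mono_neutral_left) auto

lemma ip_cnj:
  assumes "x \<in> fock n" "y \<in> fock n"
  shows "cnj (ip x y) = ip y x"
proof -
  let ?T = "{S. x S \<noteq> 0} \<union> {S. y S \<noteq> 0}"
  have T: "finite ?T" using assms by (simp add: fock_finite)
  have "ip x y = (\<Sum>S\<in>?T. cnj (x S) * y S)" "ip y x = (\<Sum>S\<in>?T. cnj (y S) * x S)"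
    by (auto intro!: ip_superset T)
  then show ?thesis by (simp add: mult.commute)
qed

lemma ip_right:
  "ip x 0 = 0" "ip x (y + z) = ip x y + ip x z" "ip x (fscale c y) = c * ip x y"
  by (simp_all add: ip_def sum.distrib sum_distrib_left algebra_simps)

lemma ip_sum_right: "ip x (\<Sum>i\<in>I. f i) = (\<Sum>i\<in>I. ip x (f i))"
  using sum_comp_morphism[of "ip x" f I] by (simp add: o_def ip_right)

lemma ip_fscale_left: "x \<in> fock n \<Longrightarrow> ip (fscale c x) y = cnj c * ip x y"
  using ip_superset[of "{S. x S \<noteq> 0}" "fscale c x" y] fock_finite[of x n]
  by (simp add: ip_def sum_distrib_left mult.assoc subset_iff)

lemma ip_delta: "ip (delta S) y = y S"
  using ip_superset[of "{S}" "delta S" y] by (auto simp: delta_def)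

lemma ip_self: "ip x x = of_real (\<Sum>S | x S \<noteq> 0. (cmod (x S))\<^sup>2)"
  by (simp only: ip_def of_real_sum mult.commute[of "cnj _"] complex_norm_square)

lemma ip_self_pos:
  assumes "x \<in> fock n" "x \<noteq> 0"
  shows "0 < Re (ip x x)"
proof -
  obtain S where "x S \<noteq> 0" using assms(2) by (auto simp: fun_eq_iff)
  then have "0 < (\<Sum>S | x S \<noteq> 0. (cmod (x S))\<^sup>2)"
    using fock_finite[OF assms(1)] by (intro sum_pos2[of _ S]) auto
  then show ?thesis by (simp add: ip_self)
qed

lemma ip_self_nonneg: "0 \<le> Re (ip x x)"
  by (simp add: ip_self sum_nonneg)

lemma ip_create:
  assumes "x \<in> fock n"
  shows "ip (create u x) y = ip x (annihilate u y)"
proof -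
  let ?T = "{S. u \<notin> S \<and> x S \<noteq> 0}"
  have T: "finite ?T" by (rule finite_subset[OF _ fock_finite[OF assms]]) auto
  have "{S. create u x S \<noteq> 0} \<subseteq> insert u ` ?T"
  proof
    fix S assume "S \<in> {S. create u x S \<noteq> 0}"
    then have "u \<in> S" "x (S - {u}) \<noteq> 0" by (auto simp: create_def split: if_splits)
    then show "S \<in> insert u ` ?T" by (intro image_eqI[of _ _ "S - {u}"]) auto
  qed
  then have "ip (create u x) y = (\<Sum>S\<in>insert u ` ?T. cnj (create u x S) * y S)"
    using T by (intro ip_superset) auto
  also have "\<dots> = (\<Sum>S\<in>?T. cnj (create u x (insert u S)) * y (insert u S))"
    by (rule sum.reindex_cong[where l = "insert u"]) (auto intro!: inj_onI)
  also have "\<dots> = (\<Sum>S\<in>?T. cnj (x S) * annihilate u y S)"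
    by (rule sum.cong) (auto simp: create_def annihilate_def mode_sign_insert)
  also have "\<dots> = ip x (annihilate u y)"
    unfolding ip_def by (rule sum.mono_neutral_left[OF fock_finite[OF assms]]) (auto simp: annihilate_def)
  finally show ?thesis .
qed

lemma ip_psi:
  assumes "x \<in> fock n" "y \<in> fock n" "\<bar>a\<bar> \<le> int n"
  shows "ip (psi a k x) y = ip x (psi (- a) (- 1 - k) y)"
proof (cases "k < 0")
  case True
  then show ?thesis using ip_create[OF assms(1)] by (simp add: psi_def)
next
  case False
  let ?u = "(- a, - 1 - k)"
  have f: "create ?u y \<in> fock n" using False assms by (intro create_fock) (auto simp: modes_def)
  have "ip (annihilate ?u x) y = cnj (ip y (annihilate ?u x))"
    by (rule ip_cnj[symmetric, OF assms(2) annihilate_fock[OF assms(1)]])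
  also have "\<dots> = cnj (ip (create ?u y) x)" by (simp only: ip_create[OF assms(2)])
  also have "\<dots> = ip x (create ?u y)" by (rule ip_cnj[OF f assms(1)])
  finally show ?thesis using False by (simp add: psi_def)
qed

text \<open>Taking adjoints reverses the two factors, and the term with index k turns into the term
  with index k - m of the adjoint operator. Hence the two finite windows differ by the shift
  m.\<close>

lemma ip_quad:
  assumes x: "x \<in> fock n" and y: "y \<in> fock n" and ab: "\<bar>a\<bar> \<le> int n" "\<bar>b\<bar> \<le> int n"
    and r: "regular a b m"
  shows "ip (quad a b m x) y = ip x (quad (- b) (- a) (- m) y)"
proof -
  have r': "regular (- b) (- a) (- m)" using r by (auto simp: regular_def)
  obtain Kx where Kx: "\<And>c l. l \<ge> Kx \<Longrightarrow> psi c l x = 0" using fock_psi_bound[OF x] by metis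
  obtain Ky where Ky: "\<And>c l. l \<ge> Ky \<Longrightarrow> psi c l y = 0" using fock_psi_bound[OF y] by metis
  \<comment> \<open>Large enough for the window on the side of \<open>x\<close> and for the shifted
    window on the side of \<open>y\<close>.\<close>
  define K where "K = \<bar>Kx\<bar> + \<bar>Ky\<bar> + \<bar>m\<bar>"
  have qx: "quad a b m x = (\<Sum>k\<in>{- K..<K}. qterm a b m x k)"
    by (rule quad_eq_sum[OF r Kx]) (auto simp: K_def)
  have qy: "quad (- b) (- a) (- m) y = (\<Sum>k\<in>{- K - m..<K - m}. qterm (- b) (- a) (- m) y k)"
    by (rule quad_eq_sum[OF r' Ky]) (auto simp: K_def)
  have "ip (quad a b m x) y = cnj (ip y (quad a b m x))"
    by (rule ip_cnj[symmetric, OF y quad_fock[OF x ab]])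
  also have "\<dots> = (\<Sum>k\<in>{- K..<K}. cnj (ip y (qterm a b m x k)))"
    by (simp add: qx ip_sum_right)
  also have "\<dots> = (\<Sum>k\<in>{- K..<K}. ip x (qterm (- b) (- a) (- m) y (k - m)))"
  proof (rule sum.cong[OF refl])
    fix k
    have f: "psi b (m - 1 - k) x \<in> fock n" "psi (- a) (- 1 - k) y \<in> fock n"
      using x y ab by (auto intro: psi_fock)
    have "cnj (ip y (qterm a b m x k)) = ip (psi a k (psi b (m - 1 - k) x)) y"
      unfolding qterm_def by (rule ip_cnj[OF y psi_fock[OF f(1) ab(1)]])
    also have "\<dots> = ip x (psi (- b) (- 1 - (m - 1 - k)) (psi (- a) (- 1 - k) y))"
      by (simp only: ip_psi[OF f(1) y ab(1)] ip_psi[OF x f(2) ab(2)])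
    also have "\<dots> = ip x (qterm (- b) (- a) (- m) y (k - m))"
      by (simp add: qterm_def)
    finally show "cnj (ip y (qterm a b m x k)) = ip x (qterm (- b) (- a) (- m) y (k - m))" .
  qed
  also have "\<dots> = (\<Sum>k\<in>{- K - m..<K - m}. ip x (qterm (- b) (- a) (- m) y k))"
    by (rule sum.reindex_bij_witness[where i = "\<lambda>k. k + m" and j = "\<lambda>k. k - m"]) auto
  finally show ?thesis by (simp only: qy ip_sum_right)
qed

section \<open>Chevalley generators and singular vectors\<close>

definition colour_weight :: "nat \<Rightarrow> int \<Rightarrow> weight" where
  "colour_weight n a = wscale (of_int (sgn a)) (c_weight n (nat \<bar>a\<bar>))"

definition mode_weight :: "nat \<Rightarrow> mode \<Rightarrow> weight" where
  "mode_weight n u = colour_weight n (fst u) + wscale (of_int (- 2 * snd u - 1)) (q_weight n)"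

text \<open>\<open>\<kappa>\<close> is the weight assigned to the empty state, the vacuum.\<close>

definition state_weight :: "nat \<Rightarrow> weight \<Rightarrow> mode set \<Rightarrow> weight" where
  "state_weight n \<kappa> S = \<kappa> + (\<Sum>u\<in>S. mode_weight n u)"

definition grade :: "nat \<Rightarrow> bool \<Rightarrow> weight \<Rightarrow> weight \<Rightarrow> fvec set" where
  "grade n p \<kappa> \<mu> =
     {x \<in> fock n. \<forall>S. x S \<noteq> 0 \<longrightarrow> even (card S) = p \<and> state_weight n \<kappa> S = \<mu>}"

lemma colour_weight_uminus: "colour_weight n (- a) = - colour_weight n a"
  by (simp add: colour_weight_def fun_eq_iff)

lemma mode_weight_uminus: "mode_weight n (- a, - 1 - k) = - mode_weight n (a, k)"
  by (simp add: mode_weight_def colour_weight_uminus fun_eq_iff algebra_simps)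

lemma state_weight_insert:
  "\<lbrakk>finite S; u \<notin> S\<rbrakk> \<Longrightarrow> state_weight n \<kappa> (insert u S) = state_weight n \<kappa> S + mode_weight n u"
  by (simp add: state_weight_def fun_eq_iff)

lemma grade_fock: "x \<in> grade n p \<kappa> \<mu> \<Longrightarrow> x \<in> fock n"
  by (simp add: grade_def)

lemma grade_0 [simp]: "0 \<in> grade n p \<kappa> \<mu>"
  by (simp add: grade_def)

lemma grade_add: "\<lbrakk>x \<in> grade n p \<kappa> \<mu>; y \<in> grade n p \<kappa> \<mu>\<rbrakk> \<Longrightarrow> x + y \<in> grade n p \<kappa> \<mu>"
  unfolding grade_def by (auto intro: fock_add) (metis add.right_neutral)+

lemma grade_fscale: "x \<in> grade n p \<kappa> \<mu> \<Longrightarrow> fscale c x \<in> grade n p \<kappa> \<mu>"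
  by (auto simp: grade_def intro: fock_fscale)

lemma grade_sum: "(\<And>i. i \<in> I \<Longrightarrow> f i \<in> grade n p \<kappa> \<mu>) \<Longrightarrow> (\<Sum>i\<in>I. f i) \<in> grade n p \<kappa> \<mu>"
  by (induction I rule: infinite_finite_induct) (auto intro: grade_add)

lemma grade_psi:
  assumes "x \<in> grade n p \<kappa> \<mu>" "\<bar>a\<bar> \<le> int n"
  shows "psi a k x \<in> grade n (\<not> p) \<kappa> (\<mu> + mode_weight n (a, k))"
proof -
  have x: "x \<in> fock n" using assms(1) by (rule grade_fock)
  have fin: "finite T" if "x T \<noteq> 0" for T
    using fock_states[OF x that] by (simp add: states_def)
  have "even (card S) = (\<not> p) \<and> state_weight n \<kappa> S = \<mu> + mode_weight n (a, k)"
    if S: "psi a k x S \<noteq> 0" for S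
  proof (cases "k < 0")
    case True
    with S have u: "(a, k) \<in> S" "x (S - {(a, k)}) \<noteq> 0"
      by (auto simp: psi_def create_def split: if_splits)
    then obtain T where T: "S = insert (a, k) T" "(a, k) \<notin> T" "x T \<noteq> 0"
      by (metis Diff_iff insertI1 insert_Diff)
    with assms(1) fin[OF T(3)] show ?thesis
      by (auto simp: grade_def state_weight_insert)
  next
    case False
    let ?u = "(- a, - 1 - k)"
    from False S have u: "?u \<notin> S" "x (insert ?u S) \<noteq> 0"
      by (auto simp: psi_def annihilate_def split: if_splits)
    then have fS: "finite S" using fin by fastforce
    have "even (card (insert ?u S)) = p" "state_weight n \<kappa> (insert ?u S) = \<mu>"
      using assms(1) u by (auto simp: grade_def)
    then have w: "\<mu> = state_weight n \<kappa> S + - mode_weight n (a, k)" "odd (card S) = p"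
      using card_insert_disjoint[OF fS u(1)] state_weight_insert[OF fS u(1), of n \<kappa>]
      by (simp_all only: mode_weight_uminus even_Suc)
    have "state_weight n \<kappa> S = \<mu> + mode_weight n (a, k)"
      unfolding w(1) by simp
    with w(2) show ?thesis by blast
  qed
  then show ?thesis using psi_fock[OF x assms(2)] by (simp add: grade_def)
qed

lemma grade_quad:
  assumes "x \<in> grade n p \<kappa> \<mu>" "\<bar>a\<bar> \<le> int n" "\<bar>b\<bar> \<le> int n"
  shows "quad a b m x \<in> grade n p \<kappa>
    (\<mu> + (colour_weight n a + colour_weight n b + wscale (of_int (- 2 * m)) (q_weight n)))"
proof -
  have "qterm a b m x k \<in> grade n p \<kappa>
    (\<mu> + (colour_weight n a + colour_weight n b + wscale (of_int (- 2 * m)) (q_weight n)))" for k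
  proof -
    have "qterm a b m x k \<in> grade n (\<not> \<not> p) \<kappa>
        (\<mu> + mode_weight n (b, m - 1 - k) + mode_weight n (a, k))"
      unfolding qterm_def by (intro grade_psi assms)
    moreover have "\<mu> + mode_weight n (b, m - 1 - k) + mode_weight n (a, k) =
        \<mu> + (colour_weight n a + colour_weight n b + wscale (of_int (- 2 * m)) (q_weight n))"
      by (simp add: mode_weight_def fun_eq_iff algebra_simps)
    ultimately show ?thesis by simp
  qed
  then show ?thesis by (simp add: quad_def Sum_any.expand_set grade_sum)
qed

section \<open>Chevalley generators as quadratic operators\<close>

definition gen_a :: "nat \<Rightarrow> int" where
  "gen_a i = (if i = 0 then - 1 else int i)"

text \<open>The two colours spell out the simple root:
  \<open>\<epsilon>\<^sub>i - \<epsilon>\<^sub>i\<^sub>+\<^sub>1\<close> for 1 \<le> i < n,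
  \<open>\<epsilon>\<^sub>n\<close> with a neutral second factor for i = n, and
  \<open>- \<epsilon>\<^sub>1 - \<epsilon>\<^sub>2\<close> for i = 0, where \<open>gen_m\<close>
  supplies the null root.\<close>

definition gen_b :: "nat \<Rightarrow> nat \<Rightarrow> int" where
  "gen_b n i = (if i = 0 then - 2 else if i = n then 0 else - (int i + 1))"

definition gen_m :: "nat \<Rightarrow> int" where
  "gen_m i = (if i = 0 then 1 else 0)"

text \<open>The coroot of the short root is twice the last coordinate, while the commutator of the
  two quadratic operators yields the charge only once; \<open>f_op\<close> absorbs the
  factor.\<close>

definition gen_s :: "nat \<Rightarrow> nat \<Rightarrow> int" where
  "gen_s n i = (if i = n then 2 else 1)"

definition e_op :: "nat \<Rightarrow> nat \<Rightarrow> fvec \<Rightarrow> fvec" where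
  "e_op n i = quad (gen_a i) (gen_b n i) (gen_m i)"

definition f_op :: "nat \<Rightarrow> nat \<Rightarrow> fvec \<Rightarrow> fvec" where
  "f_op n i x = fscale (of_int (gen_s n i)) (quad (- gen_b n i) (- gen_a i) (- gen_m i) x)"

lemma gen_facts:
  assumes "3 \<le> n" "i \<le> n"
  shows "\<bar>gen_a i\<bar> \<le> int n" "\<bar>gen_b n i\<bar> \<le> int n" "gen_a i \<noteq> gen_b n i" "gen_a i \<noteq> - gen_b n i"
    "regular (gen_a i) (gen_b n i) m" "regular (- gen_b n i) (- gen_a i) m" "gen_m i = 0 \<or> gen_m i = 1"
  using assms by (auto simp: gen_a_def gen_b_def gen_m_def regular_def)

lemma gen_weight:
  assumes "3 \<le> n" "i \<le> n"
  shows "colour_weight n (gen_a i) + colour_weight n (gen_b n i) +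
    wscale (of_int (- 2 * gen_m i)) (q_weight n) = simple_root n i"
proof -
  consider "i = 0" | "1 \<le> i" "i < n" | "i = n" using assms by linarith
  then show ?thesis
  proof cases
    case 1
    then show ?thesis using assms
      by (simp add: gen_a_def gen_b_def gen_m_def colour_weight_def simple_root_0_eq fun_eq_iff)
  next
    case 2
    then have "nat (1 + int i) = Suc i" by simp
    with 2 show ?thesis using assms
      by (simp add: gen_a_def gen_b_def gen_m_def colour_weight_def simple_root_eq fun_eq_iff)
  next
    case 3
    then show ?thesis using assms
      by (simp add: gen_a_def gen_b_def gen_m_def colour_weight_def fun_eq_iff flip: c_weight_last)
  qed
qed

lemma e_op_grade:
  assumes "3 \<le> n" "i \<le> n" "x \<in> grade n p \<kappa> \<mu>"
  shows "e_op n i x \<in> grade n p \<kappa> (\<mu> + simple_root n i)"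
  using grade_quad[OF assms(3) gen_facts(1,2)[OF assms(1,2)], of "gen_m i"]
  by (simp only: e_op_def gen_weight[OF assms(1,2)])

lemma f_op_grade:
  assumes "3 \<le> n" "i \<le> n" "x \<in> grade n p \<kappa> \<mu>"
  shows "f_op n i x \<in> grade n p \<kappa> (\<mu> - simple_root n i)"
proof -
  have "colour_weight n (- gen_b n i) + colour_weight n (- gen_a i) +
      wscale (of_int (- 2 * - gen_m i)) (q_weight n) = - simple_root n i"
    unfolding gen_weight[OF assms(1,2), symmetric] colour_weight_uminus by (simp add: fun_eq_iff)
  moreover have "quad (- gen_b n i) (- gen_a i) (- gen_m i) x \<in> grade n p \<kappa> (\<mu> +
      (colour_weight n (- gen_b n i) + colour_weight n (- gen_a i) +
      wscale (of_int (- 2 * - gen_m i)) (q_weight n)))"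
    by (rule grade_quad[OF assms(3)]) (use gen_facts[OF assms(1,2)] in auto)
  ultimately show ?thesis
    by (simp only: f_op_def add_uminus_conv_diff grade_fscale)
qed

lemma op_linear:
  assumes "3 \<le> n" "i \<le> n" "x \<in> fock n" "y \<in> fock n"
  shows "e_op n i (x + y) = e_op n i x + e_op n i y" "e_op n i (fscale c x) = fscale c (e_op n i x)"
    "f_op n i (x + y) = f_op n i x + f_op n i y" "f_op n i (fscale c x) = fscale c (f_op n i x)"
  using assms gen_facts[OF assms(1,2)]
  by (simp_all only: e_op_def f_op_def quad_add quad_fscale fv.scale_right_distrib fv.scale_left_commute)

lemma op_0 [simp]: "e_op n i 0 = 0" "f_op n i 0 = 0"
  by (simp_all only: e_op_def f_op_def quad_0 fv.scale_zero_right)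

lemma f_op_fock: "\<lbrakk>3 \<le> n; i \<le> n; x \<in> fock n\<rbrakk> \<Longrightarrow> f_op n i x \<in> fock n"
  using gen_facts[of n i] by (simp add: f_op_def quad_fock fock_fscale)

lemma ip_f_op:
  assumes "3 \<le> n" "i \<le> n" "x \<in> fock n" "y \<in> fock n"
  shows "ip (f_op n i x) y = of_int (gen_s n i) * ip x (e_op n i y)"
proof -
  have "quad (- gen_b n i) (- gen_a i) (- gen_m i) x \<in> fock n"
    using gen_facts[OF assms(1,2)] assms by (simp add: quad_fock)
  then have "ip (f_op n i x) y = of_int (gen_s n i) * ip (quad (- gen_b n i) (- gen_a i) (- gen_m i) x) y"
    by (simp only: f_op_def ip_fscale_left complex_cnj_of_int)
  also have "ip (quad (- gen_b n i) (- gen_a i) (- gen_m i) x) y = ip x (e_op n i y)"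
    using ip_quad[OF assms(3,4), of "- gen_b n i" "- gen_a i" "- gen_m i"] gen_facts[OF assms(1,2)]
    by (simp add: e_op_def)
  finally show ?thesis .
qed

text \<open>Phrased through \<open>gen_a\<close> and \<open>gen_b\<close> so that summing over a
  state gives precisely the charges on the right of \<open>quad_commutator_charge\<close>. For i = n
  the neutral colour cancels out of the second bracket.\<close>

lemma mode_weight_Coroot:
  assumes n: "3 \<le> n" and a: "\<bar>a\<bar> \<le> int n" and i: "i \<le> n"
  shows "mode_weight n (a, k) (Coroot i) =
    of_int (gen_s n i * ((if a = gen_a i then 1 else 0) - (if a = - gen_a i then 1 else 0) +
      ((if a = gen_b n i then 1 else 0) - (if a = - gen_b n i then 1 else 0))))"
proof (cases "a = 0")
  case True
  then show ?thesis using n i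
    by (simp add: mode_weight_def colour_weight_def q_weight_Coroot gen_a_def gen_b_def)
next
  case False
  have eq: "mode_weight n (a, k) (Coroot i) = of_int (sgn a) * c_weight n (nat \<bar>a\<bar>) (Coroot i)"
    using n i by (simp add: mode_weight_def colour_weight_def q_weight_Coroot)
  have c: "c_weight n (nat \<bar>a\<bar>) (Coroot i) =
    (if i = 0 then (if \<bar>a\<bar> \<le> 2 then -1 else 0)
     else if i = n then (if \<bar>a\<bar> = int n then 2 else 0)
     else (if \<bar>a\<bar> = int i then 1 else 0) - (if \<bar>a\<bar> = int i + 1 then 1 else 0))"
  proof -
    have *: "1 \<le> nat \<bar>a\<bar>" "nat \<bar>a\<bar> \<le> n" using a False by auto
    have "nat \<bar>a\<bar> \<le> 2 \<longleftrightarrow> \<bar>a\<bar> \<le> 2" "nat \<bar>a\<bar> = n \<longleftrightarrow> \<bar>a\<bar> = int n"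
      "nat \<bar>a\<bar> = i \<longleftrightarrow> \<bar>a\<bar> = int i" "nat \<bar>a\<bar> = Suc i \<longleftrightarrow> \<bar>a\<bar> = int i + 1"
      by linarith+
    then show ?thesis by (simp only: c_weight_Coroot[OF n * i])
  qed
  consider "i = 0" | "1 \<le> i" "i < n" | "i = n" using i by linarith
  then show ?thesis
  proof cases
    case 1
    then show ?thesis unfolding eq c using n False
      by (cases "0 < a") (simp_all add: gen_a_def gen_b_def gen_s_def sgn_if)
  next
    case 2
    then show ?thesis unfolding eq c using False
      by (cases "0 < a") (simp_all add: gen_a_def gen_b_def gen_s_def sgn_if)
  next
    case 3
    then show ?thesis unfolding eq c using n False
      by (cases "0 < a") (simp_all add: gen_a_def gen_b_def gen_s_def sgn_if)
  qed
qed

lemma chg_eq_sum: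
  assumes "finite S"
  shows "chg a S = (\<Sum>u\<in>S. (if fst u = a then 1 else 0) - (if fst u = - a then 1 else 0))"
  using assms
proof (induction S rule: finite_induct)
  case (insert u S)
  then show ?case using chg_insert[of S "fst u" "snd u" a] by simp
qed (simp add: chg_def)

lemma state_weight_Coroot:
  assumes n: "3 \<le> n" and S: "S \<in> states n" and i: "i \<le> n"
  shows "state_weight n \<kappa> S (Coroot i) = \<kappa> (Coroot i) +
    of_int (gen_s n i * (chg (gen_a i) S + chg (gen_b n i) S))"
proof -
  have fin: "finite S" and sub: "\<And>u. u \<in> S \<Longrightarrow> \<bar>fst u\<bar> \<le> int n"
    using S by (auto simp: states_def modes_def)
  have "(\<Sum>u\<in>S. mode_weight n u (Coroot i)) = (\<Sum>u\<in>S. of_int (gen_s n i *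
      ((if fst u = gen_a i then 1 else 0) - (if fst u = - gen_a i then 1 else 0) +
      ((if fst u = gen_b n i then 1 else 0) - (if fst u = - gen_b n i then 1 else 0)))))"
    using mode_weight_Coroot[OF n sub i] by (intro sum.cong refl) (metis prod.collapse)
  also have "\<dots> = of_int (gen_s n i * (chg (gen_a i) S + chg (gen_b n i) S))"
    unfolding chg_eq_sum[OF fin] by (simp only: flip: of_int_sum sum_distrib_left sum.distrib)
  finally show ?thesis by (simp only: state_weight_def plus_fun_apply fun_sum_apply)
qed

text \<open>The weight determines each charge, so a weight vector is a simultaneous eigenvector of
  the charge operators, as \<open>heisenberg_vacuum\<close> needs.\<close>

lemma eps_coord_state_weight:
  assumes n: "3 \<le> n" and S: "S \<in> states n" and i: "1 \<le> i" "i \<le> n"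
  shows "eps_coord n i (state_weight n \<kappa> S) = eps_coord n i \<kappa> + of_int (chg (int i) S)"
proof -
  have fin: "finite S" and sub: "\<And>u. u \<in> S \<Longrightarrow> \<bar>fst u\<bar> \<le> int n"
    using S by (auto simp: states_def modes_def)
  have "eps_coord n i (mode_weight n u) =
      of_int ((if fst u = int i then 1 else 0) - (if fst u = - int i then 1 else 0))" if "u \<in> S" for u
  proof (cases "fst u = 0")
    case False
    then have "eps_coord n i (c_weight n (nat \<bar>fst u\<bar>)) = (if \<bar>fst u\<bar> = int i then 1 else 0)"
      using sub[OF that] n i by (subst eps_coord_c_weight) auto
    with False show ?thesis using n i
      by (simp add: mode_weight_def colour_weight_def eps_coord_c_weight eps_coord_q_weight
        sgn_if abs_if)
  qed (use i n in \<open>simp add: mode_weight_def colour_weight_def eps_coord_q_weight\<close>)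
  then have "(\<Sum>u\<in>S. eps_coord n i (mode_weight n u)) =
    (\<Sum>u\<in>S. of_int ((if fst u = int i then 1 else 0) - (if fst u = - int i then 1 else 0)))"
    by (rule sum.cong[OF refl])
  then show ?thesis
    by (simp only: state_weight_def eps_coord_linear eps_coord_sum chg_eq_sum[OF fin] of_int_sum)
qed

text \<open>\<open>gen_m\<close> is 1 at node 0 and 0 elsewhere: the vacuum weight agrees with that
  of node 0 on coroots, and its value on the scaling element is free.\<close>

definition level_one :: "nat \<Rightarrow> weight \<Rightarrow> bool" where
  "level_one n \<kappa> \<longleftrightarrow> (\<forall>i\<le>n. \<kappa> (Coroot i) = of_int (gen_m i))"

text \<open>On a weight vector the charges and the central term of
  \<open>quad_commutator_charge\<close> combine to the value of the weight on the coroot. For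
  distinct nodes every contraction is absent or vanishes.\<close>

lemma e_f_commute:
  assumes n: "3 \<le> n" and i: "i \<le> n" and j: "j \<le> n" and x: "x \<in> grade n p \<kappa> \<mu>"
    and lev: "level_one n \<kappa>"
  shows "e_op n i (f_op n j x) = f_op n j (e_op n i x) + (if i = j then fscale (\<mu> (Coroot i)) x else 0)"
proof -
  note gi = gen_facts[OF n i] and gj = gen_facts[OF n j]
  have xf: "x \<in> fock n" using x by (rule grade_fock)
  have yf: "quad (- gen_b n j) (- gen_a j) (- gen_m j) x \<in> fock n"
    using xf gj by (simp add: quad_fock)
  have lhs: "e_op n i (f_op n j x) = fscale (of_int (gen_s n j))
      (quad (gen_a i) (gen_b n i) (gen_m i) (quad (- gen_b n j) (- gen_a j) (- gen_m j) x))"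
    unfolding e_op_def f_op_def by (rule quad_fscale[OF yf gi(5)])
  show ?thesis
  proof (cases "i = j")
    case True
    have "fscale (of_int (gen_s n i)) (charge (gen_a i) x + charge (gen_b n i) x + fscale (of_int (gen_m i)) x) =
        fscale (\<mu> (Coroot i)) x"
    proof
      fix S
      show "fscale (of_int (gen_s n i)) (charge (gen_a i) x + charge (gen_b n i) x + fscale (of_int (gen_m i)) x) S =
        fscale (\<mu> (Coroot i)) x S"
      proof (cases "x S = 0")
        case False
        then have "S \<in> states n" "\<mu> = state_weight n \<kappa> S"
          using x fock_states[OF xf] by (auto simp: grade_def)
        moreover have "gen_m i = 0 \<or> gen_s n i = 1"
          using n by (simp add: gen_m_def gen_s_def)
        ultimately show ?thesis using lev i
          by (auto simp add: state_weight_Coroot[OF n] level_one_def charge_def distrib_left distrib_right mult.assoc)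
      qed (simp add: charge_def)
    qed
    then show ?thesis unfolding lhs unfolding True[symmetric] quad_commutator_charge[OF xf gi(1,2,3,4,7)]
      by (simp only: f_op_def e_op_def fv.scale_right_distrib simp_thms if_True add.assoc)
  next
    case False
    have s: "gen_a j \<noteq> gen_a i" "gen_b n j \<noteq> gen_a i" "gen_a j \<noteq> gen_b n i"
      using False n i j by (auto simp: gen_a_def gen_b_def split: if_splits)
    \<comment> \<open>Second colours coincide for distinct nodes only for the pair 0 and 1, both
      with colour -2. Their contraction has two equal nonzero colours and vanishes by
      antisymmetry.\<close>
    have z: "gen_b n j = gen_b n i \<Longrightarrow> gen_a i = - gen_a j \<and> gen_m i + - gen_m j \<noteq> 0"
      using False n i j by (auto simp: gen_a_def gen_b_def gen_m_def split: if_splits)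
    have "quad (gen_a i) (gen_b n i) (gen_m i) (quad (- gen_b n j) (- gen_a j) (- gen_m j) x) =
        quad (- gen_b n j) (- gen_a j) (- gen_m j) (quad (gen_a i) (gen_b n i) (gen_m i) x) +
        (if - gen_b n j = - gen_b n i then quad (gen_a i) (- gen_a j) (gen_m i + - gen_m j) x else 0) -
        (if - gen_b n j = - gen_a i then quad (gen_b n i) (- gen_a j) (gen_m i + - gen_m j) x else 0) +
        (if - gen_a j = - gen_b n i then quad (- gen_b n j) (gen_a i) (gen_m i + - gen_m j) x else 0) -
        (if - gen_a j = - gen_a i then quad (- gen_b n j) (gen_b n i) (gen_m i + - gen_m j) x else 0)"
      by (rule quad_quad[OF xf gi(5) gj(6)]) (use gi gj s z in \<open>auto simp: regular_def\<close>)
    moreover have "(if - gen_b n j = - gen_b n i then quad (gen_a i) (- gen_a j) (gen_m i + - gen_m j) x else 0) = 0"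
      using z quad_same by auto
    ultimately have "quad (gen_a i) (gen_b n i) (gen_m i) (quad (- gen_b n j) (- gen_a j) (- gen_m j) x) =
        quad (- gen_b n j) (- gen_a j) (- gen_m j) (quad (gen_a i) (gen_b n i) (gen_m i) x)"
      using s by simp
    then show ?thesis unfolding lhs using False by (simp only: f_op_def e_op_def if_False add_0_right)
  qed
qed

section \<open>Dominance and singular vectors\<close>

lemma dominance:
  assumes n: "3 \<le> n" and i: "i \<le> n" and x: "x \<in> grade n p \<kappa> \<mu>" "x \<noteq> 0"
    and lev: "level_one n \<kappa>" and sing: "e_op n i x = 0"
  shows "0 \<le> Re (\<mu> (Coroot i))"
proof -
  have xf: "x \<in> fock n" using x(1) by (rule grade_fock)
  \<comment> \<open>The squared norm of the lowered vector is \<open>gen_s\<close> times the coroot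
    value times the squared norm of \<open>x\<close>, so positivity of the form bounds the coroot
    value.\<close>
  have "ip (f_op n i x) (f_op n i x) = of_int (gen_s n i) * ip x (e_op n i (f_op n i x))"
    by (rule ip_f_op[OF n i xf f_op_fock[OF n i xf]])
  also have "e_op n i (f_op n i x) = fscale (\<mu> (Coroot i)) x"
    using e_f_commute[OF n i i x(1) lev] by (simp add: sing)
  also have "ip x \<dots> = \<mu> (Coroot i) * ip x x" by (rule ip_right)
  finally have "0 \<le> Re (of_int (gen_s n i) * (\<mu> (Coroot i) * ip x x))"
    using ip_self_nonneg[of "f_op n i x"] by simp
  moreover have "0 < Re (ip x x)" by (rule ip_self_pos[OF xf x(2)])
  moreover have "Im (ip x x) = 0" by (simp add: ip_self)
  moreover have "0 < real_of_int (gen_s n i)" by (simp add: gen_s_def)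
  ultimately show ?thesis by (simp add: zero_le_mult_iff)
qed

text \<open>A mode in an occupied state could be removed by its annihilation operator, and the
  result would have a nonzero coefficient at the smaller state.\<close>

lemma vacuum_unique:
  assumes x: "x \<in> fock n" and van: "\<And>a k. \<lbrakk>\<bar>a\<bar> \<le> int n; 0 \<le> k\<rbrakk> \<Longrightarrow> psi a k x = 0"
  shows "x = fscale (x {}) (delta {})"
proof
  fix S
  show "x S = fscale (x {}) (delta {}) S"
  proof (cases "S = {} \<or> x S = 0")
    case False
    then obtain a l where al: "(a, l) \<in> S" by (metis equals0I surj_pair)
    have "S \<in> states n" using fock_states[OF x] False by blast
    with al have "\<bar>a\<bar> \<le> int n" "l < 0" by (auto simp: states_def modes_def)
    then have "psi (- a) (- 1 - l) x (S - {(a, l)}) = 0" by (simp add: van)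
    with \<open>l < 0\<close> al False show ?thesis
      by (simp add: psi_def annihilate_def insert_absorb)
  qed (auto simp: delta_def)
qed

text \<open>Operators killing \<open>x\<close> are closed under commutators, so positive root
  vectors are reached from the simple ones. The chain below passes through short roots, because two
  neutral factors contract to an operator of Heisenberg type.\<close>

lemma positive_part_vanishes:
  assumes n: "3 \<le> n" and x: "x \<in> fock n" and sing: "\<And>i. i \<le> n \<Longrightarrow> e_op n i x = 0"
    and i: "1 \<le> i" "i \<le> n"
  shows "m \<ge> 0 \<Longrightarrow> quad (int i) 0 m x = 0"
    and "m \<ge> 1 \<Longrightarrow> quad (int i) (- int i) m x = 0"
proof -
  have bracket: "(if c = - b then quad a d (m + p) x else 0) - (if c = - a then quad b d (m + p) x else 0) +
      (if d = - b then quad c a (m + p) x else 0) - (if d = - a then quad c b (m + p) x else 0) = 0"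
    if "quad a b m x = 0" "quad c d p x = 0" "regular a b m" "regular c d p"
      "\<bar>a\<bar> \<le> int n" "\<bar>b\<bar> \<le> int n" "\<bar>c\<bar> \<le> int n" "\<bar>d\<bar> \<le> int n"
      "c = - b \<Longrightarrow> regular a d (m + p)" "c = - a \<Longrightarrow> regular b d (m + p)"
      "d = - b \<Longrightarrow> regular c a (m + p)" "d = - a \<Longrightarrow> regular c b (m + p)" for a b c d m p
    using quad_quad[OF x that(3,4,7,8,5,6) that(9-12)] by (simp only: that(1,2) quad_0 add_0)
  have e0: "quad (- 1) (- 2) 1 x = 0"
    using sing[of 0] n by (simp add: e_op_def gen_a_def gen_b_def gen_m_def)
  have ei: "quad (int i) (- (int i + 1)) 0 x = 0" if "1 \<le> i" "i < n" for i
    using sing[of i] that by (simp add: e_op_def gen_a_def gen_b_def gen_m_def)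
  have en: "quad (int n) 0 0 x = 0"
    using sing[of n] n by (simp add: e_op_def gen_a_def gen_b_def gen_m_def)
  \<comment> \<open>The roots \<open>\<epsilon>\<^sub>i\<close>, descending from node n by adding
    \<open>\<epsilon>\<^sub>i - \<epsilon>\<^sub>i\<^sub>+\<^sub>1\<close>.\<close>
  have A: "quad (int i) 0 0 x = 0" if "1 \<le> i" "i \<le> n" for i
    using that(2,1)
  proof (induction rule: inc_induct)
    case base
    show ?case by (rule en)
  next
    case (step j)
    then have IH: "quad (int j + 1) 0 0 x = 0" by (simp add: add.commute zero_fun_def)
    have "quad (int j) 0 0 x = 0"
      using bracket[OF ei[of j] IH] step.hyps step.prems by (simp add: regular_def)
    then show ?case .
  qed
  \<comment> \<open>The roots \<open>\<delta> - \<epsilon>\<^sub>1 - \<epsilon>\<^sub>i\<close>,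
    ascending from node 0.\<close>
  have B: "quad (- 1) (- int i) 1 x = 0" if "2 \<le> i" "i \<le> n" for i
    using that
  proof (induction rule: dec_induct)
    case base
    show ?case using e0 by (simp add: zero_fun_def)
  next
    case (step j)
    then have IH: "quad (- 1) (- int j) 1 x = 0" by (simp add: zero_fun_def)
    have "quad (- 1) (- (int j + 1)) 1 x = 0"
      using bracket[OF IH ei[of j]] step.hyps step.prems by (simp add: regular_def)
    then show ?case by (simp add: add.commute zero_fun_def)
  qed
  \<comment> \<open>The roots \<open>\<delta> - \<epsilon>\<^sub>i\<close>: from B by adding
    \<open>\<epsilon>\<^sub>1\<close>, and for i = 1 from node 0 by adding
    \<open>\<epsilon>\<^sub>2\<close>.\<close>
  have C: "quad (- int i) 0 1 x = 0" if "1 \<le> i" "i \<le> n" for i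
  proof (cases "i = 1")
    case True
    have "quad (- 1) 0 1 x = 0"
      using bracket[OF e0 A[of 2]] n by (simp add: regular_def)
    with True show ?thesis by simp
  next
    case False
    then have "quad (- 1) (- int i) 1 x = 0" using that by (intro B) auto
    from bracket[OF this A[of 1]] show ?thesis using that n False by (simp add: regular_def)
  qed
  \<comment> \<open>The degree 1 Heisenberg operator of colour i; the other contraction, of two
    neutral fields, vanishes by antisymmetry. Repeated brackets with it raise the degree in
    E.\<close>
  have D: "quad (- int i) (int i) 1 x = 0"
    using bracket[OF A[OF i] C[OF i]] i n quad_same[of 0 1 x] by (simp add: regular_def quad_swap[of "int i" "- int i" 1])
  have E: "quad (int i) 0 (int m) x = 0" for m
  proof (induction m)
    case 0
    show ?case using A[OF i] by (simp add: zero_fun_def)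
  next
    case (Suc m)
    have "quad (int i) 0 (1 + int m) x = 0"
      using bracket[OF D Suc] i by (simp add: regular_def)
    then show ?case by (simp add: add.commute zero_fun_def)
  qed
  show F: "quad (int i) 0 m x = 0" if "m \<ge> 0" for m
    using E[of "nat m"] that by simp
  show "quad (int i) (- int i) m x = 0" if "m \<ge> 1" for m
  proof -
    have "quad (- int i) (int i) (m - 1 + 1) x = 0"
      using bracket[OF F[of "m - 1"] C[OF i]] i that quad_same[of 0 m x]
      by (simp add: regular_def)
    then show ?thesis using quad_swap[of "int i" "- int i" m x] that by (simp add: regular_def)
  qed
qed

lemma singular_vector:
  assumes n: "3 \<le> n" and x: "x \<in> grade n p \<kappa> \<mu>" "x \<noteq> 0" and lev: "level_one n \<kappa>"
    and sing: "\<And>i. i \<le> n \<Longrightarrow> e_op n i x = 0"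
  shows "\<exists>c. x = fscale c (delta (if p then {} else {(1, - 1)}))"
proof -
  have xf: "x \<in> fock n" using x(1) by (rule grade_fock)
  obtain S0 where S0: "x S0 \<noteq> 0" using x(2) by (auto simp: fun_eq_iff)
  have st: "S \<in> states n" "state_weight n \<kappa> S = \<mu>" "even (card S) = p" if "x S \<noteq> 0" for S
    using fock_states[OF xf that] x(1) that by (auto simp: grade_def)
  define q where "q i = chg (int i) S0" for i
  have chg_neg: "chg (- a) S = - chg a S" for a S by (simp add: chg_def)
  have chg0: "chg 0 S = 0" for S by (simp add: chg_def)
  have charge: "charge (int i) x = fscale (of_int (q i)) x" if "1 \<le> i" "i \<le> n" for i
  proof
    fix S
    show "charge (int i) x S = fscale (of_int (q i)) x S"
    proof (cases "x S = 0")
      case False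
      have "eps_coord n i \<kappa> + of_int (chg (int i) S) = eps_coord n i \<kappa> + of_int (q i)"
        using eps_coord_state_weight[OF n st(1)[OF False] that, of \<kappa>]
          eps_coord_state_weight[OF n st(1)[OF S0] that, of \<kappa>] st(2)[OF False] st(2)[OF S0]
        by (simp add: q_def)
      then show ?thesis by (simp add: charge_def)
    qed (simp add: charge_def)
  qed
  have charge': "charge (- int i) x = fscale (of_int (- q i)) x" if "1 \<le> i" "i \<le> n" for i
    using charge[OF that] by (simp add: charge_def fun_eq_iff chg_neg)
  have dom: "0 \<le> gen_m i + gen_s n i * (chg (gen_a i) S0 + chg (gen_b n i) S0)" if "i \<le> n" for i
  proof -
    have "0 \<le> Re (\<mu> (Coroot i))"
      by (rule dominance[OF n that x lev sing[OF that]])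
    also have "\<mu> (Coroot i) = of_int (gen_m i + gen_s n i * (chg (gen_a i) S0 + chg (gen_b n i) S0))"
      using state_weight_Coroot[OF n st(1)[OF S0] that, of \<kappa>] lev that
      by (simp add: level_one_def st(2)[OF S0])
    finally show ?thesis by (simp del: of_int_add of_int_mult)
  qed
  \<comment> \<open>Dominance at node 0 reads 1 - q 1 - q 2 \<ge> 0, the 1 being the level.\<close>
  have d0: "q 1 + q 2 \<le> 1"
    using dom[of 0] n chg_neg[of 1] chg_neg[of 2] by (simp add: gen_m_def gen_a_def gen_b_def gen_s_def q_def)
  have di: "q (Suc i) \<le> q i" if "1 \<le> i" "i < n" for i
    using dom[of i] that chg_neg[of "int i + 1" S0]
    by (simp add: gen_m_def gen_a_def gen_b_def gen_s_def q_def add.commute)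
  have dn: "0 \<le> q n"
    using dom[of n] n by (simp add: gen_m_def gen_a_def gen_b_def gen_s_def q_def chg0 add.commute)
  have q_nonneg: "0 \<le> q i" if "1 \<le> i" "i \<le> n" for i
    using that(2,1)
  proof (induction rule: inc_induct)
    case (step i)
    then show ?case using di[of i] by simp
  qed (rule dn)
  have q_le: "q i \<le> q 2" if "2 \<le> i" "i \<le> n" for i
    using that
  proof (induction rule: dec_induct)
    case (step i)
    then show ?case using di[of i] by simp
  qed simp
  \<comment> \<open>The charges decrease from q 1 to q n and are nonnegative; with q 1 + q 2 \<le> 1
    only q 1 can be nonzero, and then it is 1.\<close>
  have "q 2 \<le> q 1" using di[of 1] n by (simp add: numeral_2_eq_2)
  then have q2: "q 2 = 0" and q1: "q 1 = 0 \<or> q 1 = 1"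
    using d0 q_nonneg[of 2] n by auto
  have qi: "q i = 0" if "2 \<le> i" "i \<le> n" for i
    using q_le[OF that] q_nonneg[of i] q2 that by simp
  have van: "psi (int i) k x = 0" if "1 \<le> i" "i \<le> n" "- q i \<le> k" for i k
    using that by (intro heisenberg_vacuum[OF xf, where \<kappa> = "q i"] charge
        positive_part_vanishes(2)[OF n xf sing]) auto
  have van': "psi (- int i) k x = 0" if "1 \<le> i" "i \<le> n" "q i \<le> k" for i k
  proof (rule heisenberg_vacuum[OF xf, where \<kappa> = "- q i"])
    show "quad (- int i) (- (- int i)) m x = 0" if "1 \<le> m" for m
      using positive_part_vanishes(2)[OF n xf sing \<open>1 \<le> i\<close> \<open>i \<le> n\<close> that]
        quad_swap[of "int i" "- int i" m x] that by (simp add: regular_def)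
  qed (use that charge' in auto)
  \<comment> \<open>The neutral fermion is its own partner and has no charge, so
    \<open>heisenberg_vacuum\<close> does not reach it. It is recovered as the commutator of
    \<open>quad (int n) 0 k\<close> with \<open>psi (- int n) 0\<close>, both of which kill
    \<open>x\<close>.\<close>
  have van0: "psi 0 k x = 0" if "0 \<le> k" for k
  proof -
    have z: "psi (- int n) 0 x = 0" using van'[of n 0] qi[of n] n by simp
    have "quad (int n) 0 k (psi (- int n) 0 x) = psi (- int n) 0 (quad (int n) 0 k x) - psi 0 k x"
      using quad_psi[OF xf, of "int n" 0 k "- int n" 0] n by (simp add: regular_def)
    moreover have "quad (int n) 0 k x = 0"
      using n that by (intro positive_part_vanishes(1)[OF n xf sing]) auto
    ultimately show ?thesis by (simp add: z psi_linear)
  qed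
  have vanish: "psi a k x = 0" if "\<bar>a\<bar> \<le> int n" "0 \<le> k" "a = - 1 \<and> k = 0 \<longrightarrow> q 1 = 0" for a k
  proof -
    consider "a = 0" | i where "a = int i" "1 \<le> i" "i \<le> n" | i where "a = - int i" "1 \<le> i" "i \<le> n"
    proof -
      have "a = 0 \<or> (a = int (nat a) \<and> 1 \<le> nat a \<and> nat a \<le> n) \<or>
          (a = - int (nat (- a)) \<and> 1 \<le> nat (- a) \<and> nat (- a) \<le> n)"
        using \<open>\<bar>a\<bar> \<le> int n\<close> by linarith
      then show ?thesis using that by blast
    qed
    then show ?thesis
    proof cases
      case 1
      then show ?thesis using van0 that by simp
    next
      case 2
      then show ?thesis using van[of i k] q_nonneg[of i] that by simp
    next
      case 3
      have "q i \<le> k" using 3 that qi[of i] q1 by (cases "i = 1") auto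
      then show ?thesis using 3 van'[of i k] by simp
    qed
  qed
  show ?thesis
  proof (cases "q 1 = 0")
    case True
    have eq: "x = fscale (x {}) (delta {})"
      by (rule vacuum_unique[OF xf vanish]) (use True in auto)
    then have "x {} \<noteq> 0" using x(2) by (metis fv.scale_zero_left)
    then have p using st(3)[of "{}"] by simp
    with eq show ?thesis by auto
  next
    case False
    then have q1: "q 1 = 1" using q1 by simp
    \<comment> \<open>Removing the mode (1, -1), the only one that charge 1 leaves excited, should
      give a multiple of the vacuum.\<close>
    define z where "z = psi (- 1) 0 x"
    have zf: "z \<in> fock n" unfolding z_def using n by (intro psi_fock xf) auto
    have "psi a k z = 0" if "\<bar>a\<bar> \<le> int n" "0 \<le> k" for a k
    proof (cases "a = - 1 \<and> k = 0")
      case True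
      then show ?thesis by (simp add: z_def psi_psi_same)
    next
      case False
      then show ?thesis unfolding z_def using vanish[OF that] that
        by (subst psi_anticomm) (auto simp: psi_linear)
    qed
    then have z: "z = fscale (z {}) (delta {})" by (rule vacuum_unique[OF zf])
    \<comment> \<open>Charge 1 lowers the vanishing range of colour 1 down to index -1. The
      anticommutator then rebuilds \<open>x\<close> from \<open>z\<close>.\<close>
    have "psi 1 (- 1) x = 0" using van[of 1 "- 1"] q1 n by simp
    then have "psi 1 (- 1) z = x"
      unfolding z_def by (subst psi_anticomm) (simp add: psi_linear)
    then have "x = fscale (z {}) (psi 1 (- 1) (delta {}))"
      using z psi_linear(5) by metis
    moreover have "delta {(1, - 1)} = fscale (mode_sign (1, - 1) {}) (psi 1 (- 1) (delta {}))"
      using delta_insert[of "(1, - 1)" "{}"] by (simp add: psi_def)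
    ultimately have eq: "x = fscale (z {} * mode_sign (1, - 1) {}) (delta {(1, - 1)})"
      by (simp add: mult.assoc)
    then have "x {(1, - 1)} \<noteq> 0"
      using x(2) by (auto simp: fun_eq_iff delta_def)
    then have "\<not> p" using st(3)[of "{(1, - 1)}"] by simp
    with eq show ?thesis by auto
  qed
qed

section \<open>Comparison with irreducible highest weight modules\<close>

definition top_state :: "bool \<Rightarrow> mode set" where
  "top_state p = (if p then {} else {(1, - 1)})"

lemma mode_weight_Scaling:
  "2 \<le> n \<Longrightarrow> mode_weight n u Scaling = of_int (2 * snd u + 1) / 2"
  by (simp add: mode_weight_def colour_weight_def c_weight_Scaling q_weight_Scaling field_simps)

text \<open>The value on the scaling element fixes the total energy. It is a sum of terms of one
  sign, so it bounds the index of every single mode, while the colours form a finite set.\<close>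

lemma finite_states_weight:
  assumes n: "3 \<le> n"
  shows "finite {S \<in> states n. state_weight n \<kappa> S = \<mu>}"
proof (cases "{S \<in> states n. state_weight n \<kappa> S = \<mu>} = {}")
  case False
  then obtain S0 where S0: "S0 \<in> states n" "state_weight n \<kappa> S0 = \<mu>" by auto
  define E where "E S = (\<Sum>u\<in>S. 2 * snd u + 1)" for S :: "mode set"
  have E: "state_weight n \<kappa> S Scaling = \<kappa> Scaling + of_int (E S) / 2" for S
    using n by (simp add: state_weight_def fun_sum_apply mode_weight_Scaling E_def
        flip: sum_divide_distrib)
  have "{S \<in> states n. state_weight n \<kappa> S = \<mu>} \<subseteq> Pow ({- int n..int n} \<times> {E S0 - 1..0})"
  proof (clarsimp)
    fix S a k assume S: "S \<in> states n" "(a, k) \<in> S" "\<mu> = state_weight n \<kappa> S"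
    then have fin: "finite S" and sub: "S \<subseteq> modes n" by (auto simp: states_def)
    have "of_int (E S) = (of_int (E S0) :: complex)"
      using E[of S] E[of S0] S0 S by simp
    then have ES: "E S = E S0" by simp
    have "- (2 * snd (a, k) + 1) \<le> (\<Sum>u\<in>S. - (2 * snd u + 1))"
      using fin sub S(2) by (intro member_le_sum) (auto simp: modes_def)
    then have "E S \<le> 2 * k + 1" by (simp only: sum_negf E_def snd_conv neg_le_iff_le)
    with ES sub S(2) show "- int n \<le> a \<and> a \<le> int n \<and> E S0 - 1 \<le> k \<and> k \<le> 0"
      by (auto simp: modes_def)
  qed
  then show ?thesis by (rule finite_subset) simp
next
  case True
  then show ?thesis by (simp only: finite.emptyI)
qed

text \<open>A colour adds at most n to the height and the odd power of q, at least the first,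
  subtracts at least n. The mode (1, -1) has height exactly 0, so both top states have the height of
  \<open>\<kappa>\<close>.\<close>

lemma height_state_weight_le:
  assumes n: "3 \<le> n" and S: "S \<in> states n"
  shows "Re (height n (state_weight n \<kappa> S)) \<le> Re (height n \<kappa>)"
proof -
  have "Re (height n (mode_weight n u)) \<le> 0" if u: "u \<in> modes n" for u
  proof -
    obtain a k where ak: "u = (a, k)" by (cases u)
    have a: "\<bar>a\<bar> \<le> int n" and k: "k \<le> - 1" using u ak by (auto simp: modes_def)
    have "Re (height n (colour_weight n a)) \<le> real n"
      using a n by (auto simp: colour_weight_def height_c_weight sgn_if of_nat_diff)
    moreover have "Re (height n (wscale (of_int (- 2 * k - 1)) (q_weight n))) = - (of_int (- 2 * k - 1) * real n)"
      using n by (simp add: height_q_weight)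
    moreover have "1 * real n \<le> of_int (- 2 * k - 1) * real n"
      by (rule mult_right_mono) (use k in linarith, simp)
    ultimately show ?thesis by (simp only: mode_weight_def ak height_linear plus_complex.sel fst_conv snd_conv)
  qed
  then have "(\<Sum>u\<in>S. Re (height n (mode_weight n u))) \<le> 0"
    using S by (intro sum_nonpos) (auto simp: states_def)
  then show ?thesis by (simp add: state_weight_def height_sum)
qed

lemma top_state_grade:
  assumes "3 \<le> n"
  shows "top_state p \<in> states n" "delta (top_state p) \<in> grade n p \<kappa> (state_weight n \<kappa> (top_state p))"
proof -
  show st: "top_state p \<in> states n"
    using assms by (simp add: top_state_def states_def modes_def)
  show "delta (top_state p) \<in> grade n p \<kappa> (state_weight n \<kappa> (top_state p))"
    using delta_fock[OF st] by (auto simp: grade_def delta_def top_state_def)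
qed

lemma e_op_top_state:
  assumes n: "3 \<le> n" and i: "i \<le> n"
  shows "e_op n i (delta (top_state p)) = 0"
proof -
  have vac: "quad (gen_a i) (gen_b n i) (gen_m i) (delta {}) = 0"
    using gen_facts[OF n i] by (intro quad_vac) auto
  \<comment> \<open>A contraction needs a factor of colour -1. Only node 0 has one, and it leaves
    \<open>psi (- 2) 0\<close>, which kills the vacuum.\<close>
  have one: "quad (gen_a i) (gen_b n i) (gen_m i) (psi 1 (- 1) (delta {})) = 0"
    unfolding quad_psi[OF vac_fock gen_facts(5)[OF n i]] vac using n i
    by (auto simp: psi_linear gen_a_def gen_b_def gen_m_def psi_vac)
  have "delta {(1, - 1)} = fscale (mode_sign (1, - 1) {}) (psi 1 (- 1) (delta {}))"
    using delta_insert[of "(1, - 1)" "{}"] by (simp add: psi_def)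
  moreover have "psi 1 (- 1) (delta {}) \<in> fock n" using n by (intro psi_fock vac_fock) auto
  ultimately have "quad (gen_a i) (gen_b n i) (gen_m i) (delta {(1, - 1)}) = 0"
    using quad_fscale[OF _ gen_facts(5)[OF n i]] one by simp
  with vac show ?thesis by (simp add: e_op_def top_state_def)
qed

interpretation complex_line: vector_space "(*) :: complex \<Rightarrow> complex \<Rightarrow> complex"
  by standard (simp_all add: algebra_simps)

interpretation fvp: vector_space_pair fscale "(*) :: complex \<Rightarrow> complex \<Rightarrow> complex" ..

lemma separating_functional:
  assumes U: "fv.subspace U" and z: "z \<notin> U"
  shows "\<exists>\<phi>. Vector_Spaces.linear fscale (*) \<phi> \<and> (\<forall>y\<in>U. \<phi> y = 0) \<and> \<phi> z = 1"
proof -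
  obtain B where B: "B \<subseteq> U" "fv.independent B" "U \<subseteq> fv.span B"
    using fv.maximal_independent_subset by metis
  have span: "fv.span B = U" using B U by (simp add: fv.span_minimal subset_antisym)
  have "fv.independent (insert z B)" using B(2) z span by (simp add: fv.independent_insert)
  then obtain \<phi> where \<phi>: "Vector_Spaces.linear fscale (*) \<phi>"
      "\<forall>y\<in>insert z B. \<phi> y = (if y = z then 1 else 0)"
    using fvp.linear_independent_extend[of "insert z B" "\<lambda>y. if y = z then 1 else 0"] by blast
  have "\<phi> y = 0" if "y \<in> fv.span B" for y
    using fvp.linear_eq_0_on_span[OF \<phi>(1) _ that] \<phi>(2) B(1) z by (metis insertI2 subsetD)
  then show ?thesis using \<phi> span by auto
qed

locale fock_comparison = affine_B_irreducible_hw_module scale bracket n h d e f scaleV act \<Lambda>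
  for scale :: "complex \<Rightarrow> 'g::ab_group_add \<Rightarrow> 'g"
    and bracket :: "'g \<Rightarrow> 'g \<Rightarrow> 'g"
    and n :: nat and h :: "nat \<Rightarrow> 'g" and d :: 'g and e f :: "nat \<Rightarrow> 'g"
    and scaleV :: "complex \<Rightarrow> 'v::ab_group_add \<Rightarrow> 'v"
    and act :: "'g \<Rightarrow> 'v \<Rightarrow> 'v"
    and \<Lambda> :: weight +
  fixes p :: bool and \<kappa> :: weight and hv :: 'v
  assumes n3: "3 \<le> n" and level: "level_one n \<kappa>" and Lambda_weights: "\<Lambda> \<in> weights n"
    and top_weight: "state_weight n \<kappa> (top_state p) = \<Lambda>"
    and hv_nonzero: "hv \<noteq> 0"
    and hv_singular: "i \<le> n \<Longrightarrow> act (e i) hv = 0"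
    and hv_weight: "hv \<in> weight_space n h d scaleV act \<Lambda>"
    and hv_generates: "submodule W \<Longrightarrow> hv \<in> W \<Longrightarrow> W = UNIV"
begin

abbreviation wsp :: "weight \<Rightarrow> 'v set" where
  "wsp \<equiv> weight_space n h d scaleV act"

lemma act_add: "act x (v + w) = act x v + act x w"
  and act_scale: "act x (scaleV c v) = scaleV c (act x v)"
  using act_linear_right[of x] by (simp_all add: Vector_Spaces.linear_iff)

lemma act_add_left: "act (x + y) v = act x v + act y v"
  and act_scale_left: "act (scale c x) v = scaleV c (act x v)"
  using act_linear_left[of v] by (simp_all add: Vector_Spaces.linear_iff)

lemma act_0 [simp]: "act x 0 = 0"
  using act_scale[of x 0 0] by simp

lemma act_0_left [simp]: "act 0 v = 0"
  using act_scale_left[of 0 0 v] by simp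

lemma act_uminus_left: "act (- x) v = - act x v"
  using act_add_left[of "- x" x v] by (simp add: eq_neg_iff_add_eq_0)

lemma act_sum: "act x (\<Sum>i\<in>I. g i) = (\<Sum>i\<in>I. act x (g i))"
  using sum_comp_morphism[of "act x" g I] by (simp add: o_def act_add)

section \<open>Weight vectors and graded submodules of the abstract module\<close>

lemma wsp_act_cartan: "\<lbrakk>x \<in> wsp \<mu>; b \<in> cartan_indices n\<rbrakk> \<Longrightarrow> act (cartan_element h d b) x = scaleV (\<mu> b) x"
  by (simp add: weight_space_def)

lemma wsp_0 [simp]: "0 \<in> wsp \<mu>"
  by (simp add: weight_space_def)

lemma wsp_add: "\<lbrakk>x \<in> wsp \<mu>; y \<in> wsp \<mu>\<rbrakk> \<Longrightarrow> x + y \<in> wsp \<mu>"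
  by (simp add: weight_space_def act_add V.scale_right_distrib)

lemma wsp_scale: "x \<in> wsp \<mu> \<Longrightarrow> scaleV c x \<in> wsp \<mu>"
  by (simp add: weight_space_def act_scale V.scale_left_commute)

lemma wsp_diff: "\<lbrakk>x \<in> wsp \<mu>; y \<in> wsp \<mu>\<rbrakk> \<Longrightarrow> x - y \<in> wsp \<mu>"
  using wsp_add[of x \<mu> "scaleV (- 1) y"] wsp_scale[of y \<mu> "- 1"] by simp

lemma wsp_f:
  assumes "x \<in> wsp \<mu>" "i \<le> n"
  shows "act (f i) x \<in> wsp (\<mu> - simple_root n i)"
  unfolding weight_space_def
proof (intro CollectI ballI)
  fix b assume b: "b \<in> cartan_indices n"
  have "act (cartan_element h d b) (act (f i) x) =
      act (bracket (cartan_element h d b) (f i)) x + act (f i) (act (cartan_element h d b) x)"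
    by (simp add: act_bracket)
  then show "act (cartan_element h d b) (act (f i) x) = scaleV ((\<mu> - simple_root n i) b) (act (f i) x)"
    using assms b
    by (simp add: bracket_cartan_f act_uminus_left act_scale_left act_scale wsp_act_cartan
        V.scale_left_diff_distrib)
qed

lemma act_e_f:
  assumes "x \<in> wsp \<mu>" "i \<le> n" "j \<le> n"
  shows "act (e i) (act (f j) x) = act (f j) (act (e i) x) + (if i = j then scaleV (\<mu> (Coroot i)) x else 0)"
proof -
  have "act (e i) (act (f j) x) = act (f j) (act (e i) x) + act (bracket (e i) (f j)) x"
    by (simp add: act_bracket)
  moreover have "act (h i) x = scaleV (\<mu> (Coroot i)) x"
    using wsp_act_cartan[OF assms(1), of "Coroot i"] assms(2) by (simp add: cartan_indices_def)
  ultimately show ?thesis using assms by (cases "i = j") (simp_all add: bracket_e_f)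
qed

text \<open>The algebra elements preserving W form a Lie subalgebra, so it is enough to test the
  generators.\<close>

lemma submoduleI:
  assumes W: "V.subspace W"
    and "\<And>i w. i \<le> n \<Longrightarrow> w \<in> W \<Longrightarrow> act (e i) w \<in> W"
    and "\<And>i w. i \<le> n \<Longrightarrow> w \<in> W \<Longrightarrow> act (f i) w \<in> W"
    and "\<And>b w. b \<in> cartan_indices n \<Longrightarrow> w \<in> W \<Longrightarrow> act (cartan_element h d b) w \<in> W"
  shows "submodule W"
proof -
  let ?S = "{x. \<forall>w\<in>W. act x w \<in> W}"
  have "lie_subalgebra ?S"
    unfolding lie_subalgebra_def subspace_def
    using W by (auto simp: act_add_left act_scale_left act_bracket V.subspace_0 V.subspace_add
        V.subspace_scale V.subspace_diff)
  then have "?S = UNIV" using assms by (intro generated) auto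
  with W show ?thesis unfolding submodule_def by blast
qed

lemma weight_vectors_independent:
  assumes "finite N" "N \<subseteq> weights n" "\<And>\<nu>. \<nu> \<in> N \<Longrightarrow> xs \<nu> \<in> wsp \<nu>" "(\<Sum>\<nu>\<in>N. xs \<nu>) = 0" "\<nu> \<in> N"
  shows "xs \<nu> = 0"
  using assms
proof (induction N arbitrary: xs \<nu> rule: finite_induct)
  case (insert \<nu>0 N)
  have zero: "xs \<nu> = 0" if \<nu>: "\<nu> \<in> N" for \<nu>
  proof -
    obtain b where b: "b \<in> cartan_indices n" "\<nu> b \<noteq> \<nu>0 b"
    proof (rule ccontr)
      assume "\<not> thesis"
      then have "\<nu> b = \<nu>0 b" for b
        using that insert.prems(1) \<nu> by (cases "b \<in> cartan_indices n") (auto simp: weights_def)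
      then have "\<nu> = \<nu>0" by (rule ext)
      with \<nu> insert.hyps show False by simp
    qed
    let ?H = "cartan_element h d b"
    \<comment> \<open>Acting with \<open>?H\<close> minus its eigenvalue on the new weight removes
      that summand and rescales the others, to which the induction hypothesis applies.\<close>
    have "0 = act ?H (\<Sum>\<nu>\<in>insert \<nu>0 N. xs \<nu>) - scaleV (\<nu>0 b) (\<Sum>\<nu>\<in>insert \<nu>0 N. xs \<nu>)"
      using insert.prems(3) by simp
    also have "\<dots> = (\<Sum>\<nu>\<in>insert \<nu>0 N. scaleV (\<nu> b - \<nu>0 b) (xs \<nu>))"
      unfolding act_sum V.scale_sum_right sum_subtractf[symmetric]
      by (rule sum.cong) (auto simp: wsp_act_cartan[OF insert.prems(2) b(1)] V.scale_left_diff_distrib)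
    also have "\<dots> = (\<Sum>\<nu>\<in>N. scaleV (\<nu> b - \<nu>0 b) (xs \<nu>))"
      using insert.hyps by simp
    finally have "scaleV (\<nu> b - \<nu>0 b) (xs \<nu>) = 0"
      using insert.prems \<nu> by (intro insert.IH[of "\<lambda>\<nu>. scaleV (\<nu> b - \<nu>0 b) (xs \<nu>)"]) (auto intro: wsp_scale)
    then show ?thesis using b(2) by simp
  qed
  then have "xs \<nu>0 = 0" using insert.prems(3) insert.hyps by simp
  with zero insert.prems(4) show ?case by blast
qed simp

text \<open>An element of the span is a sum of homogeneous pieces satisfying P. If it is itself of
  weight \<open>\<mu>\<close>, subtracting it from the piece of weight \<open>\<mu>\<close> gives a
  vanishing sum of weight vectors, so it equals that piece.\<close>

lemma homogeneous_component:
  assumes P: "\<And>\<nu> x. P \<nu> x \<Longrightarrow> x \<in> wsp \<nu> \<and> \<nu> \<in> weights n"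
    and P0: "\<And>\<nu>. \<nu> \<in> weights n \<Longrightarrow> P \<nu> 0"
    and Padd: "\<And>\<nu> x y. P \<nu> x \<Longrightarrow> P \<nu> y \<Longrightarrow> P \<nu> (x + y)"
    and Pscale: "\<And>\<nu> x c. P \<nu> x \<Longrightarrow> P \<nu> (scaleV c x)"
    and x: "x \<in> V.span {x. \<exists>\<nu>. P \<nu> x}" "x \<in> wsp \<mu>" "\<mu> \<in> weights n"
  shows "P \<mu> x"
proof -
  \<comment> \<open>The family \<open>xs\<close> is zero off N, so that two decompositions can be
    added over the union of their index sets.\<close>
  define D where "D = {x. \<exists>N xs. finite N \<and> N \<subseteq> weights n \<and> (\<forall>\<nu>\<in>weights n. P \<nu> (xs \<nu>)) \<and>
    (\<forall>\<nu>. \<nu> \<notin> N \<longrightarrow> xs \<nu> = 0) \<and> x = (\<Sum>\<nu>\<in>N. xs \<nu>)}"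
  have "V.subspace D"
    unfolding V.subspace_def
  proof (intro conjI ballI allI)
    show "0 \<in> D" unfolding D_def using P0 by (intro CollectI exI[of _ "{}"] exI[of _ "\<lambda>_. 0"]) auto
  next
    fix x y assume "x \<in> D" "y \<in> D"
    then obtain N xs M ys where
      N: "finite N" "N \<subseteq> weights n" "\<forall>\<nu>\<in>weights n. P \<nu> (xs \<nu>)" "\<forall>\<nu>. \<nu> \<notin> N \<longrightarrow> xs \<nu> = 0" "x = (\<Sum>\<nu>\<in>N. xs \<nu>)" and
      M: "finite M" "M \<subseteq> weights n" "\<forall>\<nu>\<in>weights n. P \<nu> (ys \<nu>)" "\<forall>\<nu>. \<nu> \<notin> M \<longrightarrow> ys \<nu> = 0" "y = (\<Sum>\<nu>\<in>M. ys \<nu>)"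
      unfolding D_def by blast
    have "x = (\<Sum>\<nu>\<in>N \<union> M. xs \<nu>)" unfolding N(5)
      by (rule sum.mono_neutral_left) (use N M in auto)
    moreover have "y = (\<Sum>\<nu>\<in>N \<union> M. ys \<nu>)" unfolding M(5)
      by (rule sum.mono_neutral_left) (use N M in auto)
    ultimately show "x + y \<in> D" unfolding D_def using N M
      by (intro CollectI exI[of _ "N \<union> M"] exI[of _ "\<lambda>\<nu>. xs \<nu> + ys \<nu>"]) (auto simp: sum.distrib Padd)
  next
    fix c x assume "x \<in> D"
    then obtain N xs where
      N: "finite N" "N \<subseteq> weights n" "\<forall>\<nu>\<in>weights n. P \<nu> (xs \<nu>)" "\<forall>\<nu>. \<nu> \<notin> N \<longrightarrow> xs \<nu> = 0" "x = (\<Sum>\<nu>\<in>N. xs \<nu>)"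
      unfolding D_def by blast
    then show "scaleV c x \<in> D" unfolding D_def
      by (intro CollectI exI[of _ N] exI[of _ "\<lambda>\<nu>. scaleV c (xs \<nu>)"]) (auto simp: V.scale_sum_right Pscale)
  qed
  moreover have "{x. \<exists>\<nu>. P \<nu> x} \<subseteq> D"
  proof safe
    fix \<nu> x assume "P \<nu> x"
    with P P0 show "x \<in> D" unfolding D_def
      by (intro CollectI exI[of _ "{\<nu>}"] exI[of _ "\<lambda>\<rho>. if \<rho> = \<nu> then x else 0"]) auto
  qed
  ultimately have "x \<in> D" using x(1) V.span_minimal by blast
  then obtain N xs where
    N: "finite N" "N \<subseteq> weights n" "\<forall>\<nu>\<in>weights n. P \<nu> (xs \<nu>)" "\<forall>\<nu>. \<nu> \<notin> N \<longrightarrow> xs \<nu> = 0" "x = (\<Sum>\<nu>\<in>N. xs \<nu>)"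
    unfolding D_def by blast
  have "x = (\<Sum>\<nu>\<in>insert \<mu> N. xs \<nu>)" unfolding N(5)
    by (rule sum.mono_neutral_left) (use N in auto)
  then have "(\<Sum>\<nu>\<in>insert \<mu> N. xs \<nu> + (if \<nu> = \<mu> then scaleV (- 1) x else 0)) = 0"
    using N(1) by (simp add: sum.distrib)
  then have "xs \<mu> + (if \<mu> = \<mu> then scaleV (- 1) x else 0) = 0"
    by (intro weight_vectors_independent[of "insert \<mu> N" "\<lambda>\<nu>. xs \<nu> + (if \<nu> = \<mu> then scaleV (- 1) x else 0)" \<mu>])
      (use N x P in \<open>auto intro!: wsp_add wsp_scale wsp_diff\<close>)
  then have "xs \<mu> = x" by simp
  with N(3) x(3) show ?thesis by auto
qed

lemma graded_span_submodule:
  assumes P: "\<And>\<nu> x. P \<nu> x \<Longrightarrow> x \<in> wsp \<nu>"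
    and Pe: "\<And>\<nu> x i. P \<nu> x \<Longrightarrow> i \<le> n \<Longrightarrow> P (\<nu> + simple_root n i) (act (e i) x)"
    and Pf: "\<And>\<nu> x i. P \<nu> x \<Longrightarrow> i \<le> n \<Longrightarrow> P (\<nu> - simple_root n i) (act (f i) x)"
  shows "submodule (V.span {x. \<exists>\<nu>. P \<nu> x})" (is "submodule (V.span ?G)")
proof -
  have closed: "act y w \<in> V.span ?G" if w: "w \<in> V.span ?G" and y: "\<And>x. x \<in> ?G \<Longrightarrow> act y x \<in> V.span ?G" for y w
    using w
  proof (induction w rule: V.span_induct_alt)
    case (step c x w)
    then show ?case using y by (simp add: act_add act_scale V.span_add V.span_scale)
  qed (simp add: V.span_zero)
  show ?thesis
  proof (rule submoduleI)
    show "act (e i) w \<in> V.span ?G" if "i \<le> n" "w \<in> V.span ?G" for i w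
      by (rule closed[OF that(2)]) (use Pe that(1) in \<open>blast intro: V.span_base\<close>)
    show "act (f i) w \<in> V.span ?G" if "i \<le> n" "w \<in> V.span ?G" for i w
      by (rule closed[OF that(2)]) (use Pf that(1) in \<open>blast intro: V.span_base\<close>)
    show "act (cartan_element h d b) w \<in> V.span ?G" if b: "b \<in> cartan_indices n" and w: "w \<in> V.span ?G" for b w
    proof (rule closed[OF w])
      fix x assume x: "x \<in> ?G"
      then obtain \<nu> where "x \<in> wsp \<nu>" using P by blast
      then have "act (cartan_element h d b) x = scaleV (\<nu> b) x" using b by (rule wsp_act_cartan)
      then show "act (cartan_element h d b) x \<in> V.span ?G" using x by (simp add: V.span_scale V.span_base)
    qed
  qed simp
qed

text \<open>The graph of the isomorphism with the Fock space, restricted to a weight.\<close>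

inductive rel :: "weight \<Rightarrow> 'v \<Rightarrow> fvec \<Rightarrow> bool" where
  base: "rel \<Lambda> hv (delta (top_state p))"
| lower: "\<lbrakk>i \<le> n; rel \<mu> x y\<rbrakk> \<Longrightarrow> rel (\<mu> - simple_root n i) (act (f i) x) (f_op n i y)"
| zero: "\<mu> \<in> weights n \<Longrightarrow> rel \<mu> 0 0"
| add: "\<lbrakk>rel \<mu> x y; rel \<mu> x' y'\<rbrakk> \<Longrightarrow> rel \<mu> (x + x') (y + y')"
| scale: "rel \<mu> x y \<Longrightarrow> rel \<mu> (scaleV c x) (fscale c y)"

lemma rel_graded:
  "rel \<mu> x y \<Longrightarrow> \<mu> \<in> weights n \<and> x \<in> wsp \<mu> \<and> y \<in> grade n p \<kappa> \<mu>"
proof (induction rule: rel.induct)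
  case base
  show ?case using Lambda_weights hv_weight top_state_grade(2)[OF n3, of p \<kappa>] by (simp add: top_weight)
next
  case (lower i \<mu> x y)
  then have l: "\<mu> \<in> weights n" "x \<in> wsp \<mu>" "y \<in> grade n p \<kappa> \<mu>" by blast+
  show ?case
    by (intro conjI weights_closed simple_root_weights wsp_f f_op_grade[OF n3] l lower.hyps(1))
qed (blast intro: wsp_0 grade_0 wsp_add wsp_scale grade_add grade_fscale)+

lemma rel_fock: "rel \<mu> x y \<Longrightarrow> y \<in> fock n"
  using rel_graded grade_fock by blast

text \<open>The generating rules mention only lowering operators. Raising operators pass through
  them with the same correction on both sides, by \<open>act_e_f\<close> and
  \<open>e_f_commute\<close>, until they reach the highest weight vectors.\<close>

lemma rel_raise: "rel \<mu> x y \<Longrightarrow> i \<le> n \<Longrightarrow> rel (\<mu> + simple_root n i) (act (e i) x) (e_op n i y)"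
proof (induction rule: rel.induct)
  case base
  have "rel (\<Lambda> + simple_root n i) 0 0"
    by (intro rel.zero weights_closed Lambda_weights simple_root_weights)
  then show ?case by (simp only: hv_singular[OF base] e_op_top_state[OF n3 base])
next
  case (lower j \<mu> x y)
  note g = rel_graded[OF lower.hyps(2)]
  have 1: "rel (\<mu> + simple_root n i - simple_root n j) (act (f j) (act (e i) x)) (f_op n j (e_op n i y))"
    by (rule rel.lower[OF lower.hyps(1) lower.IH[OF lower.prems]])
  have eq: "\<mu> + simple_root n i - simple_root n j = \<mu> - simple_root n j + simple_root n i"
    by simp
  have 2: "rel (\<mu> - simple_root n j + simple_root n i) (if i = j then scaleV (\<mu> (Coroot i)) x else 0)
      (if i = j then fscale (\<mu> (Coroot i)) y else 0)"
    using lower rel.scale[OF lower.hyps(2)] g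
    by (auto intro!: rel.zero weights_closed simple_root_weights)
  have "act (e i) (act (f j) x) = act (f j) (act (e i) x) + (if i = j then scaleV (\<mu> (Coroot i)) x else 0)"
    using g lower by (intro act_e_f) auto
  moreover have "e_op n i (f_op n j y) = f_op n j (e_op n i y) + (if i = j then fscale (\<mu> (Coroot i)) y else 0)"
    using g lower by (intro e_f_commute[OF n3 _ _ _ level]) auto
  ultimately show ?case using rel.add[OF 1[unfolded eq] 2] by (simp only:)
next
  case (zero \<mu>)
  then show ?case using rel.zero[of "\<mu> + simple_root n i"] by (simp only: act_0 op_0 weights_closed simple_root_weights)
next
  case (add \<mu> x y x' y')
  have "e_op n i (y + y') = e_op n i y + e_op n i y'"
    using op_linear(1)[OF n3 add.prems rel_fock rel_fock] add.hyps by blast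
  then show ?case using rel.add[OF add.IH(1)[OF add.prems] add.IH(2)[OF add.prems]]
    by (simp only: act_add)
next
  case (scale \<mu> x y c)
  have "e_op n i (fscale c y) = fscale c (e_op n i y)"
    using op_linear(2)[OF n3 scale.prems rel_fock] rel_fock scale.hyps by blast
  then show ?case using rel.scale[OF scale.IH[OF scale.prems], of c]
    by (simp only: act_scale)
qed

text \<open>Each lowering step decreases the height by 1, so nothing new is ever added at the top
  weight and the two scalars stay equal there.\<close>

lemma rel_top:
  "rel \<mu> x y \<Longrightarrow> (\<mu> = \<Lambda> \<and> (\<exists>c. x = scaleV c hv \<and> y = fscale c (delta (top_state p)))) \<or>
    Re (height n \<mu>) < Re (height n \<Lambda>) \<or> (x = 0 \<and> y = 0)"
proof (induction rule: rel.induct)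
  case base
  have "hv = scaleV 1 hv \<and> delta (top_state p) = fscale 1 (delta (top_state p))" by simp
  then show ?case by blast
next
  case (lower i \<mu> x y)
  have "Re (height n (\<mu> - simple_root n i)) = Re (height n \<mu>) - 1"
    using lower.hyps(1) by (simp add: height_simple_root[OF n3])
  moreover have "Re (height n \<mu>) \<le> Re (height n \<Lambda>) \<or> (x = 0 \<and> y = 0)"
    using lower.IH by (metis less_imp_le order_refl)
  ultimately have "Re (height n (\<mu> - simple_root n i)) < Re (height n \<Lambda>) \<or>
      (act (f i) x = 0 \<and> f_op n i y = 0)"
    by (metis act_0 op_0(2) diff_less_eq le_imp_less_or_eq less_add_one order_le_less_trans)
  then show ?case by blast
next
  case (add \<mu> x y x' y')
  show ?case
  proof (cases "\<mu> = \<Lambda>")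
    case True
    have "\<exists>c. x = scaleV c hv \<and> y = fscale c (delta (top_state p))"
      using add.IH(1) True by (metis V.scale_zero_left fv.scale_zero_left less_irrefl)
    moreover have "\<exists>c. x' = scaleV c hv \<and> y' = fscale c (delta (top_state p))"
      using add.IH(2) True by (metis V.scale_zero_left fv.scale_zero_left less_irrefl)
    ultimately show ?thesis using True by (metis V.scale_left_distrib fv.scale_left_distrib)
  next
    case False
    with add.IH show ?thesis by (metis add.left_neutral)
  qed
next
  case (scale \<mu> x y c)
  then show ?case by (metis V.scale_scale fv.scale_scale V.scale_zero_right fv.scale_zero_right)
qed simp

text \<open>Induction on the depth below the top. Raising (0, y) gives pairs of smaller depth with
  first entry 0, so y is singular; a nonzero y would be a multiple of the top state, where
  \<open>rel_top\<close> forces the same multiple of \<open>hv\<close>.\<close>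

lemma rel_zero_left:
  assumes "rel \<mu> 0 y"
  shows "y = 0"
proof -
  have "y = 0" if "rel \<mu> 0 y" "Re (height n \<Lambda>) - Re (height n \<mu>) < real N" for N \<mu> y
    using that
  proof (induction N arbitrary: \<mu> y)
    case 0
    then show ?case using rel_top[OF 0(1)] by (cases "\<mu> = \<Lambda>") auto
  next
    case (Suc N)
    have sing: "e_op n i y = 0" if "i \<le> n" for i
    proof (rule Suc.IH)
      show "rel (\<mu> + simple_root n i) 0 (e_op n i y)"
        using rel_raise[OF Suc.prems(1) that] by (simp only: act_0)
      show "Re (height n \<Lambda>) - Re (height n (\<mu> + simple_root n i)) < real N"
        using Suc.prems(2) by (simp add: height_simple_root[OF n3 that])
    qed
    have g: "y \<in> grade n p \<kappa> \<mu>" using rel_graded[OF Suc.prems(1)] by blast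
    show ?case
    proof (rule ccontr)
      assume y: "y \<noteq> 0"
      from singular_vector[OF n3 g y level sing]
      obtain c where c: "y = fscale c (delta (top_state p))" by (auto simp: top_state_def)
      with y have "c \<noteq> 0" by auto
      then have "y (top_state p) \<noteq> 0" by (simp add: c delta_def)
      with g have "state_weight n \<kappa> (top_state p) = \<mu>" unfolding grade_def by blast
      then have "\<mu> = \<Lambda>" by (simp only: top_weight)
      with rel_top[OF Suc.prems(1)] y obtain c where "0 = scaleV c hv" "y = fscale c (delta (top_state p))"
        by auto
      with y hv_nonzero show False by (metis V.scale_eq_0_iff fv.scale_zero_left)
    qed
  qed
  moreover obtain N where "Re (height n \<Lambda>) - Re (height n \<mu>) < real N"
    using reals_Archimedean2 by blast
  ultimately show ?thesis using assms by blast
qed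

text \<open>The vectors related to 0 span a submodule. It misses \<open>hv\<close>, so
  irreducibility makes it zero.\<close>

lemma rel_zero_right:
  assumes "rel \<mu> x 0"
  shows "x = 0"
proof -
  let ?P = "\<lambda>\<nu> x. rel \<nu> x 0"
  have sub: "submodule (V.span {x. \<exists>\<nu>. ?P \<nu> x})"
  proof (rule graded_span_submodule)
    show "rel (\<nu> + simple_root n i) (act (e i) x) 0" if "rel \<nu> x 0" "i \<le> n" for \<nu> x i
      using rel_raise[OF that] by (simp only: op_0)
    show "rel (\<nu> - simple_root n i) (act (f i) x) 0" if "rel \<nu> x 0" "i \<le> n" for \<nu> x i
      using rel.lower[OF that(2,1)] by (simp only: op_0)
  qed (use rel_graded in blast)
  have "hv \<notin> V.span {x. \<exists>\<nu>. ?P \<nu> x}"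
  proof
    assume "hv \<in> V.span {x. \<exists>\<nu>. ?P \<nu> x}"
    then have "rel \<Lambda> hv 0"
    proof (rule homogeneous_component[rotated 4])
      show "rel \<nu> (x + y) 0" if "rel \<nu> x 0" "rel \<nu> y 0" for \<nu> x y
        using rel.add[OF that] by (simp only: add_0)
      show "rel \<nu> (scaleV c x) 0" if "rel \<nu> x 0" for \<nu> x c
        using rel.scale[OF that, of c] by (simp only: fv.scale_zero_right)
    qed (use rel_graded rel.zero hv_weight Lambda_weights in blast)+
    with rel_top[of \<Lambda> hv 0] hv_nonzero obtain c where c: "hv = scaleV c hv" "0 = fscale c (delta (top_state p))"
      by auto
    from fun_cong[OF c(2), of "top_state p"] have "c = 0" by (simp add: delta_def)
    with c(1) hv_nonzero show False by simp
  qed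
  then have "V.span {x. \<exists>\<nu>. ?P \<nu> x} = {0}" using irreducible[OF sub] by blast
  then show ?thesis using assms V.span_base[of x "{x. \<exists>\<nu>. ?P \<nu> x}"] by blast
qed

text \<open>The vectors that have a partner span a submodule containing \<open>hv\<close>, hence
  everything; the homogeneous ones are then related themselves.\<close>

lemma rel_left_total:
  assumes "x \<in> wsp \<mu>" "\<mu> \<in> weights n"
  shows "\<exists>y. rel \<mu> x y"
proof -
  let ?P = "\<lambda>\<nu> x. \<exists>y. rel \<nu> x y"
  have sub: "submodule (V.span {x. \<exists>\<nu>. ?P \<nu> x})"
    by (rule graded_span_submodule) (use rel_graded rel_raise rel.lower in blast)+
  have "hv \<in> V.span {x. \<exists>\<nu>. ?P \<nu> x}" using rel.base by (blast intro: V.span_base)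
  then have "x \<in> V.span {x. \<exists>\<nu>. ?P \<nu> x}" using hv_generates[OF sub] by blast
  then show ?thesis
    by (rule homogeneous_component[where P = ?P, rotated 4])
      (use assms rel_graded rel.zero rel.add rel.scale in blast)+
qed

lemma rel_sum:
  assumes "\<mu> \<in> weights n" "\<And>i. i \<in> I \<Longrightarrow> rel \<mu> (a i) (b i)"
  shows "rel \<mu> (\<Sum>i\<in>I. a i) (\<Sum>i\<in>I. b i)"
  using assms(2)
proof (induction I rule: infinite_finite_induct)
  case (insert i I)
  then have "rel \<mu> (a i + sum a I) (b i + sum b I)" by (intro rel.add) auto
  moreover have "sum b (insert i I) = b i + sum b I" "sum a (insert i I) = a i + sum a I"
    using insert by simp_all
  ultimately show ?case by (simp only:)
qed (simp_all only: sum.infinite sum.empty rel.zero[OF assms(1)] simp_thms)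

section \<open>Exhausting the Fock sector and counting dimensions\<close>

definition parity_states :: "weight \<Rightarrow> mode set set" where
  "parity_states \<mu> = {S \<in> states n. even (card S) = p \<and> state_weight n \<kappa> S = \<mu>}"

lemma finite_parity_states: "finite (parity_states \<mu>)"
  by (rule finite_subset[OF _ finite_states_weight[OF n3, of \<kappa> \<mu>]]) (auto simp: parity_states_def)

lemma delta_grade: "S \<in> parity_states \<mu> \<Longrightarrow> delta S \<in> grade n p \<kappa> \<mu>"
  by (auto simp: parity_states_def grade_def delta_fock) (auto simp: delta_def split: if_splits)

lemma grade_expand:
  assumes "y \<in> grade n p \<kappa> \<mu>"
  shows "y = (\<Sum>S\<in>parity_states \<mu>. fscale (y S) (delta S))"
proof -
  have "{S. y S \<noteq> 0} \<subseteq> parity_states \<mu>"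
    using assms fock_states[OF grade_fock[OF assms]] by (auto simp: grade_def parity_states_def)
  then have "(\<Sum>S | y S \<noteq> 0. fscale (y S) (delta S)) = (\<Sum>S\<in>parity_states \<mu>. fscale (y S) (delta S))"
    by (intro sum.mono_neutral_left finite_parity_states) auto
  with fock_expand[OF grade_fock[OF assms]] show ?thesis by simp
qed

text \<open>If a basis state were not reached, a functional vanishing on the reached part of its weight
  space would give a singular vector, because raising it pairs with lowered states only.\<close>

lemma rel_right_total:
  assumes "S \<in> parity_states \<mu>"
  shows "\<exists>x. rel \<mu> x (delta S)"
proof -
  have "\<exists>x. rel \<mu> x (delta S)"
    if "S \<in> parity_states \<mu>" "Re (height n \<kappa>) - Re (height n \<mu>) < real N" for N S \<mu>
    using that
  proof (induction N arbitrary: S \<mu>)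
    case 0
    then show ?case using height_state_weight_le[OF n3, of S \<kappa>] by (simp add: parity_states_def)
  next
    case (Suc N)
    define U where "U = {y. \<exists>x. rel \<mu> x y}"
    have \<mu>: "\<mu> = state_weight n \<kappa> S" using Suc.prems(1) by (simp add: parity_states_def)
    have "\<kappa> = \<Lambda> - (\<Sum>u\<in>top_state p. mode_weight n u)"
      unfolding top_weight[symmetric] by (simp add: state_weight_def)
    then have "\<kappa> \<in> weights n"
      unfolding mode_weight_def colour_weight_def
      using Lambda_weights by (auto intro!: weights_closed weights_sum c_weight_weights q_weight_weights)
    then have \<mu>w: "\<mu> \<in> weights n"
      unfolding \<mu> state_weight_def mode_weight_def colour_weight_def
      by (intro weights_closed weights_sum c_weight_weights q_weight_weights)
    have U: "fv.subspace U"
      unfolding fv.subspace_def U_def using rel.zero[OF \<mu>w] rel.add rel.scale by blast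
    show ?case
    proof (rule ccontr)
      assume "\<not> ?case"
      then have "delta S \<notin> U" by (simp add: U_def)
      from separating_functional[OF U this] obtain \<phi> where
        \<phi>: "Vector_Spaces.linear fscale (*) \<phi>" "\<And>y. y \<in> U \<Longrightarrow> \<phi> y = 0" "\<phi> (delta S) = 1"
        by blast
      \<comment> \<open>The vector of this weight space representing \<open>\<phi>\<close> through
        the Hermitian form, hence the conjugates.\<close>
      define y where "y = (\<Sum>T\<in>parity_states \<mu>. fscale (cnj (\<phi> (delta T))) (delta T))"
      have y_apply: "y T = (if T \<in> parity_states \<mu> then cnj (\<phi> (delta T)) else 0)" for T
        unfolding y_def fun_sum_apply using finite_parity_states
        by (simp add: delta_def if_distrib[of "(*) _"] sum.delta' cong: if_cong)
      have yg: "y \<in> grade n p \<kappa> \<mu>"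
        unfolding y_def by (intro grade_sum grade_fscale delta_grade)
      have yf: "y \<in> fock n" using yg by (rule grade_fock)
      have pair: "ip z y = cnj (\<phi> z)" if z: "z \<in> grade n p \<kappa> \<mu>" for z
      proof -
        have "\<phi> z = (\<Sum>T\<in>parity_states \<mu>. z T * \<phi> (delta T))"
          using \<phi>(1) by (subst grade_expand[OF z])
            (simp only: fvp.linear_sum[OF \<phi>(1)] fvp.linear_scale[OF \<phi>(1)])
        moreover have "ip z y = (\<Sum>T\<in>parity_states \<mu>. cnj (z T) * y T)"
          using z fock_states[OF grade_fock[OF z]]
          by (intro ip_superset finite_parity_states) (auto simp: grade_def parity_states_def)
        ultimately show ?thesis by (simp add: y_apply)
      qed
      have sing: "e_op n i y = 0" if i: "i \<le> n" for i
      proof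
        fix T
        show "e_op n i y T = 0 T"
        proof (rule ccontr)
          assume nz: "e_op n i y T \<noteq> 0 T"
          have g: "e_op n i y \<in> grade n p \<kappa> (\<mu> + simple_root n i)"
            by (rule e_op_grade[OF n3 i yg])
          have T: "T \<in> parity_states (\<mu> + simple_root n i)"
            using nz g fock_states[OF grade_fock[OF g]] by (auto simp: grade_def parity_states_def)
          have "Re (height n \<kappa>) - Re (height n (\<mu> + simple_root n i)) < real N"
            using Suc.prems(2) by (simp add: height_simple_root[OF n3 i])
          \<comment> \<open>The raised weight is closer to the height of \<open>\<kappa>\<close>, so
            T is already reached. Lowering it lands in U, where \<open>\<phi>\<close> vanishes, and
            by adjointness this is the coefficient of \<open>e_op n i y\<close> at T.\<close>
          with Suc.IH[OF T] obtain x where x: "rel (\<mu> + simple_root n i) x (delta T)" by blast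
          have "rel \<mu> (act (f i) x) (f_op n i (delta T))"
            using rel.lower[OF i x] by simp
          then have "\<phi> (f_op n i (delta T)) = 0" "f_op n i (delta T) \<in> grade n p \<kappa> \<mu>"
            using \<phi>(2) rel_graded by (auto simp: U_def)
          then have "ip (f_op n i (delta T)) y = 0" using pair by simp
          moreover have "ip (f_op n i (delta T)) y = of_int (gen_s n i) * e_op n i y T"
            using ip_f_op[OF n3 i delta_fock yf] T by (simp add: ip_delta parity_states_def)
          ultimately show False using nz by (simp add: gen_s_def split: if_splits)
        qed
      qed
      \<comment> \<open>The singular vector is nonzero at S, so S must be the top state, which is
        reached by the first rule of \<open>rel\<close>.\<close>
      have yS: "y S = 1" using Suc.prems(1) by (simp add: y_apply \<phi>(3))
      then have "y \<noteq> 0" by auto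
      from singular_vector[OF n3 yg this level sing]
      obtain c where c: "y = fscale c (delta (top_state p))" by (auto simp: top_state_def)
      with yS have "S = top_state p" by (auto simp: delta_def split: if_splits)
      with \<mu> have "rel \<mu> hv (delta S)" using rel.base top_weight by simp
      with \<open>\<not> ?case\<close> show False by blast
    qed
  qed
  moreover obtain N where "Re (height n \<kappa>) - Re (height n \<mu>) < real N"
    using reals_Archimedean2 by blast
  ultimately show ?thesis using assms by blast
qed

text \<open>The partners of the basis states form a basis: \<open>rel_zero_left\<close> gives
  independence, and \<open>rel_left_total\<close> with \<open>rel_zero_right\<close> gives
  spanning.\<close>

lemma dim_weight_space:
  assumes \<mu>: "\<mu> \<in> weights n"
  shows "V.dim (wsp \<mu>) = card (parity_states \<mu>)"
proof -
  have "\<forall>S\<in>parity_states \<mu>. \<exists>x. rel \<mu> x (delta S)" using rel_right_total by blast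
  then obtain b where b: "\<And>S. S \<in> parity_states \<mu> \<Longrightarrow> rel \<mu> (b S) (delta S)" by metis
  let ?B = "b ` parity_states \<mu>"
  note fin = finite_parity_states[of \<mu>]
  have comb: "rel \<mu> (\<Sum>S\<in>parity_states \<mu>. scaleV (r S) (b S)) (\<Sum>S\<in>parity_states \<mu>. fscale (r S) (delta S))" for r
    by (intro rel_sum[OF \<mu>] rel.scale b)
  have apply_comb: "(\<Sum>S\<in>parity_states \<mu>. fscale (r S) (delta S)) T = r T" if "T \<in> parity_states \<mu>" for r T
    unfolding fun_sum_apply using fin that
    by (simp add: delta_def if_distrib[of "(*) _"] sum.delta' cong: if_cong)
  have indep: "r T = 0" if "(\<Sum>S\<in>parity_states \<mu>. scaleV (r S) (b S)) = 0" "T \<in> parity_states \<mu>" for r T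
    using rel_zero_left[OF comb[of r, unfolded that(1)]] apply_comb[OF that(2), of r] by simp
  have inj: "inj_on b (parity_states \<mu>)"
  proof (rule inj_onI)
    fix S T assume ST: "S \<in> parity_states \<mu>" "T \<in> parity_states \<mu>" "b S = b T"
    have "rel \<mu> (b S + scaleV (- 1) (b T)) (delta S + fscale (- 1) (delta T))"
      using ST by (intro rel.add rel.scale b)
    then have "delta S + fscale (- 1) (delta T) = 0"
      using ST by (intro rel_zero_left) simp
    from fun_cong[OF this, of S] show "S = T" by (auto simp: delta_def split: if_splits)
  qed
  have "V.independent ?B"
  proof (rule V.independent_if_scalars_zero)
    fix r x assume "(\<Sum>x\<in>?B. scaleV (r x) x) = 0" "x \<in> ?B"
    then show "r x = 0" using indep[of "r \<circ> b"] by (auto simp: sum.reindex[OF inj] o_def)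
  qed (use fin in simp)
  moreover have "V.span ?B = V.span (wsp \<mu>)"
  proof (rule V.span_eq[THEN iffD2], intro conjI)
    show "?B \<subseteq> V.span (wsp \<mu>)" using b rel_graded by (blast intro: V.span_base)
    show "wsp \<mu> \<subseteq> V.span ?B"
    proof
      fix x assume "x \<in> wsp \<mu>"
      then obtain y where y: "rel \<mu> x y" using rel_left_total \<mu> by blast
      then have yg: "y \<in> grade n p \<kappa> \<mu>" using rel_graded by blast
      have "rel \<mu> (x + scaleV (- 1) (\<Sum>S\<in>parity_states \<mu>. scaleV (y S) (b S))) (y + fscale (- 1) y)"
        using rel.add[OF y rel.scale[OF comb[of y]]] unfolding grade_expand[OF yg, symmetric] .
      then have "x + scaleV (- 1) (\<Sum>S\<in>parity_states \<mu>. scaleV (y S) (b S)) = 0"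
        by (intro rel_zero_right[of \<mu>]) simp
      then have "x = (\<Sum>S\<in>parity_states \<mu>. scaleV (y S) (b S))" by simp
      moreover have "(\<Sum>S\<in>parity_states \<mu>. scaleV (y S) (b S)) \<in> V.span ?B"
        by (intro V.span_sum V.span_scale V.span_base imageI)
      ultimately show "x \<in> V.span ?B" by simp
    qed
  qed
  ultimately have "V.dim (wsp \<mu>) = card ?B" by (metis V.dim_eq_card)
  then show ?thesis by (simp add: card_image[OF inj])
qed

end

section \<open>Infinite products in the \<open>q\<close>-adic topology\<close>

definition fls_agree :: "int \<Rightarrow> 'a::zero fls \<Rightarrow> 'a fls \<Rightarrow> bool" where
  "fls_agree m X Y \<longleftrightarrow> (\<forall>i\<le>m. fls_nth X i = fls_nth Y i)"

text \<open>Convergence in the q-adic metric, expressed by coefficients; \<open>fls_conv_lim\<close>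
  ties it to the \<open>lim\<close> in \<open>qpochhammer_inf\<close>.\<close>

definition fls_conv :: "(nat \<Rightarrow> 'a::zero fls) \<Rightarrow> 'a fls \<Rightarrow> bool" where
  "fls_conv F X \<longleftrightarrow> (\<forall>m. \<exists>N0. \<forall>N\<ge>N0. fls_agree m (F N) X)"

lemma fls_conv_lim:
  fixes X :: "'a::group_add fls"
  assumes "fls_conv F X"
  shows "lim F = X"
proof (rule limI, rule metric_LIMSEQ_I)
  fix r :: real assume r: "0 < r"
  obtain m :: nat where m: "inverse (2 ^ m) < r"
    using real_arch_pow_inv[OF r, of "1/2"] by (auto simp: power_one_over inverse_eq_divide)
  obtain N0 where N0: "\<And>N. N \<ge> N0 \<Longrightarrow> fls_agree (int m) (F N) X"
    using assms unfolding fls_conv_def by blast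
  have "dist (F N) X < r" if "N \<ge> N0" for N
  proof (cases "F N = X")
    case False
    have "int m \<le> fls_subdegree (F N - X)"
      by (rule fls_subdegree_geI) (use False N0[OF that] in \<open>auto simp: fls_agree_def\<close>)
    then have "dist (F N) X = inverse (2 ^ nat (fls_subdegree (F N - X)))" "m \<le> nat (fls_subdegree (F N - X))"
      using False by (auto simp: dist_fls_def)
    moreover have "inverse (2 ^ nat (fls_subdegree (F N - X))) \<le> (inverse (2 ^ m) :: real)"
      using calculation(2) by (intro le_imp_inverse_le power_increasing) auto
    ultimately show ?thesis using m by linarith
  qed (use r in simp)
  then show "\<exists>no. \<forall>N\<ge>no. dist (F N) X < r" by blast
qed

lemma fls_conv_exists:
  assumes "\<And>m. \<exists>N0. \<forall>N\<ge>N0. fls_agree m (F N) (F N0)"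
  shows "\<exists>X. fls_conv F X"
proof -
  obtain N0 where N0: "\<And>m N. N \<ge> N0 m \<Longrightarrow> fls_agree m (F N) (F (N0 m))"
    using assms by metis
  define c where "c m = fls_nth (F (N0 m)) m" for m
  have c: "fls_nth (F N) i = c i" if "N \<ge> N0 m" "i \<le> m" for N i m
  proof -
    let ?M = "max (N0 m) (N0 i)"
    have "fls_nth (F N) i = fls_nth (F (N0 m)) i" "fls_nth (F ?M) i = fls_nth (F (N0 m)) i"
      using N0[of m N] N0[of m ?M] that by (auto simp: fls_agree_def)
    moreover have "fls_nth (F ?M) i = c i"
      using N0[of i ?M] by (auto simp: fls_agree_def c_def)
    ultimately show ?thesis by simp
  qed
  \<comment> \<open>The limit needs a lowest exponent: all coefficients of nonpositive index agree
    with those of the single series \<open>F (N0 0)\<close>.\<close>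
  obtain l where l: "\<forall>i<l. fls_nth (F (N0 0)) i = 0" by (rule fls_nth_vanishes_belowE)
  have "c i = 0" if "i < min l 0" for i
    using c[of 0 "N0 0" i] l that by simp
  then have "fls_nth (Abs_fls c) i = c i" for i
    by (intro nth_Abs_fls_ex_lower_bound exI[of _ "min l 0"]) simp
  then have "fls_conv F (Abs_fls c)"
    unfolding fls_conv_def fls_agree_def using c by metis
  then show ?thesis ..
qed

lemma fls_mult_vanish:
  fixes A B :: "'a::comm_ring_1 fls"
  assumes "\<forall>i\<le>a. fls_nth A i = 0" "\<forall>i<b. fls_nth B i = 0" "i \<le> a + b"
  shows "fls_nth (A * B) i = 0"
proof (cases "A = 0 \<or> B = 0")
  case False
  have "a + 1 \<le> fls_subdegree A" "b \<le> fls_subdegree B"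
    using False assms by (auto intro!: fls_subdegree_geI)
  then show ?thesis using assms(3) by (intro fls_times_nth_eq0) simp
qed auto

lemma fls_conv_mult:
  fixes X Y :: "'a::comm_ring_1 fls"
  assumes X: "fls_conv F X" and Y: "fls_conv G Y"
  shows "fls_conv (\<lambda>N. F N * G N) (X * Y)"
  unfolding fls_conv_def
proof
  fix m
  obtain lx where lx: "\<forall>i<lx. fls_nth X i = 0" by (rule fls_nth_vanishes_belowE)
  obtain ly where ly: "\<forall>i<ly. fls_nth Y i = 0" by (rule fls_nth_vanishes_belowE)
  obtain N1 where N1: "\<And>N. N \<ge> N1 \<Longrightarrow> fls_agree (m - ly) (F N) X"
    using X unfolding fls_conv_def by blast
  \<comment> \<open>Agreement up to \<open>ly\<close> makes the series \<open>G N\<close> vanish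
    below \<open>ly\<close> as Y does, which the error term (F N - X) * G N requires.\<close>
  obtain N2 where N2: "\<And>N. N \<ge> N2 \<Longrightarrow> fls_agree (max (m - lx) ly) (G N) Y"
    using Y unfolding fls_conv_def by blast
  have "fls_agree m (F N * G N) (X * Y)" if N: "N \<ge> max N1 N2" for N
    unfolding fls_agree_def
  proof (intro allI impI)
    fix i assume i: "i \<le> m"
    have "fls_nth ((F N - X) * G N) i = 0"
      by (rule fls_mult_vanish[where a = "m - ly" and b = ly])
        (use N1[of N] N2[of N] N ly i in \<open>auto simp: fls_agree_def\<close>)
    moreover have "fls_nth ((G N - Y) * X) i = 0"
      by (rule fls_mult_vanish[where a = "m - lx" and b = lx])
        (use N2[of N] N lx i in \<open>auto simp: fls_agree_def\<close>)
    moreover have "F N * G N = X * Y + ((F N - X) * G N + (G N - Y) * X)"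
      by (simp add: algebra_simps)
    ultimately show "fls_nth (F N * G N) i = fls_nth (X * Y) i" by simp
  qed
  then show "\<exists>N0. \<forall>N\<ge>N0. fls_agree m (F N * G N) (X * Y)" by blast
qed

lemma fls_conv_prod:
  fixes X :: "'i \<Rightarrow> 'a::comm_ring_1 fls"
  assumes "\<And>i. i \<in> I \<Longrightarrow> fls_conv (F i) (X i)"
  shows "fls_conv (\<lambda>N. \<Prod>i\<in>I. F i N) (\<Prod>i\<in>I. X i)"
  using assms
proof (induction I rule: infinite_finite_induct)
  case (insert i I)
  then show ?case using fls_conv_mult[of "F i" "X i"] by simp
qed (simp_all add: fls_conv_def fls_agree_def)

section \<open>Products as generating functions of finite mode sets\<close>

definition cq_monomial :: "(nat \<Rightarrow>\<^sub>0 int) \<Rightarrow> int \<Rightarrow> rat \<Rightarrow> cq_series" where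
  "cq_monomial b m r = fls_shift (- m) (fls_const (Poly_Mapping.single b r))"

lemma cq_monomial_nth: "fls_nth (cq_monomial b m r) i = (if i = m then Poly_Mapping.single b r else 0)"
  by (simp add: cq_monomial_def)

lemma cq_monomial_mult: "cq_monomial b m r * cq_monomial b' m' r' = cq_monomial (b + b') (m + m') (r * r')"
  by (simp add: cq_monomial_def fls_times_both_shifted_simp mult_single add.commute)

lemma cq_monomial_one: "cq_monomial 0 0 1 = 1"
  by (simp add: cq_monomial_def fls_const_1)

lemma cq_monomial_uminus: "- cq_monomial b m r = cq_monomial b m (- r)"
  by (rule fls_eqI) (simp add: cq_monomial_nth single_uminus)

lemma c_pow_q_pow: "c_pow k e * q_pow m = cq_monomial (Poly_Mapping.single k e) m 1"
  by (simp add: c_pow_def q_pow_def cq_monomial_def fls_X_intpow_times_conv_shift)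

lemma q_pow_eq: "q_pow m = cq_monomial 0 m 1"
  by (simp add: q_pow_def cq_monomial_def fls_const_1)

lemma q_pow_power: "q_pow m ^ k = cq_monomial 0 (int k * m) 1"
  by (simp add: q_pow_def fls_X_intpow_power flip: q_pow_eq)

lemma prod_cq_monomial:
  "finite S \<Longrightarrow> (\<Prod>u\<in>S. cq_monomial (b u) (g u) r) =
     cq_monomial (\<Sum>u\<in>S. b u) (\<Sum>u\<in>S. g u) (r ^ card S)"
  by (induction S rule: finite_induct) (simp_all add: cq_monomial_one cq_monomial_mult)

lemma prod_one_plus: "finite B \<Longrightarrow> (\<Prod>u\<in>B. 1 + x u) = (\<Sum>S\<in>Pow B. \<Prod>u\<in>S. x u)"
  for x :: "'i \<Rightarrow> 'a::comm_ring_1"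
  using prod_add[of B x "\<lambda>_. 1"] by (simp add: add.commute)

text \<open>The threshold encodes the first factor of each product: the highest admissible index
  \<open>t a - 1\<close> has q-exponent 1 - 2 * t a, so thresholds 0, -1 and 1 start at q, at its
  cube and at its inverse.\<close>

definition mode_set :: "int set \<Rightarrow> (int \<Rightarrow> int) \<Rightarrow> mode set" where
  "mode_set A t = {(a, k). a \<in> A \<and> k < t a}"

definition mode_box :: "int set \<Rightarrow> (int \<Rightarrow> int) \<Rightarrow> nat \<Rightarrow> mode set" where
  "mode_box A t N = (SIGMA a:A. {t a - int N..<t a})"

definition q_exp :: "mode set \<Rightarrow> int" where
  "q_exp S = (\<Sum>u\<in>S. - 2 * snd u - 1)"

definition c_exp :: "(int \<Rightarrow> nat \<Rightarrow>\<^sub>0 int) \<Rightarrow> mode set \<Rightarrow> nat \<Rightarrow>\<^sub>0 int" where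
  "c_exp \<beta> S = (\<Sum>u\<in>S. \<beta> (fst u))"

text \<open>Only modes with index at least 0 have a negative q-exponent, and a finite set of colours
  admits finitely many of them. Their total is the constant c.\<close>

lemma mode_set_bound:
  assumes A: "finite A"
  shows "\<exists>c. \<forall>S. finite S \<and> S \<subseteq> mode_set A t \<longrightarrow> (\<forall>u\<in>S. - 2 * snd u - 1 \<le> q_exp S + c)"
proof (intro exI allI impI ballI)
  let ?g = "\<lambda>u :: mode. - 2 * snd u - 1"
  let ?Neg = "SIGMA a:A. {0..<t a}"
  let ?c = "\<Sum>u\<in>?Neg. - ?g u"
  have fN: "finite ?Neg" using A by simp
  fix S u assume S: "finite S \<and> S \<subseteq> mode_set A t" and u: "u \<in> S"
  show "?g u \<le> q_exp S + ?c"
  proof -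
    have sub: "{v \<in> S. 0 \<le> snd v} \<subseteq> ?Neg" using S by (auto simp: mode_set_def)
    have "(\<Sum>v\<in>{v \<in> S. 0 \<le> snd v}. - ?g v) \<le> ?c"
      by (rule sum_mono2[OF fN sub]) auto
    moreover have "q_exp S = (\<Sum>v\<in>{v \<in> S. 0 \<le> snd v}. ?g v) + (\<Sum>v\<in>{v \<in> S. snd v < 0}. ?g v)"
      unfolding q_exp_def using S
      by (subst sum.union_disjoint[symmetric]) (auto intro!: sum.cong)
    moreover have "?g u \<le> (\<Sum>v\<in>{v \<in> S. snd v < 0}. ?g v)"
    proof (cases "snd u < 0")
      case True
      then show ?thesis using S u by (intro member_le_sum) auto
    next
      case False
      have "0 \<le> (\<Sum>v\<in>{v \<in> S. snd v < 0}. ?g v)" by (rule sum_nonneg) auto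
      with False show ?thesis by simp
    qed
    ultimately show ?thesis unfolding sum_negf by linarith
  qed
qed

lemma mode_box_absorb:
  assumes A: "finite A"
  shows "\<exists>N. \<forall>S. finite S \<and> S \<subseteq> mode_set A t \<and> q_exp S \<le> m \<longrightarrow> S \<subseteq> mode_box A t N"
proof -
  obtain c where c: "\<forall>S. finite S \<and> S \<subseteq> mode_set A t \<longrightarrow> (\<forall>u\<in>S. - 2 * snd u - 1 \<le> q_exp S + c)"
    using mode_set_bound[OF A, of t] by (elim exE)
  \<comment> \<open>Summing over the colours gives one number exceeding the bound needed for each of
    them.\<close>
  define N where "N = nat (\<Sum>a\<in>A. \<bar>t a\<bar> + \<bar>m\<bar> + \<bar>c\<bar> + 1)"
  have "S \<subseteq> mode_box A t N" if S: "finite S" "S \<subseteq> mode_set A t" "q_exp S \<le> m" for S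
  proof
    fix u assume u: "u \<in> S"
    obtain a k where ak: "u = (a, k)" by (cases u)
    have a: "a \<in> A" "k < t a" using u S ak by (auto simp: mode_set_def)
    have "- 2 * snd u - 1 \<le> q_exp S + c" using c S(1,2) u by blast
    then have "- 2 * k - 1 \<le> m + c" using S(3) ak by simp
    moreover have "\<bar>t a\<bar> + \<bar>m\<bar> + \<bar>c\<bar> + 1 \<le> (\<Sum>a\<in>A. \<bar>t a\<bar> + \<bar>m\<bar> + \<bar>c\<bar> + 1)"
      by (rule member_le_sum[OF a(1) _ A]) simp
    then have "\<bar>t a\<bar> + \<bar>m\<bar> + \<bar>c\<bar> + 1 \<le> int N" unfolding N_def by linarith
    ultimately show "u \<in> mode_box A t N" using a by (simp add: mode_box_def ak)
  qed
  then show ?thesis by (intro exI[of _ N] allI impI) simp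
qed

lemma finite_q_exp:
  assumes "finite A"
  shows "finite {S. finite S \<and> S \<subseteq> mode_set A t \<and> q_exp S = m}"
proof -
  obtain N where N: "\<forall>S. finite S \<and> S \<subseteq> mode_set A t \<and> q_exp S \<le> m \<longrightarrow> S \<subseteq> mode_box A t N"
    using mode_box_absorb[OF assms, of t m] by (elim exE)
  have "{S. finite S \<and> S \<subseteq> mode_set A t \<and> q_exp S = m} \<subseteq> Pow (mode_box A t N)"
    using N by auto
  then show ?thesis by (rule finite_subset) (simp add: assms mode_box_def)
qed

definition partial_product :: "(int \<Rightarrow> nat \<Rightarrow>\<^sub>0 int) \<Rightarrow> (int \<Rightarrow> int) \<Rightarrow> rat \<Rightarrow> int \<Rightarrow> nat \<Rightarrow> cq_series" where
  "partial_product \<beta> t r a N = (\<Prod>j<N. 1 - - cq_monomial (\<beta> a) (1 - 2 * t a) r * q_pow 2 ^ j)"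

lemma partial_product_box:
  assumes "finite A"
  shows "(\<Prod>a\<in>A. partial_product \<beta> t r a N) =
    (\<Sum>S\<in>Pow (mode_box A t N). cq_monomial (c_exp \<beta> S) (q_exp S) (r ^ card S))"
proof -
  have "partial_product \<beta> t r a N = (\<Prod>k\<in>{t a - int N..<t a}. 1 + cq_monomial (\<beta> a) (- 2 * k - 1) r)" for a
    unfolding partial_product_def
    \<comment> \<open>With k = t a - 1 - j the exponent 1 - 2 * t a + 2 * j becomes -2 * k -
      1.\<close>
    by (rule prod.reindex_bij_witness[where i = "\<lambda>k. nat (t a - 1 - k)" and j = "\<lambda>j. t a - 1 - int j"])
      (auto simp: q_pow_power cq_monomial_mult algebra_simps)
  then have "(\<Prod>a\<in>A. partial_product \<beta> t r a N) =
      (\<Prod>u\<in>mode_box A t N. 1 + cq_monomial (\<beta> (fst u)) (- 2 * snd u - 1) r)"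
    unfolding mode_box_def using assms by (simp add: prod.Sigma case_prod_unfold)
  also have "\<dots> = (\<Sum>S\<in>Pow (mode_box A t N). \<Prod>u\<in>S. cq_monomial (\<beta> (fst u)) (- 2 * snd u - 1) r)"
    by (rule prod_one_plus) (simp add: mode_box_def assms)
  also have "\<dots> = (\<Sum>S\<in>Pow (mode_box A t N). cq_monomial (c_exp \<beta> S) (q_exp S) (r ^ card S))"
  proof (rule sum.cong[OF refl])
    fix S assume "S \<in> Pow (mode_box A t N)"
    then have "finite S" by (auto simp: mode_box_def assms intro: finite_subset[of S "SIGMA a:A. {t a - int N..<t a}"])
    then show "(\<Prod>u\<in>S. cq_monomial (\<beta> (fst u)) (- 2 * snd u - 1) r) = cq_monomial (c_exp \<beta> S) (q_exp S) (r ^ card S)"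
      by (simp add: prod_cq_monomial c_exp_def q_exp_def)
  qed
  finally show ?thesis .
qed

lemma partial_product_coeff:
  assumes A: "finite A"
    and N: "\<forall>S. finite S \<and> S \<subseteq> mode_set A t \<and> q_exp S \<le> m \<longrightarrow> S \<subseteq> mode_box A t N0" "N0 \<le> N"
    and i: "i \<le> m"
  shows "fls_nth (\<Prod>a\<in>A. partial_product \<beta> t r a N) i =
    (\<Sum>S | finite S \<and> S \<subseteq> mode_set A t \<and> q_exp S = i. Poly_Mapping.single (c_exp \<beta> S) (r ^ card S))"
proof -
  have fin: "finite (mode_box A t N)" using A by (simp add: mode_box_def)
  have sub: "mode_box A t N0 \<subseteq> mode_box A t N" "mode_box A t N \<subseteq> mode_set A t"
    using N(2) by (auto simp: mode_box_def mode_set_def)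
  have "fls_nth (\<Prod>a\<in>A. partial_product \<beta> t r a N) i =
      (\<Sum>S\<in>Pow (mode_box A t N). if q_exp S = i then Poly_Mapping.single (c_exp \<beta> S) (r ^ card S) else 0)"
    unfolding partial_product_box[OF A] fls_nth_sum by (simp add: cq_monomial_nth eq_commute cong: if_cong)
  also have "\<dots> = (\<Sum>S\<in>{S \<in> Pow (mode_box A t N). q_exp S = i}. Poly_Mapping.single (c_exp \<beta> S) (r ^ card S))"
    by (rule sum.inter_filter[symmetric]) (simp add: fin)
  also have "{S \<in> Pow (mode_box A t N). q_exp S = i} = {S. finite S \<and> S \<subseteq> mode_set A t \<and> q_exp S = i}"
  proof (intro equalityI subsetI; clarsimp)
    fix S assume "S \<subseteq> mode_box A t N" "i = q_exp S"
    then show "finite S \<and> S \<subseteq> mode_set A t" using sub(2) finite_subset[OF _ fin] by blast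
  next
    fix S x assume "finite S" "S \<subseteq> mode_set A t" "i = q_exp S"
    then have "S \<subseteq> mode_box A t N" using N(1) i sub(1) by blast
    moreover assume "x \<in> S"
    ultimately show "x \<in> mode_box A t N" by blast
  qed
  finally show ?thesis .
qed

text \<open>For a single colour, \<open>partial_product_coeff\<close> expresses the coefficients up
  to m without reference to N once N is large, so the partial products are Cauchy.\<close>

lemma partial_product_conv:
  "fls_conv (partial_product \<beta> t r a) (qp2 (- cq_monomial (\<beta> a) (1 - 2 * t a) r))"
proof -
  have "\<exists>N0. \<forall>N\<ge>N0. fls_agree m (partial_product \<beta> t r a N) (partial_product \<beta> t r a N0)" for m
  proof -
    obtain N0 where N0: "\<forall>S. finite S \<and> S \<subseteq> mode_set {a} t \<and> q_exp S \<le> m \<longrightarrow> S \<subseteq> mode_box {a} t N0"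
      using mode_box_absorb[OF finite.insertI[OF finite.emptyI], of a t m] by (elim exE)
    have "fls_agree m (partial_product \<beta> t r a N) (partial_product \<beta> t r a N0)" if "N \<ge> N0" for N
      using partial_product_coeff[OF _ N0 that, of _ \<beta> r] partial_product_coeff[OF _ N0 order_refl, of _ \<beta> r]
      by (simp add: fls_agree_def)
    then show ?thesis by blast
  qed
  from fls_conv_exists[OF this] obtain X where X: "fls_conv (partial_product \<beta> t r a) X" by blast
  with fls_conv_lim[OF X] show ?thesis
    by (simp add: qpochhammer_inf_def partial_product_def[abs_def])
qed

lemma qp2_product_coeff:
  assumes A: "finite A"
  shows "fls_nth (\<Prod>a\<in>A. qp2 (- cq_monomial (\<beta> a) (1 - 2 * t a) r)) m =
    (\<Sum>S | finite S \<and> S \<subseteq> mode_set A t \<and> q_exp S = m. Poly_Mapping.single (c_exp \<beta> S) (r ^ card S))"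
proof -
  obtain N0 where N0: "\<forall>S. finite S \<and> S \<subseteq> mode_set A t \<and> q_exp S \<le> m \<longrightarrow> S \<subseteq> mode_box A t N0"
    using mode_box_absorb[OF A, of t m] by (elim exE)
  have "fls_conv (\<lambda>N. \<Prod>a\<in>A. partial_product \<beta> t r a N) (\<Prod>a\<in>A. qp2 (- cq_monomial (\<beta> a) (1 - 2 * t a) r))"
    by (intro fls_conv_prod partial_product_conv)
  then obtain N1 where "\<And>N. N \<ge> N1 \<Longrightarrow> fls_agree m (\<Prod>a\<in>A. partial_product \<beta> t r a N)
      (\<Prod>a\<in>A. qp2 (- cq_monomial (\<beta> a) (1 - 2 * t a) r))"
    unfolding fls_conv_def by blast
  from this[of "max N0 N1"] partial_product_coeff[OF A N0, where N = "max N0 N1" and i = m and \<beta> = \<beta> and r = r]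
  show ?thesis by (auto simp: fls_agree_def)
qed

section \<open>Specialization of the even parts\<close>

definition even_mode_sets :: "nat \<Rightarrow> (int \<Rightarrow> int) \<Rightarrow> mode set set" where
  "even_mode_sets n t = {S. finite S \<and> S \<subseteq> mode_set {- int n..int n} t \<and> even (card S)}"

text \<open>The neutral colour keeps its own variable, so that the operator on even parts sees every
  factor.\<close>

definition colour_exp :: "int \<Rightarrow> nat \<Rightarrow>\<^sub>0 int" where
  "colour_exp a = Poly_Mapping.single (nat \<bar>a\<bar>) (if a < 0 then - 1 else 1)"

text \<open>The version after substituting 1 for the variable of the neutral colour. Both versions
  give the same weight, as \<open>c_weight n 0\<close> is zero.\<close>

definition colour_exp' :: "int \<Rightarrow> nat \<Rightarrow>\<^sub>0 int" where
  "colour_exp' a = Poly_Mapping.single (nat \<bar>a\<bar>) (sgn a)"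

lemma monomial_weight_exps:
  assumes \<beta>: "\<beta> = colour_exp \<or> \<beta> = colour_exp'" and S: "finite S" "S \<subseteq> mode_set {- int n..int n} t"
  shows "monomial_weight n (q_exp S) (c_exp \<beta> S) = (\<Sum>u\<in>S. mode_weight n u)"
proof
  fix x
  have single: "(\<Sum>i=0..n. of_int (Poly_Mapping.lookup (\<beta> a) i) * c_weight n i x) = colour_weight n a x"
    if "\<bar>a\<bar> \<le> int n" for a
  proof -
    have "(\<Sum>i=0..n. of_int (Poly_Mapping.lookup (\<beta> a) i) * c_weight n i x) =
        (\<Sum>i=0..n. if i = nat \<bar>a\<bar> then colour_weight n a x else 0)"
      using \<beta> by (intro sum.cong refl)
        (auto simp: colour_exp_def colour_exp'_def colour_weight_def lookup_single when_def sgn_if simp del: single_one)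
    also have "\<dots> = colour_weight n a x" using that by (simp add: sum.delta)
    finally show ?thesis .
  qed
  have "(\<Sum>i=0..n. of_int (Poly_Mapping.lookup (c_exp \<beta> S) i) * c_weight n i x) =
      (\<Sum>u\<in>S. \<Sum>i=0..n. of_int (Poly_Mapping.lookup (\<beta> (fst u)) i) * c_weight n i x)"
    unfolding c_exp_def lookup_sum of_int_sum sum_distrib_right by (rule sum.swap)
  also have "\<dots> = (\<Sum>u\<in>S. colour_weight n (fst u) x)"
    using S(2) by (intro sum.cong refl single) (auto simp: mode_set_def)
  finally have "(\<Sum>i=0..n. of_int (Poly_Mapping.lookup (c_exp \<beta> S) i) * c_weight n i x) =
      (\<Sum>u\<in>S. colour_weight n (fst u) x)" .
  moreover have "of_int (q_exp S) * q_weight n x = (\<Sum>u\<in>S. of_int (- 2 * snd u - 1) * q_weight n x)"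
    by (simp only: q_exp_def of_int_sum sum_distrib_right)
  ultimately show "monomial_weight n (q_exp S) (c_exp \<beta> S) x = (\<Sum>u\<in>S. mode_weight n u) x"
    by (simp only: monomial_weight_def plus_fun_apply fun_sum_apply wscale_apply mode_weight_def
        sum.distrib add.commute)
qed

lemma monomial_weight_Scaling: "2 \<le> n \<Longrightarrow> monomial_weight n m a Scaling = - of_int m / 2"
  by (simp add: monomial_weight_def fun_sum_apply c_weight_Scaling q_weight_Scaling)

text \<open>The value on the scaling element recovers the q-exponent, so finitely many sets have
  weight \<open>\<mu>\<close>. The monomials of that weight are the exponent pairs of these sets,
  and their coefficients are the sizes of the fibres.\<close>

lemma specialize_even:
  assumes n: "2 \<le> n" and \<beta>: "\<beta> = colour_exp \<or> \<beta> = colour_exp'"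
    and G: "\<And>m b. Poly_Mapping.lookup (fls_nth G m) b =
      of_nat (card {S \<in> even_mode_sets n t. q_exp S = m \<and> c_exp \<beta> S = b})"
  shows "specialize n G \<mu> = of_nat (card {S \<in> even_mode_sets n t. (\<Sum>u\<in>S. mode_weight n u) = \<mu>})"
proof -
  define T where "T = {S \<in> even_mode_sets n t. (\<Sum>u\<in>S. mode_weight n u) = \<mu>}"
  define ex where "ex S = (q_exp S, c_exp \<beta> S)" for S
  have mw: "monomial_weight n (q_exp S) (c_exp \<beta> S) = (\<Sum>u\<in>S. mode_weight n u)" if "S \<in> even_mode_sets n t" for S
    using that by (intro monomial_weight_exps[OF \<beta>]) (auto simp: even_mode_sets_def)
  have fin_q: "finite {S \<in> even_mode_sets n t. q_exp S = m}" for m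
    by (rule finite_subset[OF _ finite_q_exp[of "{- int n..int n}" t m]]) (auto simp: even_mode_sets_def)
  have finT: "finite T"
  proof (cases "T = {}")
    case False
    then obtain S0 where S0: "S0 \<in> T" by auto
    have "q_exp S = q_exp S0" if "S \<in> T" for S
    proof -
      have "monomial_weight n (q_exp S) (c_exp \<beta> S) = \<mu>" "monomial_weight n (q_exp S0) (c_exp \<beta> S0) = \<mu>"
        using that S0 mw by (auto simp: T_def)
      then have "- of_int (q_exp S) / 2 = (- of_int (q_exp S0) / 2 :: complex)"
        by (metis monomial_weight_Scaling[OF n])
      then show ?thesis by simp
    qed
    then have "T \<subseteq> {S \<in> even_mode_sets n t. q_exp S = q_exp S0}" by (auto simp: T_def)
    then show ?thesis by (rule finite_subset) (rule fin_q)
  qed simp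
  have idx: "{(m, b). Poly_Mapping.lookup (fls_nth G m) b \<noteq> 0 \<and> monomial_weight n m b = \<mu>} = ex ` T"
  proof (intro equalityI subsetI)
    fix mb assume "mb \<in> {(m, b). Poly_Mapping.lookup (fls_nth G m) b \<noteq> 0 \<and> monomial_weight n m b = \<mu>}"
    then obtain m b where mb: "mb = (m, b)" "Poly_Mapping.lookup (fls_nth G m) b \<noteq> 0" "monomial_weight n m b = \<mu>"
      by auto
    then have "{S \<in> even_mode_sets n t. q_exp S = m \<and> c_exp \<beta> S = b} \<noteq> {}"
      unfolding G by (metis card.empty of_nat_0)
    then obtain S where "S \<in> even_mode_sets n t" "q_exp S = m" "c_exp \<beta> S = b" by auto
    then show "mb \<in> ex ` T" using mb mw[of S] by (auto simp: T_def ex_def)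
  next
    fix mb assume "mb \<in> ex ` T"
    then obtain S where S: "S \<in> T" "mb = (q_exp S, c_exp \<beta> S)" by (auto simp: ex_def)
    have "finite {S' \<in> even_mode_sets n t. q_exp S' = q_exp S \<and> c_exp \<beta> S' = c_exp \<beta> S}"
      by (rule finite_subset[OF _ fin_q[of "q_exp S"]]) auto
    then have "card {S' \<in> even_mode_sets n t. q_exp S' = q_exp S \<and> c_exp \<beta> S' = c_exp \<beta> S} \<noteq> 0"
      using S(1) by (auto simp: T_def)
    then show "mb \<in> {(m, b). Poly_Mapping.lookup (fls_nth G m) b \<noteq> 0 \<and> monomial_weight n m b = \<mu>}"
      using S mw by (auto simp: G T_def)
  qed
  have "specialize n G \<mu> = (\<Sum>mb\<in>ex ` T. of_nat (card {S \<in> T. ex S = mb}))"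
    unfolding specialize_def idx
  proof (rule sum.cong[OF refl], clarify)
    fix m b S assume "S \<in> T" "(m, b) = ex S"
    then have "{S' \<in> even_mode_sets n t. q_exp S' = m \<and> c_exp \<beta> S' = b} = {S' \<in> T. ex S' = (m, b)}"
      using mw by (auto simp: T_def ex_def) (metis mw)
    then show "Poly_Mapping.lookup (fls_nth G m) b = of_nat (card {S' \<in> T. ex S' = (m, b)})"
      by (simp add: G)
  qed
  also have "\<dots> = of_nat (\<Sum>mb\<in>ex ` T. card {S \<in> T. ex S = mb})" by simp
  also have "(\<Sum>mb\<in>ex ` T. card {S \<in> T. ex S = mb}) = card T"
    using sum.image_gen[OF finT, of "\<lambda>_. 1::nat" ex] by simp
  finally show ?thesis by (simp add: T_def)
qed

text \<open>Each mode, neutral ones included, contributes 1 or -1 to the total degree in the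
  c-variables.\<close>

lemma even_c_exp:
  assumes S: "finite S" "S \<subseteq> mode_set {- int n..int n} t"
  shows "even (\<Sum>k\<in>{0..n}. Poly_Mapping.lookup (c_exp colour_exp S) k) \<longleftrightarrow> even (card S)"
proof -
  have single: "(\<Sum>k\<in>{0..n}. Poly_Mapping.lookup (colour_exp a) k) = (if a < 0 then - 1 else 1)"
    if "\<bar>a\<bar> \<le> int n" for a
  proof -
    have "nat \<bar>a\<bar> \<in> {0..n}" using that by auto
    then show ?thesis
      by (simp only: colour_exp_def lookup_single when_def sum.delta' finite_atLeastAtMost if_True)
  qed
  have "(\<Sum>k\<in>{0..n}. Poly_Mapping.lookup (c_exp colour_exp S) k) =
      (\<Sum>u\<in>S. \<Sum>k\<in>{0..n}. Poly_Mapping.lookup (colour_exp (fst u)) k)"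
    unfolding c_exp_def lookup_sum by (rule sum.swap)
  also have "\<dots> = (\<Sum>u\<in>S. if fst u < 0 then - 1 else 1)"
    using S(2) by (intro sum.cong refl single) (auto simp: mode_set_def)
  also have "even \<dots> \<longleftrightarrow> even (card S)"
    using S(1) by (induction S rule: finite_induct) auto
  finally show ?thesis .
qed

definition colour_product :: "nat \<Rightarrow> (int \<Rightarrow> int) \<Rightarrow> (int \<Rightarrow> nat \<Rightarrow>\<^sub>0 int) \<Rightarrow> rat \<Rightarrow> cq_series" where
  "colour_product n t \<beta> r = (\<Prod>a\<in>{- int n..int n}. qp2 (- cq_monomial (\<beta> a) (1 - 2 * t a) r))"

lemma colour_product_coeff:
  "Poly_Mapping.lookup (fls_nth (colour_product n t \<beta> r) m) b =
    (\<Sum>S | finite S \<and> S \<subseteq> mode_set {- int n..int n} t \<and> q_exp S = m \<and> c_exp \<beta> S = b. r ^ card S)"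
proof -
  let ?Q = "{S. finite S \<and> S \<subseteq> mode_set {- int n..int n} t \<and> q_exp S = m}"
  have "Poly_Mapping.lookup (fls_nth (colour_product n t \<beta> r) m) b =
      (\<Sum>S\<in>?Q. if c_exp \<beta> S = b then r ^ card S else 0)"
    unfolding colour_product_def
    by (subst qp2_product_coeff) (simp_all add: lookup_sum lookup_single when_def)
  also have "\<dots> = (\<Sum>S\<in>{S \<in> ?Q. c_exp \<beta> S = b}. r ^ card S)"
    by (rule sum.inter_filter[symmetric]) (rule finite_q_exp, simp)
  finally show ?thesis by (simp add: conj_assoc)
qed

lemma specialize_even_part:
  assumes "2 \<le> n"
  shows "specialize n (even_part {0..n} (colour_product n t colour_exp 1)) \<mu> =
    of_nat (card {S \<in> even_mode_sets n t. (\<Sum>u\<in>S. mode_weight n u) = \<mu>})"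
proof (rule specialize_even[OF assms, of colour_exp])
  fix m b
  have "{S \<in> even_mode_sets n t. q_exp S = m \<and> c_exp colour_exp S = b} =
    (if even (\<Sum>k\<in>{0..n}. Poly_Mapping.lookup b k) then
      {S. finite S \<and> S \<subseteq> mode_set {- int n..int n} t \<and> q_exp S = m \<and> c_exp colour_exp S = b} else {})"
    using even_c_exp[where n = n and t = t] by (auto simp: even_mode_sets_def)
  then show "Poly_Mapping.lookup (fls_nth (even_part {0..n} (colour_product n t colour_exp 1)) m) b =
      of_nat (card {S \<in> even_mode_sets n t. q_exp S = m \<and> c_exp colour_exp S = b})"
    by (simp add: fls_nth_even_part lookup_even_part_poly colour_product_coeff)
qed simp

lemma lookup_single_0_times: "Poly_Mapping.lookup (Poly_Mapping.single 0 r * p) b = r * Poly_Mapping.lookup p b"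
  for p :: laurent_poly
  unfolding mult_map_scale_conv_mult[symmetric] by (simp add: Poly_Mapping.map.rep_eq when_def)

text \<open>A set S enters the two products with signs 1 and (-1) to the power
  \<open>card S\<close>; half their sum selects the even sets.\<close>

lemma specialize_half_sum:
  assumes "2 \<le> n"
  shows "specialize n (rat_const (1 / 2) * (colour_product n t colour_exp' 1 + colour_product n t colour_exp' (- 1))) \<mu> =
    of_nat (card {S \<in> even_mode_sets n t. (\<Sum>u\<in>S. mode_weight n u) = \<mu>})"
proof (rule specialize_even[OF assms, of colour_exp'])
  fix m b
  let ?Q = "{S. finite S \<and> S \<subseteq> mode_set {- int n..int n} t \<and> q_exp S = m \<and> c_exp colour_exp' S = b}"
  have fin: "finite ?Q"
    by (rule finite_subset[OF _ finite_q_exp[of "{- int n..int n}" t m]]) auto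
  have "Poly_Mapping.lookup (fls_nth (rat_const (1 / 2) *
      (colour_product n t colour_exp' 1 + colour_product n t colour_exp' (- 1))) m) b =
      1 / 2 * ((\<Sum>S\<in>?Q. 1 ^ card S) + (\<Sum>S\<in>?Q. (- 1) ^ card S))"
    by (simp only: rat_const_def fls_mult_const_nth lookup_single_0_times fls_plus_nth lookup_add colour_product_coeff)
  also have "\<dots> = (\<Sum>S\<in>?Q. if even (card S) then 1 else 0)"
    unfolding sum.distrib[symmetric] sum_distrib_left by (rule sum.cong) auto
  also have "\<dots> = of_nat (card {S \<in> ?Q. even (card S)})"
    using fin by (simp flip: sum.inter_filter)
  also have "{S \<in> ?Q. even (card S)} = {S \<in> even_mode_sets n t. q_exp S = m \<and> c_exp colour_exp' S = b}"
    by (auto simp: even_mode_sets_def)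
  finally show "Poly_Mapping.lookup (fls_nth (rat_const (1 / 2) *
      (colour_product n t colour_exp' 1 + colour_product n t colour_exp' (- 1))) m) b =
      of_nat (card {S \<in> even_mode_sets n t. q_exp S = m \<and> c_exp colour_exp' S = b})" .
qed simp

lemma prod_symmetric:
  fixes F :: "int \<Rightarrow> 'a::comm_monoid_mult"
  shows "(\<Prod>a\<in>{- int n..int n}. F a) = F 0 * (\<Prod>k=1..n. F (int k) * F (- int k))"
proof (induction n)
  case (Suc n)
  have "{- int (Suc n)..int (Suc n)} = insert (int (Suc n)) (insert (- int (Suc n)) {- int n..int n})"
    by auto
  then have "(\<Prod>a\<in>{- int (Suc n)..int (Suc n)}. F a) =
      F (int (Suc n)) * (F (- int (Suc n)) * (\<Prod>a\<in>{- int n..int n}. F a))"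
    by simp
  then show ?case unfolding Suc by (simp add: ac_simps)
qed simp

section \<open>The characters\<close>

definition twisted_threshold :: "int \<Rightarrow> int" where
  "twisted_threshold a = (if a = 1 then - 1 else if a = - 1 then 1 else 0)"

lemma even_mode_sets_0: "even_mode_sets n (\<lambda>_. 0) = {S \<in> states n. even (card S)}"
proof -
  have "mode_set {- int n..int n} (\<lambda>_. 0) = modes n"
    by (auto simp: mode_set_def modes_def)
  then show ?thesis by (auto simp: even_mode_sets_def states_def)
qed

text \<open>Multiplying the odd part of the untwisted product by \<open>c\<^sub>1\<^sup>-\<^sup>1 q\<^sup>-\<^sup>1\<close> replaces the factor
  \<open>1 + c\<^sub>1 q\<close> by \<open>1 + c\<^sub>1\<^sup>-\<^sup>1 q\<^sup>-\<^sup>1\<close>.\<close>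

lemma card_twisted:
  assumes "1 \<le> n"
  shows "card {S \<in> even_mode_sets n twisted_threshold. (\<Sum>u\<in>S. mode_weight n u) = \<mu>} =
    card {S \<in> states n. odd (card S) \<and> (\<Sum>u\<in>S. mode_weight n u) = \<mu> + mode_weight n (1, - 1)}"
    (is "card ?X = card ?Y")
proof (rule bij_betw_same_card)
  let ?P = "(1, - 1) :: mode" and ?M = "(- 1, 0) :: mode"
  \<comment> \<open>The two modes have opposite weights, so removing \<open>?M\<close> and inserting
    \<open>?P\<close> change the weight by the same amount; either operation flips the
    parity.\<close>
  let ?F = "\<lambda>S. if ?M \<in> S then S - {?M} else insert ?P S"
  let ?G = "\<lambda>S. if ?P \<in> S then S - {?P} else insert ?M S"
  have neg: "mode_weight n ?M = - mode_weight n ?P"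
    using mode_weight_uminus[of n 1 "- 1"] by simp
  have X: "S \<in> even_mode_sets n twisted_threshold \<longleftrightarrow> finite S \<and> even (card S) \<and> ?P \<notin> S \<and> S - {?M} \<subseteq> modes n" for S
  proof -
    have "mode_set {- int n..int n} twisted_threshold = insert ?M (modes n - {?P})"
      using assms by (auto simp: mode_set_def modes_def twisted_threshold_def split: if_splits)
    then show ?thesis by (auto simp: even_mode_sets_def)
  qed
  have Y: "S \<in> states n \<longleftrightarrow> finite S \<and> S \<subseteq> modes n" for S by (simp add: states_def)
  have PM: "?P \<in> modes n" "?M \<notin> modes n" using assms by (auto simp: modes_def)
  have remove: "finite S \<Longrightarrow> u \<in> S \<Longrightarrow> (\<Sum>v\<in>S - {u}. mode_weight n v) = (\<Sum>v\<in>S. mode_weight n v) - mode_weight n u" for S u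
    by (simp add: sum_diff1)
  have insert: "finite S \<Longrightarrow> u \<notin> S \<Longrightarrow> (\<Sum>v\<in>insert u S. mode_weight n v) = mode_weight n u + (\<Sum>v\<in>S. mode_weight n v)" for S u
    by simp
  have parity: "finite S \<Longrightarrow> u \<in> S \<Longrightarrow> even (card (S - {u})) \<longleftrightarrow> odd (card S)"
    "finite S \<Longrightarrow> u \<notin> S \<Longrightarrow> even (card (insert u S)) \<longleftrightarrow> odd (card S)" for S :: "mode set" and u
    using card.remove[of S u] by auto
  show "bij_betw ?F ?X ?Y"
  proof (rule bij_betwI[where g = ?G])
    show "?F \<in> ?X \<rightarrow> ?Y"
    proof
      fix S assume S: "S \<in> ?X"
      then have S': "finite S" "even (card S)" "?P \<notin> S" "S - {?M} \<subseteq> modes n" "(\<Sum>u\<in>S. mode_weight n u) = \<mu>"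
        by (auto simp: X)
      show "?F S \<in> ?Y"
      proof (cases "?M \<in> S")
        case True
        then have "(\<Sum>v\<in>S - {?M}. mode_weight n v) = \<mu> + mode_weight n ?P"
          unfolding remove[OF S'(1) True] S'(5) neg by simp
        with S' True parity(1)[OF S'(1) True] show ?thesis by (simp add: Y)
      next
        case False
        have "(\<Sum>v\<in>insert ?P S. mode_weight n v) = \<mu> + mode_weight n ?P"
          unfolding insert[OF S'(1,3)] S'(5) by (simp only: add.commute)
        with S' False PM parity(2)[OF S'(1,3)] show ?thesis by (simp add: Y)
      qed
    qed
    show "?G \<in> ?Y \<rightarrow> ?X"
    proof
      fix S assume S: "S \<in> ?Y"
      then have S': "finite S" "odd (card S)" "S \<subseteq> modes n" "(\<Sum>u\<in>S. mode_weight n u) = \<mu> + mode_weight n ?P"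
        by (auto simp: Y)
      then have M: "?M \<notin> S" using PM by auto
      show "?G S \<in> ?X"
      proof (cases "?P \<in> S")
        case True
        then have "(\<Sum>v\<in>S - {?P}. mode_weight n v) = \<mu>"
          unfolding remove[OF S'(1) True] S'(4) by simp
        with S' True M parity(1)[OF S'(1) True] show ?thesis by (auto simp: X)
      next
        case False
        have "(\<Sum>v\<in>insert ?M S. mode_weight n v) = \<mu>"
          unfolding insert[OF S'(1) M] S'(4) neg by simp
        with S' False M parity(2)[OF S'(1) M] show ?thesis by (auto simp: X)
      qed
    qed
    show "?G (?F S) = S" if "S \<in> ?X" for S
      using that by (auto simp: X insert_absorb)
    show "?F (?G S) = S" if "S \<in> ?Y" for S
    proof -
      have "?M \<notin> S" using that PM by (auto simp: Y)
      then show ?thesis by (auto simp: insert_absorb)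
    qed
  qed
qed

text \<open>The parameters are the sector, chosen by \<open>p\<close>, and a vacuum weight making
  the top state of that sector have weight \<open>\<Lambda>\<close>.\<close>

lemma character_eq_card:
  assumes n: "3 \<le> n" and mod: "affine_B_irreducible_hw_module scale bracket n h d e f scaleV act \<Lambda>"
    and level: "level_one n \<kappa>" and \<Lambda>: "\<Lambda> \<in> weights n" and \<kappa>: "\<kappa> \<in> weights n"
    and top: "state_weight n \<kappa> (top_state p) = \<Lambda>"
  shows "character n h d scaleV act \<mu> =
    of_nat (card {S \<in> states n. even (card S) = p \<and> state_weight n \<kappa> S = \<mu>})"
proof -
  interpret affine_B_irreducible_hw_module scale bracket n h d e f scaleV act \<Lambda> by (rule mod)
  obtain hv where hv: "hv \<noteq> 0" "\<forall>i\<le>n. act (e i) hv = 0"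
    "\<forall>b\<in>cartan_indices n. act (cartan_element h d b) hv = scaleV (\<Lambda> b) hv"
    "\<forall>W. submodule W \<and> hv \<in> W \<longrightarrow> W = UNIV"
    using highest_weight_vector by blast
  interpret fock_comparison scale bracket n h d e f scaleV act \<Lambda> p \<kappa> hv
    by unfold_locales (use n level \<Lambda> top hv in \<open>auto simp: weight_space_def\<close>)
  show ?thesis
  proof (cases "\<mu> \<in> weights n")
    case True
    then show ?thesis by (simp add: character_def dim_weight_space parity_states_def)
  next
    case False
    have "state_weight n \<kappa> S \<in> weights n" for S
      unfolding state_weight_def mode_weight_def colour_weight_def
      by (intro weights_closed weights_sum c_weight_weights q_weight_weights \<kappa>)
    with False have "{S \<in> states n. even (card S) = p \<and> state_weight n \<kappa> S = \<mu>} = {}" by blast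
    with False show ?thesis by (simp only: character_def if_False card.empty of_nat_0)
  qed
qed

lemma colour_product_eq:
  "colour_product n t \<beta> r = qp2 (- cq_monomial (\<beta> 0) (1 - 2 * t 0) r) *
    (\<Prod>k=1..n. qp2 (- cq_monomial (\<beta> (int k)) (1 - 2 * t (int k)) r) *
      qp2 (- cq_monomial (\<beta> (- int k)) (1 - 2 * t (- int k)) r))"
  unfolding colour_product_def by (rule prod_symmetric)

lemma colour_exp_simps:
  "colour_exp 0 = Poly_Mapping.single 0 1" "colour_exp' 0 = 0"
  "colour_exp (int k) = Poly_Mapping.single k 1"
  "1 \<le> k \<Longrightarrow> colour_exp (- int k) = Poly_Mapping.single k (- 1)"
  "1 \<le> k \<Longrightarrow> colour_exp' (int k) = Poly_Mapping.single k 1"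
  "1 \<le> k \<Longrightarrow> colour_exp' (- int k) = Poly_Mapping.single k (- 1)"
  by (simp_all add: colour_exp_def colour_exp'_def del: single_one)

lemma untwisted_products:
  shows "qp2 (- c_pow 0 1 * q_pow 1) *
      (\<Prod>k=1..n. qp2 (- c_pow k 1 * q_pow 1) * qp2 (- c_pow k (-1) * q_pow 1)) =
      colour_product n (\<lambda>_. 0) colour_exp 1"
    and "qp2 (- q_pow 1) * (\<Prod>k=1..n. qp2 (- c_pow k 1 * q_pow 1) * qp2 (- c_pow k (-1) * q_pow 1)) =
      colour_product n (\<lambda>_. 0) colour_exp' 1"
    and "qp2 (q_pow 1) * (\<Prod>k=1..n. qp2 (c_pow k 1 * q_pow 1) * qp2 (c_pow k (-1) * q_pow 1)) =
      colour_product n (\<lambda>_. 0) colour_exp' (- 1)"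
  unfolding colour_product_eq mult_minus_left c_pow_q_pow unfolding q_pow_eq[of 1]
  by (auto simp: colour_exp_simps cq_monomial_uminus intro!: arg_cong2[where f = "(*)"] prod.cong simp del: single_one)

lemma twisted_products:
  assumes "1 \<le> n"
  shows "qp2 (- c_pow 0 1 * q_pow 1) * qp2 (- c_pow 1 1 * q_pow 3) * qp2 (- c_pow 1 (-1) * q_pow (-1)) *
      (\<Prod>k=2..n. qp2 (- c_pow k 1 * q_pow 1) * qp2 (- c_pow k (-1) * q_pow 1)) =
      colour_product n twisted_threshold colour_exp 1"
    and "qp2 (- q_pow 1) * qp2 (- c_pow 1 1 * q_pow 3) * qp2 (- c_pow 1 (-1) * q_pow (-1)) *
      (\<Prod>k=2..n. qp2 (- c_pow k 1 * q_pow 1) * qp2 (- c_pow k (-1) * q_pow 1)) =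
      colour_product n twisted_threshold colour_exp' 1"
    and "qp2 (q_pow 1) * qp2 (c_pow 1 1 * q_pow 3) * qp2 (c_pow 1 (-1) * q_pow (-1)) *
      (\<Prod>k=2..n. qp2 (c_pow k 1 * q_pow 1) * qp2 (c_pow k (-1) * q_pow 1)) =
      colour_product n twisted_threshold colour_exp' (- 1)"
proof -
  have split: "(\<Prod>k=1..n. F k) = F 1 * (\<Prod>k=2..n. F k)" for F :: "nat \<Rightarrow> cq_series"
    using prod.atLeast_Suc_atMost[OF assms, of F] by (simp add: numeral_2_eq_2)
  have t: "twisted_threshold 0 = 0" "twisted_threshold (int 1) = - 1" "twisted_threshold (- int 1) = 1"
    "2 \<le> k \<Longrightarrow> twisted_threshold (int k) = 0" "2 \<le> k \<Longrightarrow> twisted_threshold (- int k) = 0" for k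
    by (auto simp: twisted_threshold_def)
  have num: "1 - 2 * 0 = (1::int)" "1 - 2 * - 1 = (3::int)" "1 - 2 * 1 = (- 1::int)" by simp_all
  have e: "colour_exp (int 1) = Poly_Mapping.single 1 1" "colour_exp (- int 1) = Poly_Mapping.single 1 (- 1)"
    "colour_exp' (int 1) = Poly_Mapping.single 1 1" "colour_exp' (- int 1) = Poly_Mapping.single 1 (- 1)"
    by (simp_all add: colour_exp_def colour_exp'_def del: single_one)
  have tail: "(\<Prod>k=2..n. qp2 (- cq_monomial (\<beta> (int k)) (1 - 2 * twisted_threshold (int k)) r) *
      qp2 (- cq_monomial (\<beta> (- int k)) (1 - 2 * twisted_threshold (- int k)) r)) =
    (\<Prod>k=2..n. qp2 (- cq_monomial (Poly_Mapping.single k 1) 1 r) * qp2 (- cq_monomial (Poly_Mapping.single k (- 1)) 1 r))"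
    if "\<beta> = colour_exp \<or> \<beta> = colour_exp'" for \<beta> r
    using that by (intro prod.cong refl) (auto simp: t colour_exp_simps simp del: single_one)
  show "qp2 (- c_pow 0 1 * q_pow 1) * qp2 (- c_pow 1 1 * q_pow 3) * qp2 (- c_pow 1 (-1) * q_pow (-1)) *
      (\<Prod>k=2..n. qp2 (- c_pow k 1 * q_pow 1) * qp2 (- c_pow k (-1) * q_pow 1)) =
      colour_product n twisted_threshold colour_exp 1"
    unfolding colour_product_eq split mult_minus_left c_pow_q_pow
    by (subst tail[OF disjI1[OF refl]]) (simp only: num t e colour_exp_simps(1,2) mult.assoc)
  show "qp2 (- q_pow 1) * qp2 (- c_pow 1 1 * q_pow 3) * qp2 (- c_pow 1 (-1) * q_pow (-1)) *
      (\<Prod>k=2..n. qp2 (- c_pow k 1 * q_pow 1) * qp2 (- c_pow k (-1) * q_pow 1)) =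
      colour_product n twisted_threshold colour_exp' 1"
    unfolding colour_product_eq split mult_minus_left c_pow_q_pow unfolding q_pow_eq[of 1]
    by (subst tail[OF disjI2[OF refl]]) (simp only: num t e colour_exp_simps(1,2) mult.assoc)
  show "qp2 (q_pow 1) * qp2 (c_pow 1 1 * q_pow 3) * qp2 (c_pow 1 (-1) * q_pow (-1)) *
      (\<Prod>k=2..n. qp2 (c_pow k 1 * q_pow 1) * qp2 (c_pow k (-1) * q_pow 1)) =
      colour_product n twisted_threshold colour_exp' (- 1)"
    unfolding colour_product_eq split mult_minus_left c_pow_q_pow unfolding q_pow_eq[of 1]
    by (subst tail[OF disjI2[OF refl]]) (simp only: num t e colour_exp_simps(1,2) cq_monomial_uminus minus_minus mult.assoc)
qed

lemma character_fundamental_0: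
  assumes n: "3 \<le> n"
    and mod: "affine_B_irreducible_hw_module scale bracket n h d e f scaleV act (fundamental_weight 0)"
  shows "exp_times (- fundamental_weight 0) (character n h d scaleV act) \<mu> =
    of_nat (card {S \<in> even_mode_sets n (\<lambda>_. 0). (\<Sum>u\<in>S. mode_weight n u) = \<mu>})"
proof -
  have "exp_times (- fundamental_weight 0) (character n h d scaleV act) \<mu> =
      character n h d scaleV act (\<mu> + fundamental_weight 0)"
    by (simp only: exp_times_def diff_minus_eq_add)
  also have "\<dots> = of_nat (card {S \<in> states n. even (card S) = True \<and>
      state_weight n (fundamental_weight 0) S = \<mu> + fundamental_weight 0})"
    by (rule character_eq_card[OF n mod])
      (use n in \<open>auto simp: level_one_def fundamental_weight_def gen_m_def top_state_def state_weight_def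
        intro: fundamental_weight_weights\<close>)
  also have "{S \<in> states n. even (card S) = True \<and>
      state_weight n (fundamental_weight 0) S = \<mu> + fundamental_weight 0} =
      {S \<in> even_mode_sets n (\<lambda>_. 0). (\<Sum>u\<in>S. mode_weight n u) = \<mu>}"
    unfolding even_mode_sets_0 state_weight_def add.commute[of \<mu>] add_left_cancel by auto
  finally show ?thesis .
qed

lemma character_fundamental_1:
  assumes n: "3 \<le> n"
    and mod: "affine_B_irreducible_hw_module scale bracket n h d e f scaleV act (fundamental_weight 1)"
  shows "exp_times (- fundamental_weight 1) (character n h d scaleV act) \<mu> =
    of_nat (card {S \<in> even_mode_sets n twisted_threshold. (\<Sum>u\<in>S. mode_weight n u) = \<mu>})"
proof -
  \<comment> \<open>The mode (1, -1) carries one factor q besides its colour weight; subtracting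
    \<open>q_weight n\<close> from the vacuum weight makes the top weight of the odd sector
    exact.\<close>
  let ?\<kappa> = "fundamental_weight 0 - q_weight n"
  have top: "fundamental_weight 1 = ?\<kappa> + mode_weight n (1, - 1)"
    unfolding fundamental_weight_1_eq[OF n] by (simp add: mode_weight_def colour_weight_def fun_eq_iff)
  have "exp_times (- fundamental_weight 1) (character n h d scaleV act) \<mu> =
      character n h d scaleV act (\<mu> + fundamental_weight 1)"
    by (simp only: exp_times_def diff_minus_eq_add)
  also have "\<dots> = of_nat (card {S \<in> states n. even (card S) = False \<and>
      state_weight n ?\<kappa> S = \<mu> + fundamental_weight 1})"
  proof (rule character_eq_card[OF n mod])
    show "level_one n ?\<kappa>"
      using n by (auto simp: level_one_def fundamental_weight_def gen_m_def q_weight_Coroot)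
    show "state_weight n ?\<kappa> (top_state False) = fundamental_weight 1"
      unfolding top by (simp add: state_weight_def top_state_def)
    show "?\<kappa> \<in> weights n"
      by (intro weights_closed q_weight_weights fundamental_weight_weights) simp
  qed (use n in \<open>simp add: fundamental_weight_weights\<close>)
  also have "{S \<in> states n. even (card S) = False \<and> state_weight n ?\<kappa> S = \<mu> + fundamental_weight 1} =
      {S \<in> states n. odd (card S) \<and> (\<Sum>u\<in>S. mode_weight n u) = \<mu> + mode_weight n (1, - 1)}"
    unfolding top state_weight_def add.left_commute[of \<mu>] add_left_cancel by auto
  also have "card \<dots> = card {S \<in> even_mode_sets n twisted_threshold. (\<Sum>u\<in>S. mode_weight n u) = \<mu>}"
    using n by (intro card_twisted[symmetric]) simp
  finally show ?thesis .
qed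

theorem theorem1p5:
  fixes n :: nat
    and scale :: "complex \<Rightarrow> 'g::ab_group_add \<Rightarrow> 'g" and bracket :: "'g \<Rightarrow> 'g \<Rightarrow> 'g"
    and h :: "nat \<Rightarrow> 'g" and d :: 'g and e f :: "nat \<Rightarrow> 'g"
    and scale0 :: "complex \<Rightarrow> 'v::ab_group_add \<Rightarrow> 'v" and act0 :: "'g \<Rightarrow> 'v \<Rightarrow> 'v"
    and scale1 :: "complex \<Rightarrow> 'w::ab_group_add \<Rightarrow> 'w" and act1 :: "'g \<Rightarrow> 'w \<Rightarrow> 'w"
  assumes "n \<ge> 3"
    and "affine_B_algebra scale bracket n h d e f"
    and "affine_B_irreducible_hw_module scale bracket n h d e f scale0 act0 (fundamental_weight 0)"
    and "affine_B_irreducible_hw_module scale bracket n h d e f scale1 act1 (fundamental_weight 1)"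
  shows
    "exp_times (- fundamental_weight 0) (character n h d scale0 act0) =
       specialize n (even_part {0..n}
         (qp2 (- c_pow 0 1 * q_pow 1) *
          (\<Prod>k=1..n. qp2 (- c_pow k 1 * q_pow 1) * qp2 (- c_pow k (-1) * q_pow 1))))
     \<and>
     specialize n (even_part {0..n}
         (qp2 (- c_pow 0 1 * q_pow 1) *
          (\<Prod>k=1..n. qp2 (- c_pow k 1 * q_pow 1) * qp2 (- c_pow k (-1) * q_pow 1)))) =
       specialize n (rat_const (1 / 2) *
         (qp2 (- q_pow 1) *
            (\<Prod>k=1..n. qp2 (- c_pow k 1 * q_pow 1) * qp2 (- c_pow k (-1) * q_pow 1)) +
          qp2 (q_pow 1) *
            (\<Prod>k=1..n. qp2 (c_pow k 1 * q_pow 1) * qp2 (c_pow k (-1) * q_pow 1))))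
     \<and>
     exp_times (- fundamental_weight 1) (character n h d scale1 act1) =
       specialize n (even_part {0..n}
         (qp2 (- c_pow 0 1 * q_pow 1) * qp2 (- c_pow 1 1 * q_pow 3) * qp2 (- c_pow 1 (-1) * q_pow (-1)) *
          (\<Prod>k=2..n. qp2 (- c_pow k 1 * q_pow 1) * qp2 (- c_pow k (-1) * q_pow 1))))
     \<and>
     specialize n (even_part {0..n}
         (qp2 (- c_pow 0 1 * q_pow 1) * qp2 (- c_pow 1 1 * q_pow 3) * qp2 (- c_pow 1 (-1) * q_pow (-1)) *
          (\<Prod>k=2..n. qp2 (- c_pow k 1 * q_pow 1) * qp2 (- c_pow k (-1) * q_pow 1)))) =
       specialize n (rat_const (1 / 2) *
         (qp2 (- q_pow 1) * qp2 (- c_pow 1 1 * q_pow 3) * qp2 (- c_pow 1 (-1) * q_pow (-1)) *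
            (\<Prod>k=2..n. qp2 (- c_pow k 1 * q_pow 1) * qp2 (- c_pow k (-1) * q_pow 1)) +
          qp2 (q_pow 1) * qp2 (c_pow 1 1 * q_pow 3) * qp2 (c_pow 1 (-1) * q_pow (-1)) *
            (\<Prod>k=2..n. qp2 (c_pow k 1 * q_pow 1) * qp2 (c_pow k (-1) * q_pow 1))))"
proof -
  have n: "1 \<le> n" "2 \<le> n" using assms(1) by simp_all
  show ?thesis
    unfolding untwisted_products twisted_products[OF n(1)]
    using character_fundamental_0[OF assms(1,3)] character_fundamental_1[OF assms(1,4)]
      specialize_even_part[OF n(2)] specialize_half_sum[OF n(2)]
    by (intro conjI ext) (simp_all only:)
qed

end
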